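(* Let $S\subseteq\mathbb{N}^p$ be a Cohen-Macaulay simplicial strong affine semigroup, with $E=\operatorname{Mult}(S)$ and $A=\operatorname{msg}(S)\setminus E$, such that $\sharp E=p$ and $A$ is non-empty. Then the set of Betti elements of $S$ is $$\{a+a'\mid a,a'\in A,\ a\ne a'\}\cup\{2a\mid 2a\in 2A\setminus\operatorname{Ap}(S,E)\}\cup\{3a\mid 2a\in 2A\cap\operatorname{Ap}(S,E)\}.$$
   Context: Here $p\ge1$ and $\mathbb{N}$ is the set of non-negative integers. An affine semigroup $S\subseteq\mathbb{N}^p$ is a finitely generated submonoid of $\mathbb{N}^p$; $\operatorname{msg}(S)$ is its unique minimal generating set; $\mathcal{C}(S)$ is the set of points of $\mathbb{N}^p$ lying in the cone of non-negative real combinations of $\operatorname{msg}(S)$. The set of multiplicities $\operatorname{Mult}(S)\subseteq\operatorname{msg}(S)$ is the set of minimal elements of $S\setminus\{0\}$ for the order $x\le_{\mathcal{C}(S)}y\iff y-x\in\mathcal{C}(S)$. $S$ is strong if for all $x,y\in S\setminus\{0\}$ with $x\neq y$ there is $e\in\operatorname{Mult}(S)$ with $x+y-e\in S$. $S$ is simplicial if the cone generated by $S$ has dimension $p$ and exactly $p$ extremal rays. $\operatorname{Ap}(S,E)=\{s\in S\mid s-e\notin S\text{ for all }e\in E\}$, and $2A=\{2a\mid a\in A\}$. In the set-builder expressions, $a$ ranges over $A$. Let $\mathbb{K}$ be a field, $E=\{e_1,\dots,e_t\}$, $A=\{a_1,\dots,a_r\}$. $S$ is Cohen-Macaulay if the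 semigroup ring $\mathbb{K}[S]$ is a Cohen-Macaulay ring. In $\mathbb{K}[x_1,\dots,x_t,y_1,\dots,y_r]$ the monomial $X^\alpha Y^\beta=x_1^{\alpha_1}\cdots x_t^{\alpha_t}y_1^{\beta_1}\cdots y_r^{\beta_r}$ has $S$-degree $\sum_i\alpha_ie_i+\sum_i\beta_ia_i$, and $I_S$ is the ideal generated by all binomials $X^\alpha Y^\beta-X^\gamma Y^\delta$ whose two monomials have the same $S$-degree. The Betti elements of $S$ are the $S$-degrees of the elements of a minimal generating set of $I_S$ consisting of such binomials (this set of degrees does not depend on the chosen minimal binomial generating set). *)

theory Defs
  imports
    "HOL-Analysis.Analysis"
    "HOL-Algebra.Ring_Divisibility"
    "HOL-Library.Extended_Nat"
    "HOL-Library.Poly_Mapping"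
begin

section \<open>Affine semigroups\<close>

definition add_submonoid :: "'a::comm_monoid_add set \<Rightarrow> bool" where
  "add_submonoid M \<longleftrightarrow> 0 \<in> M \<and> (\<forall>x\<in>M. \<forall>y\<in>M. x + y \<in> M)"

definition affine_semigroup :: "(nat ^ 'p) set \<Rightarrow> bool" where
  "affine_semigroup S \<longleftrightarrow> (\<exists>B. finite B \<and> add_submonoid hull B = S)"

definition minimal_generating_set :: "(nat ^ 'p) set \<Rightarrow> (nat ^ 'p) set \<Rightarrow> bool" where
  "minimal_generating_set S B \<longleftrightarrow>
     add_submonoid hull B = S \<and> (\<forall>B'. B' \<subset> B \<longrightarrow> add_submonoid hull B' \<noteq> S)"

text \<open>Existence and uniqueness are proved below (\<open>minimal_generating_set_iff\<close>).\<close>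

definition msg :: "(nat ^ 'p) set \<Rightarrow> (nat ^ 'p) set" where
  "msg S = (THE B. minimal_generating_set S B)"

definition real_vec :: "nat ^ 'p \<Rightarrow> real ^ 'p" where
  "real_vec x = (\<chi> i. real (x $ i))"

definition real_cone :: "(nat ^ 'p) set \<Rightarrow> (real ^ 'p) set" where
  "real_cone X =
     {\<Sum>v\<in>F. c v *\<^sub>R real_vec v | F c. finite F \<and> F \<subseteq> X \<and> (\<forall>v\<in>F. 0 \<le> c v)}"

definition lattice_cone :: "(nat ^ 'p) set \<Rightarrow> (nat ^ 'p) set" where
  "lattice_cone S = {x. real_vec x \<in> real_cone (msg S)}"

text \<open>Subtraction on \<^typ>\<open>nat\<close> truncates, so throughout, a condition of the form
  \<open>y - x \<in> T\<close> is stated as \<open>y = x + z\<close> for some \<open>z \<in> T\<close>.\<close>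

definition cone_le :: "(nat ^ 'p) set \<Rightarrow> nat ^ 'p \<Rightarrow> nat ^ 'p \<Rightarrow> bool" where
  "cone_le S x y \<longleftrightarrow> (\<exists>z\<in>lattice_cone S. y = x + z)"

definition multiplicities :: "(nat ^ 'p) set \<Rightarrow> (nat ^ 'p) set" where
  "multiplicities S = {m \<in> S - {0}. \<forall>x\<in>S - {0}. cone_le S x m \<longrightarrow> x = m}"

definition strong :: "(nat ^ 'p) set \<Rightarrow> bool" where
  "strong S \<longleftrightarrow>
     (\<forall>x\<in>S - {0}. \<forall>y\<in>S - {0}. x \<noteq> y \<longrightarrow> (\<exists>e\<in>multiplicities S. \<exists>s\<in>S. x + y = e + s))"

text \<open>The cone lies in the non-negative orthant, hence is pointed, and its extremal rays are
  its one-dimensional faces.\<close>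

definition extremal_rays :: "(real ^ 'p) set \<Rightarrow> (real ^ 'p) set set" where
  "extremal_rays C = {F. F face_of C \<and> aff_dim F = 1}"

definition simplicial :: "(nat ^ 'p) set \<Rightarrow> bool" where
  "simplicial S \<longleftrightarrow>
     dim (real_cone S) = CARD('p) \<and> card (extremal_rays (real_cone S)) = CARD('p)"

definition Apery :: "(nat ^ 'p) set \<Rightarrow> (nat ^ 'p) set \<Rightarrow> (nat ^ 'p) set" where
  "Apery S E = {s \<in> S. \<forall>e\<in>E. \<not> (\<exists>t\<in>S. s = e + t)}"


section \<open>Cohen-Macaulay rings\<close>

definition regular_sequence :: "('a, 'm) ring_scheme \<Rightarrow> 'a list \<Rightarrow> bool" where
  "regular_sequence R xs \<longleftrightarrow>
     set xs \<subseteq> carrier R \<and>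
     genideal R (set xs) \<noteq> carrier R \<and>
     (\<forall>i<length xs. \<forall>r\<in>carrier R.
        r \<otimes>\<^bsub>R\<^esub> xs ! i \<in> genideal R (set (take i xs)) \<longrightarrow> r \<in> genideal R (set (take i xs)))"

definition ideal_depth :: "('a, 'm) ring_scheme \<Rightarrow> 'a set \<Rightarrow> enat" where
  "ideal_depth R I = Sup {enat (length xs) | xs. regular_sequence R xs \<and> set xs \<subseteq> I}"

definition prime_height :: "('a, 'm) ring_scheme \<Rightarrow> 'a set \<Rightarrow> enat" where
  "prime_height R P =
     Sup {enat n | n. \<exists>Q :: nat \<Rightarrow> 'a set.
            (\<forall>i\<le>n. primeideal (Q i) R) \<and> (\<forall>i<n. Q i \<subset> Q (Suc i)) \<and> Q n = P}"

text \<open>A Noetherian ring is Cohen-Macaulay if depth and codimension agree for every maximal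
  ideal. This is the definition in Eisenbud, \<open>Commutative Algebra\<close>, Section 18.2; it avoids
  localizations, since depth and height of a maximal ideal \<open>M\<close> are the depth and the Krull
  dimension of the local ring at \<open>M\<close>.\<close>

definition cohen_macaulay_ring :: "('a, 'm) ring_scheme \<Rightarrow> bool" where
  "cohen_macaulay_ring R \<longleftrightarrow>
     cring R \<and> noetherian_ring R \<and>
     (\<forall>M. maximalideal M R \<longrightarrow> ideal_depth R M = prime_height R M)"


section \<open>Semigroup rings and Betti elements\<close>

definition semigroup_ring :: "'a::comm_monoid_add set \<Rightarrow> ('a \<Rightarrow>\<^sub>0 'k::field) ring" where
  "semigroup_ring M =
     \<lparr>carrier = {f. Poly_Mapping.keys f \<subseteq> M}, mult = (*), one = 1, zero = 0, add = (+)\<rparr>"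

definition cohen_macaulay :: "'k::field itself \<Rightarrow> (nat ^ 'p) set \<Rightarrow> bool" where
  "cohen_macaulay K S \<longleftrightarrow>
     cohen_macaulay_ring (semigroup_ring S :: (nat ^ 'p \<Rightarrow>\<^sub>0 'k) ring)"

text \<open>The polynomial ring has one variable for each element of \<^term>\<open>msg S\<close>, and the variables
  are indexed by these elements themselves. A monomial is its exponent function, so the
  polynomial ring is the semigroup ring of the monoid of exponents.\<close>

definition exponents :: "(nat ^ 'p) set \<Rightarrow> (nat ^ 'p \<Rightarrow>\<^sub>0 nat) set" where
  "exponents S = {\<alpha>. Poly_Mapping.keys \<alpha> \<subseteq> msg S}"

definition s_degree :: "(nat ^ 'p \<Rightarrow>\<^sub>0 nat) \<Rightarrow> nat ^ 'p" where
  "s_degree \<alpha> = (\<Sum>v\<in>Poly_Mapping.keys \<alpha>. Poly_Mapping.lookup \<alpha> v *s v)"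

definition monomial :: "(nat ^ 'p \<Rightarrow>\<^sub>0 nat) \<Rightarrow> ((nat ^ 'p \<Rightarrow>\<^sub>0 nat) \<Rightarrow>\<^sub>0 'k::field)" where
  "monomial \<alpha> = Poly_Mapping.single \<alpha> 1"

definition binomials :: "(nat ^ 'p) set \<Rightarrow> ((nat ^ 'p \<Rightarrow>\<^sub>0 nat) \<Rightarrow>\<^sub>0 'k::field) set" where
  "binomials S =
     {monomial \<alpha> - monomial \<beta> | \<alpha> \<beta>.
        \<alpha> \<in> exponents S \<and> \<beta> \<in> exponents S \<and> s_degree \<alpha> = s_degree \<beta>}"

definition semigroup_ideal :: "(nat ^ 'p) set \<Rightarrow> ((nat ^ 'p \<Rightarrow>\<^sub>0 nat) \<Rightarrow>\<^sub>0 'k::field) set" where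
  "semigroup_ideal S = genideal (semigroup_ring (exponents S)) (binomials S)"

definition minimal_binomial_generating_set ::
  "(nat ^ 'p) set \<Rightarrow> ((nat ^ 'p \<Rightarrow>\<^sub>0 nat) \<Rightarrow>\<^sub>0 'k::field) set \<Rightarrow> bool" where
  "minimal_binomial_generating_set S G \<longleftrightarrow>
     G \<subseteq> binomials S \<and>
     genideal (semigroup_ring (exponents S)) G = semigroup_ideal S \<and>
     (\<forall>G'. G' \<subset> G \<longrightarrow> genideal (semigroup_ring (exponents S)) G' \<noteq> semigroup_ideal S)"

text \<open>The monomials of a non-zero binomial are its keys; the zero binomial, which has no keys,
  never lies in a minimal generating set.\<close>

definition s_degrees :: "((nat ^ 'p \<Rightarrow>\<^sub>0 nat) \<Rightarrow>\<^sub>0 'k::field) set \<Rightarrow> (nat ^ 'p) set" where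
  "s_degrees G = (\<Union>g\<in>G. s_degree ` Poly_Mapping.keys g)"

text \<open>A definite description, since the degrees do not depend on the minimal binomial
  generating set.\<close>

definition betti_elements :: "'k::field itself \<Rightarrow> (nat ^ 'p) set \<Rightarrow> (nat ^ 'p) set" where
  "betti_elements K S =
     (THE D. \<exists>G :: ((nat ^ 'p \<Rightarrow>\<^sub>0 nat) \<Rightarrow>\<^sub>0 'k) set.
        minimal_binomial_generating_set S G \<and> D = s_degrees G)"


section \<open>Well-definedness\<close>

lemma add_submonoid_hull: "add_submonoid (add_submonoid hull B)"
  by (rule hull_in) (auto simp: add_submonoid_def)

lemma vec_nat_add_eq_0: "x + y = (0 :: nat ^ 'p) \<longleftrightarrow> x = 0 \<and> y = 0"
  by (auto simp: vec_eq_iff)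

lemma minimal_generating_set_iff:
  fixes S :: "(nat ^ 'p) set"
  assumes S: "add_submonoid S"
  shows "minimal_generating_set S B \<longleftrightarrow>
    B = {s \<in> S - {0}. \<forall>a\<in>S - {0}. \<forall>b\<in>S - {0}. s \<noteq> a + b}"
proof -
  define I where "I = {s \<in> S - {0}. \<forall>a\<in>S - {0}. \<forall>b\<in>S - {0}. s \<noteq> a + b}"
  have sub: "I \<subseteq> C" if C: "add_submonoid hull C = S" for C
  proof
    fix s assume s: "s \<in> I"
    show "s \<in> C"
    proof (rule ccontr)
      assume "s \<notin> C"
      have "x + y \<noteq> s" if "x \<in> S - {s}" "y \<in> S - {s}" for x y
        using s that unfolding I_def by (cases "x = 0"; cases "y = 0") auto
      then have "add_submonoid (S - {s})"
        using S s unfolding add_submonoid_def I_def by auto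
      moreover have "C \<subseteq> S - {s}"
        using C \<open>s \<notin> C\<close> hull_subset[of C add_submonoid] by auto
      ultimately have "S \<subseteq> S - {s}"
        using C hull_minimal[of C "S - {s}" add_submonoid] by simp
      then show False using s by (auto simp: I_def)
    qed
  qed
  have mem: "s \<in> add_submonoid hull I" if "s \<in> S" for s
    using that
  proof (induction "\<Sum>i\<in>UNIV. s $ i" arbitrary: s rule: less_induct)
    case less
    have hull: "0 \<in> add_submonoid hull I"
      "\<And>x y. x \<in> add_submonoid hull I \<Longrightarrow> y \<in> add_submonoid hull I \<Longrightarrow> x + y \<in> add_submonoid hull I"
      using add_submonoid_hull[of I] by (simp_all add: add_submonoid_def[of "add_submonoid hull I"])
    show ?case
    proof (cases "s = 0 \<or> s \<in> I")
      case True
      then show ?thesis using hull hull_subset[of I add_submonoid] by auto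
    next
      case False
      then obtain a b where ab: "a \<in> S - {0}" "b \<in> S - {0}" "s = a + b"
        using less.prems by (auto simp: I_def)
      have pos: "(\<Sum>i\<in>UNIV. x $ i) > 0" if "x \<noteq> 0" for x :: "nat ^ 'p"
        using that by (auto simp: vec_eq_iff intro!: sum_pos2)
      have sum: "(\<Sum>i\<in>UNIV. s $ i) = (\<Sum>i\<in>UNIV. a $ i) + (\<Sum>i\<in>UNIV. b $ i)"
        by (simp add: ab sum.distrib)
      have "a \<in> add_submonoid hull I" "b \<in> add_submonoid hull I"
        using ab sum pos[of a] pos[of b] by (auto intro!: less.hyps)
      then show ?thesis using hull ab by auto
    qed
  qed
  have gen: "add_submonoid hull I = S"
  proof
    show "add_submonoid hull I \<subseteq> S"
      using S by (intro hull_minimal) (auto simp: I_def)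
    show "S \<subseteq> add_submonoid hull I" using mem by auto
  qed
  show ?thesis
    unfolding minimal_generating_set_def I_def[symmetric]
    using sub gen by blast
qed

lemma msg_eq:
  fixes S :: "(nat ^ 'p) set"
  assumes "add_submonoid S"
  shows "msg S = {s \<in> S - {0}. \<forall>a\<in>S - {0}. \<forall>b\<in>S - {0}. s \<noteq> a + b}"
  unfolding msg_def minimal_generating_set_iff[OF assms] by simp

lemma semigroup_ring_cring:
  fixes M :: "'a::comm_monoid_add set"
  assumes M: "add_submonoid M"
  shows "cring (semigroup_ring M :: ('a \<Rightarrow>\<^sub>0 'k::field) ring)"
proof (rule cringI)
  show "abelian_group (semigroup_ring M :: ('a \<Rightarrow>\<^sub>0 'k) ring)"
  proof (rule abelian_groupI)
    fix x :: "'a \<Rightarrow>\<^sub>0 'k"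
    assume "x \<in> carrier (semigroup_ring M)"
    then show "\<exists>y\<in>carrier (semigroup_ring M). y \<oplus>\<^bsub>semigroup_ring M\<^esub> x = \<zero>\<^bsub>semigroup_ring M\<^esub>"
      by (intro bexI[of _ "- x"]) (auto simp: semigroup_ring_def)
  next
    fix x y :: "'a \<Rightarrow>\<^sub>0 'k"
    assume "x \<in> carrier (semigroup_ring M)" "y \<in> carrier (semigroup_ring M)"
    then show "x \<oplus>\<^bsub>semigroup_ring M\<^esub> y \<in> carrier (semigroup_ring M)"
      using Poly_Mapping.keys_add[of x y] by (auto simp: semigroup_ring_def)
  qed (simp_all add: semigroup_ring_def ac_simps)
  show "comm_monoid (semigroup_ring M :: ('a \<Rightarrow>\<^sub>0 'k) ring)"
  proof (rule comm_monoidI)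
    fix x y :: "'a \<Rightarrow>\<^sub>0 'k"
    assume "x \<in> carrier (semigroup_ring M)" "y \<in> carrier (semigroup_ring M)"
    then have "Poly_Mapping.keys x \<subseteq> M" "Poly_Mapping.keys y \<subseteq> M"
      by (simp_all add: semigroup_ring_def)
    then have "{a + b | a b. a \<in> Poly_Mapping.keys x \<and> b \<in> Poly_Mapping.keys y} \<subseteq> M"
      using M unfolding add_submonoid_def by blast
    then have "Poly_Mapping.keys (x * y) \<subseteq> M"
      using keys_mult[of x y] by (rule order_trans[rotated])
    then show "x \<otimes>\<^bsub>semigroup_ring M\<^esub> y \<in> carrier (semigroup_ring M)"
      by (simp add: semigroup_ring_def)
  qed (use M in \<open>simp_all add: semigroup_ring_def ac_simps add_submonoid_def\<close>)
qed (simp add: semigroup_ring_def distrib_right)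

end

theory Submission
  imports Defs "HOL-Computational_Algebra.Polynomial"
begin

text \<open>Call a monomial in the variables of \<open>A\<close> critical if it is \<open>y\<^sub>a y\<^sub>b\<close> with \<open>a \<noteq> b\<close>, \<open>y\<^sub>a\<^sup>2\<close> with
  \<open>2a\<close> outside the Apery set, or \<open>y\<^sub>a\<^sup>3\<close> with \<open>2a\<close> inside it. Since \<open>S\<close> is strong, the degree of a
  critical monomial is also the degree of a monomial that involves a variable of \<open>E\<close>, while no other
  monomial of its degree shares a variable with it. Hence every binomial generating set has an element
  of that degree. Conversely, in any other degree all monomials are connected through binomials of
  smaller degree: a monomial without critical divisor and without variables of \<open>E\<close> is alone in its
  degree, every other one reaches a monomial \<open>x\<^sub>e \<xi>\<close> with \<open>e \<in> E\<close>, and two such monomials \<open>x\<^sub>e \<xi>\<close>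
  and \<open>x\<^sub>f \<eta>\<close> are joined through one divisible by \<open>x\<^sub>e x\<^sub>f\<close>, because \<open>e + s = f + t\<close> implies \<open>s \<in> f + S\<close>.

  The last implication is extracted from the Cohen-Macaulay property: the faces of the simplicial cone
  give a chain of \<open>p + 1\<close> monomial primes, so the irrelevant maximal ideal contains a regular
  sequence of length \<open>p\<close>. By Kaplansky's elementary exchange argument, \<open>p - 1\<close> of its length remains
  modulo \<open>x\<^sup>f\<close>, which excludes elements modulo \<open>x\<^sup>f\<close> whose support has dimension at most \<open>p - 2\<close>.\<close>

section \<open>Depth in a Noetherian ring at an ideal\<close>

text \<open>The regular sequence supplied by the Cohen-Macaulay hypothesis consists of arbitrary
  elements of the maximal ideal, whereas the argument has to divide by \<open>X^f\<close> first. So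
  depth must be shown not to depend on the first nonzerodivisor. The usual proofs use Ext, or
  associated primes and prime avoidance; here they become computations with elements. The field may
  be finite, so nonzerodivisors cannot come from generic coefficients: they are built as
  \<open>g + y ^ N\<close> with a variable exponent, and the ascending chain condition leaves only
  finitely many bad exponents. The semigroup ring is not local either; instead of localizing, ideals
  are saturated with respect to the elements congruent to 1 modulo \<open>M\<close>. Taking
  \<open>R\<close> as a subset of a type-class ring keeps all this in ordinary ring arithmetic. A
  second obstacle is geometric: multiplicities are defined by minimality, not as generators of rays,
  and cone coefficients are real. Before faces are available, the \<open>p\<close> multiplicities
  must be shown to be a basis whose dual coordinates are nonnegative on \<open>S\<close>.\<close>

locale noetherian_subring =
  fixes R M :: "'a::comm_ring_1 set"
  assumes R_one: "1 \<in> R"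
    and R_add: "x \<in> R \<Longrightarrow> y \<in> R \<Longrightarrow> x + y \<in> R"
    and R_minus: "x \<in> R \<Longrightarrow> - x \<in> R"
    and R_mult: "x \<in> R \<Longrightarrow> y \<in> R \<Longrightarrow> x * y \<in> R"
    and M_sub: "M \<subseteq> R"
    and M_zero: "0 \<in> M"
    and M_add: "x \<in> M \<Longrightarrow> y \<in> M \<Longrightarrow> x + y \<in> M"
    and M_mult: "r \<in> R \<Longrightarrow> x \<in> M \<Longrightarrow> r * x \<in> M"
    and acc: "\<And>C :: nat \<Rightarrow> 'a set.
      (\<And>n. C n \<subseteq> R \<and> 0 \<in> C n \<and> (\<forall>x\<in>C n. \<forall>y\<in>C n. x + y \<in> C n) \<and> (\<forall>r\<in>R. \<forall>x\<in>C n. r * x \<in> C n))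
      \<Longrightarrow> (\<And>n. C n \<subseteq> C (Suc n)) \<Longrightarrow> \<exists>n. C (Suc n) \<subseteq> C n"
begin

lemma R_zero: "0 \<in> R"
  using R_add[OF R_one R_minus[OF R_one]] by simp

lemma R_diff: "x \<in> R \<Longrightarrow> y \<in> R \<Longrightarrow> x - y \<in> R"
  using R_add[of x "- y"] R_minus[of y] by simp

lemma R_power: "x \<in> R \<Longrightarrow> x ^ n \<in> R"
  by (induction n) (auto simp: R_one R_mult)

lemma M_R: "x \<in> M \<Longrightarrow> x \<in> R"
  using M_sub by auto

lemmas R_closed = R_zero R_one R_add R_minus R_mult R_diff R_power M_R

lemma M_mult': "r \<in> R \<Longrightarrow> x \<in> M \<Longrightarrow> x * r \<in> M"
  using M_mult[of r x] by (simp add: mult.commute)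

lemma M_power: "x \<in> M \<Longrightarrow> 0 < n \<Longrightarrow> x ^ n \<in> M"
  by (cases n) (auto simp: M_mult' R_power M_R)

section \<open>Ideals and their finite generation\<close>

definition is_ideal :: "'a set \<Rightarrow> bool" where
  "is_ideal I \<longleftrightarrow> I \<subseteq> R \<and> 0 \<in> I \<and> (\<forall>x\<in>I. \<forall>y\<in>I. x + y \<in> I) \<and> (\<forall>r\<in>R. \<forall>x\<in>I. r * x \<in> I)"

lemma idealD:
  assumes "is_ideal I"
  shows "x \<in> I \<Longrightarrow> x \<in> R" and "0 \<in> I" and "x \<in> I \<Longrightarrow> y \<in> I \<Longrightarrow> x + y \<in> I"
    and "r \<in> R \<Longrightarrow> x \<in> I \<Longrightarrow> r * x \<in> I" and "r \<in> R \<Longrightarrow> x \<in> I \<Longrightarrow> x * r \<in> I"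
    and "x \<in> I \<Longrightarrow> - x \<in> I" and "x \<in> I \<Longrightarrow> y \<in> I \<Longrightarrow> x - y \<in> I"
proof -
  show 1: "x \<in> I \<Longrightarrow> x \<in> R" "0 \<in> I" "x \<in> I \<Longrightarrow> y \<in> I \<Longrightarrow> x + y \<in> I"
    "r \<in> R \<Longrightarrow> x \<in> I \<Longrightarrow> r * x \<in> I" for x y r
    using assms by (auto simp: is_ideal_def)
  show "r \<in> R \<Longrightarrow> x \<in> I \<Longrightarrow> x * r \<in> I"
    using 1(4) by (simp add: mult.commute)
  show 2: "x \<in> I \<Longrightarrow> - x \<in> I" for x
    using 1(4)[of "- 1" x] by (simp add: R_minus R_one)
  show "x \<in> I \<Longrightarrow> y \<in> I \<Longrightarrow> x - y \<in> I"
    using 1(3)[of x "- y"] 2[of y] by simp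
qed

lemma ideal_diff_cong:
  assumes "is_ideal I" and "x - y \<in> I"
  shows "x \<in> I \<longleftrightarrow> y \<in> I"
  using idealD(3)[OF assms(1) assms(2), of y] idealD(7)[OF assms(1) _ assms(2), of x] by auto

lemma ideal_lincomb:
  assumes "is_ideal I" "r \<in> R" "s \<in> R" "x \<in> I" "y \<in> I"
  shows "r * x + s * y \<in> I" and "r * x - s * y \<in> I"
  using assms idealD(3,4,7)[OF assms(1)] by auto

text \<open>The ideal generated by \<open>J\<close> and the list, with the head adjoined last. The
  recursion turns adding one generator into a \<open>Cons\<close> step, and the base
  \<open>J\<close> lets the same notion express generation modulo an ideal.\<close>

fun comb :: "'a set \<Rightarrow> 'a list \<Rightarrow> 'a set" where
  "comb J [] = J"
| "comb J (g # gs) = {r \<in> R. \<exists>c\<in>R. r - c * g \<in> comb J gs}"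

lemma comb_ideal: "is_ideal J \<Longrightarrow> is_ideal (comb J gs)"
proof (induction gs)
  case (Cons g gs)
  then have I: "is_ideal (comb J gs)" by simp
  have "x + y \<in> comb J (g # gs)" if "x \<in> comb J (g # gs)" "y \<in> comb J (g # gs)" for x y
  proof -
    from that obtain c d where cd: "x \<in> R" "y \<in> R" "c \<in> R" "d \<in> R"
      "x - c * g \<in> comb J gs" "y - d * g \<in> comb J gs" by auto
    have "x + y - (c + d) * g \<in> comb J gs"
      using idealD(3)[OF I cd(5,6)] by (simp add: algebra_simps)
    then show ?thesis using cd by (auto simp: R_closed intro!: bexI[of _ "c + d"])
  qed
  moreover have "r * x \<in> comb J (g # gs)" if "x \<in> comb J (g # gs)" "r \<in> R" for x r
  proof -
    from that obtain c where cd: "x \<in> R" "c \<in> R" "x - c * g \<in> comb J gs" by auto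
    have "r * x - (r * c) * g \<in> comb J gs"
      using idealD(4)[OF I that(2) cd(3)] by (simp add: algebra_simps)
    then show ?thesis using cd that by (auto simp: R_closed intro!: bexI[of _ "r * c"])
  qed
  moreover have "0 \<in> comb J (g # gs)"
    using idealD(2)[OF I] by (auto simp: R_closed intro!: bexI[of _ 0])
  ultimately show ?case unfolding is_ideal_def by auto
qed simp

lemma comb_Cons_mono:
  assumes "is_ideal J"
  shows "comb J gs \<subseteq> comb J (g # gs)"
  using idealD(1)[OF comb_ideal[OF assms], of _ gs] by (auto simp: R_zero intro!: bexI[of _ 0])

lemma comb_Cons_self:
  assumes "is_ideal J" "g \<in> R"
  shows "g \<in> comb J (g # gs)"
  using idealD(2)[OF comb_ideal[OF assms(1)], of gs] assms by (auto simp: R_one intro!: bexI[of _ 1])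

lemma comb_base: "is_ideal J \<Longrightarrow> J \<subseteq> comb J gs"
proof (induction gs)
  case (Cons g gs)
  then show ?case using comb_Cons_mono[of J gs g] by (meson order_trans)
qed simp

lemma comb_least:
  assumes K: "is_ideal K" and "J \<subseteq> K" "set gs \<subseteq> K"
  shows "comb J gs \<subseteq> K"
  using assms(3)
proof (induction gs)
  case (Cons g gs)
  have "r \<in> K" if "c \<in> R" "r - c * g \<in> comb J gs" for r c
  proof -
    have "r - c * g \<in> K" "c * g \<in> K"
      using that Cons idealD(4)[OF K] by auto
    then show ?thesis using idealD(3)[OF K, of "r - c * g" "c * g"] by simp
  qed
  then show ?case by auto
qed (use assms in simp)

lemma comb_gens:
  assumes "is_ideal J" "set gs \<subseteq> R"
  shows "set gs \<subseteq> comb J gs"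
  using assms(2)
proof (induction gs)
  case (Cons g gs)
  then show ?case
    using comb_Cons_mono[OF assms(1), of gs g] comb_Cons_self[OF assms(1), of g gs]
    by (simp del: comb.simps)
qed simp

lemma comb_append: "comb J (xs @ ys) = comb (comb J ys) xs"
  by (induction xs) simp_all

lemma zero_ideal: "is_ideal {0}"
  by (auto simp: is_ideal_def R_zero)

lemma M_ideal: "is_ideal M"
  by (auto simp: is_ideal_def M_zero M_add M_mult M_R)

text \<open>If no finite list worked, prepending a missing element again and again would give a
  strictly increasing chain of ideals.\<close>

lemma finitely_generated:
  assumes J: "is_ideal J"
  obtains xs where "set xs \<subseteq> J" "J = comb {0} xs"
proof -
  define ext where "ext xs = (SOME x. x \<in> J - comb {0} xs) # xs" for xs
  define L where "L n = (ext ^^ n) []" for n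
  show ?thesis
  proof (cases "\<exists>xs. set xs \<subseteq> J \<and> J \<subseteq> comb {0} xs")
    case True
    then show ?thesis
      using that comb_least[OF J, of "{0}"] idealD(2)[OF J] by blast
  next
    case False
    have ext: "hd (ext xs) \<in> J - comb {0} xs" if "set xs \<subseteq> J" for xs
      unfolding ext_def list.sel by (rule someI_ex) (use that False in auto)
    have L: "set (L n) \<subseteq> J" for n
    proof (induction n)
      case (Suc n)
      then show ?case using ext[OF Suc] by (auto simp: L_def ext_def)
    qed (simp add: L_def)
    have LS: "L (Suc n) = hd (ext (L n)) # L n" for n
      by (simp add: L_def ext_def)
    have "\<exists>n. comb {0} (L (Suc n)) \<subseteq> comb {0} (L n)"
    proof (rule acc)
      show "comb {0} (L n) \<subseteq> comb {0} (L (Suc n))" for n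
        unfolding LS by (rule comb_Cons_mono[OF zero_ideal])
    qed (use comb_ideal[OF zero_ideal] in \<open>auto simp: is_ideal_def\<close>)
    then obtain n where n: "comb {0} (L (Suc n)) \<subseteq> comb {0} (L n)" by auto
    have "hd (ext (L n)) \<in> comb {0} (L (Suc n))"
      unfolding LS by (rule comb_Cons_self[OF zero_ideal]) (use ext[OF L[of n]] idealD(1)[OF J] in auto)
    then show ?thesis using n ext[OF L[of n]] by auto
  qed
qed

text \<open>The ascending chain condition for the ideals generated by initial segments.
  \<open>rev\<close> makes the newest term the head, so consecutive ideals differ by one
  \<open>Cons\<close>.\<close>

lemma sequence_dependent:
  assumes I: "is_ideal I" and b: "\<And>n. b n \<in> R"
  obtains n where "b n \<in> comb I (map b (rev [0..<n]))"
proof -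
  define C where "C n = comb I (map b (rev [0..<n]))" for n
  have "\<exists>n. C (Suc n) \<subseteq> C n"
  proof (rule acc)
    show "C n \<subseteq> C (Suc n)" for n
      unfolding C_def by (simp del: comb.simps add: comb_Cons_mono[OF I])
  qed (use comb_ideal[OF I] in \<open>auto simp: is_ideal_def C_def\<close>)
  then obtain n where "C (Suc n) \<subseteq> C n" by auto
  moreover have "b n \<in> C (Suc n)"
    unfolding C_def by (simp del: comb.simps add: comb_Cons_self[OF I b])
  ultimately show ?thesis using that C_def by blast
qed

text \<open>The elements of \<open>units\<close> become invertible in the localization at \<open>M\<close>. Working with ideals
  that are closed under division by them replaces passing to that localization.\<close>

definition units :: "'a set" where
  "units = {t \<in> R. 1 - t \<in> M}"

lemma units_R: "t \<in> units \<Longrightarrow> t \<in> R"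
  by (simp add: units_def)

lemma units_one: "1 \<in> units"
  by (simp add: units_def R_one M_zero)

lemma units_mult: "s \<in> units \<Longrightarrow> t \<in> units \<Longrightarrow> s * t \<in> units"
proof -
  assume st: "s \<in> units" "t \<in> units"
  have "(1 - s) + s * (1 - t) \<in> M" using st by (intro M_add M_mult) (auto simp: units_def)
  moreover have "(1 - s) + s * (1 - t) = 1 - s * t" by (simp add: algebra_simps)
  ultimately show ?thesis using st by (simp add: units_def R_mult)
qed

lemma units_diff: "t \<in> units \<Longrightarrow> m \<in> M \<Longrightarrow> t - m \<in> units"
  using M_add[of "1 - t" m] by (auto simp: units_def R_diff M_R algebra_simps)

section \<open>Saturated ideals and depth\<close>

definition closed_ideal :: "'a set \<Rightarrow> bool" where
  "closed_ideal I \<longleftrightarrow> is_ideal I \<and> (\<forall>t\<in>units. \<forall>r\<in>R. t * r \<in> I \<longrightarrow> r \<in> I)"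

text \<open>The saturation of \<open>I + R z\<close>, that is, the contraction of its extension to
  the localization at \<open>units\<close>. The choice \<open>z = 0\<close> saturates
  \<open>I\<close> alone.\<close>

definition adjoin :: "'a set \<Rightarrow> 'a \<Rightarrow> 'a set" where
  "adjoin I z = {r \<in> R. \<exists>t\<in>units. \<exists>c\<in>R. t * r - c * z \<in> I}"

definition nonzerodivisor :: "'a set \<Rightarrow> 'a \<Rightarrow> bool" where
  "nonzerodivisor I z \<longleftrightarrow> (\<forall>r\<in>R. z * r \<in> I \<longrightarrow> r \<in> I)"

definition quotient :: "'a set \<Rightarrow> 'a \<Rightarrow> 'a set" where
  "quotient I b = {r \<in> R. r * b \<in> I}"

text \<open>Properness is not part of the notion: the whole ring has every depth. Upper bounds
  therefore always speak of an element outside \<open>I\<close>.\<close>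

fun depth_ge :: "'a set \<Rightarrow> nat \<Rightarrow> bool" where
  "depth_ge I 0 = True"
| "depth_ge I (Suc n) = (\<exists>z\<in>M. nonzerodivisor I z \<and> depth_ge (adjoin I z) n)"

lemma closed_idealD: "closed_ideal I \<Longrightarrow> is_ideal I"
  by (simp add: closed_ideal_def)

lemma closed_idealD2: "closed_ideal I \<Longrightarrow> t \<in> units \<Longrightarrow> r \<in> R \<Longrightarrow> t * r \<in> I \<Longrightarrow> r \<in> I"
  by (simp add: closed_ideal_def)

lemma adjoinI: "r \<in> R \<Longrightarrow> t \<in> units \<Longrightarrow> c \<in> R \<Longrightarrow> t * r - c * z \<in> I \<Longrightarrow> r \<in> adjoin I z"
  by (auto simp: adjoin_def)

lemma adjoinE:
  assumes "r \<in> adjoin I z"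
  obtains t c where "r \<in> R" "t \<in> units" "c \<in> R" "t * r - c * z \<in> I"
  using assms by (auto simp: adjoin_def)

lemma nonzerodivisorD: "nonzerodivisor I z \<Longrightarrow> r \<in> R \<Longrightarrow> z * r \<in> I \<Longrightarrow> r \<in> I"
  by (simp add: nonzerodivisor_def)

lemma adjoin_closed_ideal:
  assumes I: "is_ideal I" and z: "z \<in> R"
  shows "closed_ideal (adjoin I z)"
proof -
  have "x + y \<in> adjoin I z" if "x \<in> adjoin I z" "y \<in> adjoin I z" for x y
  proof -
    from that obtain s c t d where *: "x \<in> R" "s \<in> units" "c \<in> R" "s * x - c * z \<in> I"
      "y \<in> R" "t \<in> units" "d \<in> R" "t * y - d * z \<in> I" by (auto elim!: adjoinE)
    have "(s * t) * (x + y) - (t * c + s * d) * z = t * (s * x - c * z) + s * (t * y - d * z)"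
      by (simp add: algebra_simps)
    also have "\<dots> \<in> I" by (rule ideal_lincomb[OF I]) (use * units_R in auto)
    finally show ?thesis
      by (rule adjoinI[rotated 3]) (use * in \<open>auto simp: R_closed units_mult units_R\<close>)
  qed
  moreover have "r * x \<in> adjoin I z" if "x \<in> adjoin I z" "r \<in> R" for x r
  proof -
    from that obtain t c where *: "x \<in> R" "t \<in> units" "c \<in> R" "t * x - c * z \<in> I"
      by (auto elim!: adjoinE)
    have "t * (r * x) - (r * c) * z = r * (t * x - c * z)" by (simp add: algebra_simps)
    also have "\<dots> \<in> I" using * that by (auto intro!: idealD(4)[OF I])
    finally show ?thesis
      by (rule adjoinI[rotated 3]) (use * that in \<open>auto simp: R_closed\<close>)
  qed
  moreover have "0 \<in> adjoin I z"
    by (rule adjoinI[of _ 1 0]) (auto simp: R_closed units_one idealD(2)[OF I])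
  moreover have "r \<in> adjoin I z" if tr: "t \<in> units" "r \<in> R" "t * r \<in> adjoin I z" for t r
  proof -
    from tr(3) obtain s c where "s \<in> units" "c \<in> R" "s * (t * r) - c * z \<in> I"
      by (auto elim!: adjoinE)
    then show ?thesis
      using tr by (intro adjoinI[of _ "s * t" c]) (auto simp: units_mult mult.assoc)
  qed
  moreover have "adjoin I z \<subseteq> R" by (auto simp: adjoin_def)
  ultimately show ?thesis
    unfolding closed_ideal_def is_ideal_def by blast
qed

lemma adjoin_mono: 
  assumes "is_ideal I"
  shows "I \<subseteq> adjoin I z"
  using idealD(1)[OF assms] by (auto intro!: adjoinI[of _ 1 0] simp: units_one R_closed)

lemma adjoin_self:
  assumes "is_ideal I" "z \<in> R"
  shows "z \<in> adjoin I z"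
  using idealD(2)[OF assms(1)] assms by (auto intro!: adjoinI[of _ 1 1] simp: units_one R_closed)

text \<open>Clearing denominators leaves a single unit for both generators, a description symmetric
  in \<open>x\<close> and \<open>z\<close>.\<close>

lemma adjoin_adjoin:
  assumes I: "is_ideal I" and xz: "x \<in> R" "z \<in> R"
  shows "adjoin (adjoin I x) z = {r \<in> R. \<exists>t\<in>units. \<exists>c\<in>R. \<exists>d\<in>R. t * r - c * x - d * z \<in> I}"
proof (intro equalityI subsetI)
  fix r assume "r \<in> adjoin (adjoin I x) z"
  then obtain t d s c where *: "r \<in> R" "t \<in> units" "d \<in> R" "s \<in> units" "c \<in> R"
    "s * (t * r - d * z) - c * x \<in> I"
    by (auto elim!: adjoinE)
  have "s * (t * r - d * z) - c * x = (s * t) * r - c * x - (s * d) * z"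
    by (simp add: algebra_simps)
  then have "(s * t) * r - c * x - (s * d) * z \<in> I" using *(6) by metis
  then show "r \<in> {r \<in> R. \<exists>t\<in>units. \<exists>c\<in>R. \<exists>d\<in>R. t * r - c * x - d * z \<in> I}"
    using * units_mult[of s t] R_mult[of s d] units_R[of s] by blast
next
  fix r assume "r \<in> {r \<in> R. \<exists>t\<in>units. \<exists>c\<in>R. \<exists>d\<in>R. t * r - c * x - d * z \<in> I}"
  then obtain t c d where *: "r \<in> R" "t \<in> units" "c \<in> R" "d \<in> R" "t * r - c * x - d * z \<in> I"
    by auto
  have "t * r - d * z \<in> adjoin I x"
    using * xz by (intro adjoinI[of _ 1 c]) (auto simp: units_one R_closed units_R algebra_simps)
  then show "r \<in> adjoin (adjoin I x) z" using * by (intro adjoinI[of r t d z "adjoin I x"]) auto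
qed

lemma adjoin_commute:
  assumes "is_ideal I" "x \<in> R" "z \<in> R"
  shows "adjoin (adjoin I x) z = adjoin (adjoin I z) x"
proof -
  have "adjoin (adjoin I x) z \<subseteq> adjoin (adjoin I z) x" if xz: "x \<in> R" "z \<in> R" for x z
  proof
    fix r assume "r \<in> adjoin (adjoin I x) z"
    then obtain t c d where *: "r \<in> R" "t \<in> units" "c \<in> R" "d \<in> R" "t * r - c * x - d * z \<in> I"
      unfolding adjoin_adjoin[OF assms(1) xz] by auto
    have "t * r - d * z - c * x \<in> I" using *(5) by (simp add: algebra_simps)
    then show "r \<in> adjoin (adjoin I z) x"
      unfolding adjoin_adjoin[OF assms(1) xz(2,1)] using * by blast
  qed
  then show ?thesis using assms by blast
qed

text \<open>If \<open>x * r = c * z\<close> up to units modulo \<open>I\<close>, then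
  \<open>c\<close> is a multiple of \<open>x\<close> because \<open>z\<close> is a nonzerodivisor
  modulo \<open>x\<close>; cancelling \<open>x\<close> exhibits \<open>r\<close> as a multiple of
  \<open>z\<close>. This half of exchanging \<open>x\<close> and \<open>z\<close> requires no form
  of Nakayama's lemma.\<close>

lemma nonzerodivisor_swap:
  assumes I: "is_ideal I" and xz: "x \<in> R" "z \<in> R"
    and x: "nonzerodivisor I x" and z: "nonzerodivisor (adjoin I x) z"
  shows "nonzerodivisor (adjoin I z) x"
  unfolding nonzerodivisor_def
proof (intro ballI impI)
  fix r assume r: "r \<in> R" "x * r \<in> adjoin I z"
  then obtain t c where tc: "t \<in> units" "c \<in> R" "t * (x * r) - c * z \<in> I"
    by (auto elim!: adjoinE)
  have "z * c \<in> adjoin I x"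
    by (rule adjoinI[of _ 1 "t * r"])
      (use tc r xz idealD(6)[OF I tc(3)] in \<open>auto simp: R_closed units_one units_R algebra_simps\<close>)
  then have "c \<in> adjoin I x" using nonzerodivisorD[OF z] tc by auto
  then obtain s d where sd: "s \<in> units" "d \<in> R" "s * c - d * x \<in> I" by (auto elim!: adjoinE)
  have "x * ((s * t) * r - d * z) = s * (t * (x * r) - c * z) + z * (s * c - d * x)"
    by (simp add: algebra_simps)
  also have "\<dots> \<in> I"
    by (rule ideal_lincomb[OF I _ xz(2) tc(3) sd(3)]) (use sd units_R in auto)
  finally have "(s * t) * r - d * z \<in> I"
    by (rule nonzerodivisorD[OF x, rotated]) (use r tc sd xz in \<open>auto simp: R_closed units_R\<close>)
  then show "r \<in> adjoin I z"
    using r tc sd by (intro adjoinI[of _ "s * t" d]) (auto simp: units_mult)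
qed

text \<open>The witness \<open>v\<close> is defined by \<open>z * u = v * x\<close> up to units
  modulo \<open>I\<close>. This is the hands-on form of the fact that the socle modulo a
  nonzerodivisor \<open>x\<close> corresponds to Ext^1(R/M, R/I), which does not depend on
  \<open>x\<close>.\<close>

lemma socle_transfer:
  assumes I: "is_ideal I" and xz: "x \<in> R" "z \<in> M"
    and nz: "nonzerodivisor I x" "nonzerodivisor I z"
    and u: "u \<in> R" "u \<notin> adjoin I x" "\<And>m. m \<in> M \<Longrightarrow> m * u \<in> adjoin I x"
  shows "\<exists>v\<in>R. v \<notin> adjoin I z \<and> (\<forall>m\<in>M. m * v \<in> adjoin I z)"
proof -
  obtain t v where tv: "t \<in> units" "v \<in> R" "t * (z * u) - v * x \<in> I"
    using u(3)[OF xz(2)] by (auto elim!: adjoinE)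
  have zR: "z \<in> R" using xz M_R by auto
  have "v \<notin> adjoin I z"
  proof
    assume "v \<in> adjoin I z"
    then obtain s d where sd: "s \<in> units" "d \<in> R" "s * v - d * z \<in> I" by (auto elim!: adjoinE)
    have "z * ((s * t) * u - d * x) = s * (t * (z * u) - v * x) + x * (s * v - d * z)"
      by (simp add: algebra_simps)
    also have "\<dots> \<in> I"
      by (rule ideal_lincomb[OF I _ xz(1) tv(3) sd(3)]) (use sd units_R in auto)
    finally have "(s * t) * u - d * x \<in> I"
      by (rule nonzerodivisorD[OF nz(2), rotated]) (use u tv sd xz in \<open>auto simp: R_closed units_R\<close>)
    then show False
      using u tv sd adjoinI[of u "s * t" d x I] by (auto simp: units_mult)
  qed
  moreover have "m * v \<in> adjoin I z" if m: "m \<in> M" for m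
  proof -
    obtain s c where sc: "s \<in> units" "c \<in> R" "s * (m * u) - c * x \<in> I"
      using u(3)[OF m] by (auto elim!: adjoinE)
    have "x * (s * (m * v) - (t * c) * z) =
        t * z * (s * (m * u) - c * x) - s * m * (t * (z * u) - v * x)"
      by (simp add: algebra_simps)
    also have "\<dots> \<in> I"
      by (rule ideal_lincomb[OF I _ _ sc(3) tv(3)]) (use tv sc zR m in \<open>auto simp: R_closed units_R\<close>)
    finally have "s * (m * v) - (t * c) * z \<in> I"
      by (rule nonzerodivisorD[OF nz(1), rotated]) (use m tv sc zR in \<open>auto simp: R_closed units_R\<close>)
    then show ?thesis
      using m tv sc by (intro adjoinI[of _ s "t * c"]) (auto simp: R_closed units_R)
  qed
  ultimately show ?thesis using tv by blast
qed

section \<open>Nonzerodivisors found by varying an exponent\<close>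

lemma quotient_ideal:
  assumes I: "is_ideal I" and "b \<in> R"
  shows "is_ideal (quotient I b)"
proof -
  have "(x + y) * b \<in> I" if "x * b \<in> I" "y * b \<in> I" for x y
    using idealD(3)[OF I that] by (simp add: distrib_right)
  moreover have "(r * x) * b \<in> I" if "r \<in> R" "x * b \<in> I" for r x
    using idealD(4)[OF I that] by (simp add: mult.assoc)
  ultimately show ?thesis
    using idealD(2)[OF I] by (simp add: is_ideal_def quotient_def R_zero R_add R_mult subset_iff)
qed

text \<open>For bad exponents \<open>e\<^sub>0 < e\<^sub>1 < \<dots>\<close> with witnesses \<open>b\<^sub>0, b\<^sub>1, \<dots>\<close>, the ascending chain
  condition expresses some \<open>b\<^sub>n\<close> by its predecessors modulo \<open>I\<close>, so the product of the
  \<open>x + y ^ e\<^sub>i\<close> with \<open>i < n\<close> annihilates \<open>b\<^sub>n\<close>. On \<open>b\<^sub>n\<close> the element \<open>x\<close> acts as \<open>- y ^ e\<^sub>n\<close>, so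
  this product acts as a power of \<open>y\<close> times a unit.\<close>

lemma finite_bad_exponents:
  assumes I: "closed_ideal I" and x: "x \<in> R" and y: "y \<in> M"
  shows "finite {N. \<exists>b\<in>R. (x + y ^ N) * b \<in> I \<and> (\<forall>j. y ^ j * b \<notin> I)}" (is "finite ?B")
proof (rule ccontr)
  note I' = closed_idealD[OF I]
  assume inf: "infinite ?B"
  define e where "e = enumerate ?B"
  have "\<forall>n. \<exists>b. b \<in> R \<and> (x + y ^ e n) * b \<in> I \<and> (\<forall>j. y ^ j * b \<notin> I)"
    using enumerate_in_set[OF inf] by (auto simp: e_def)
  then obtain b where b: "\<And>n. b n \<in> R" "\<And>n. (x + y ^ e n) * b n \<in> I" "\<And>n j. y ^ j * b n \<notin> I"
    by metis
  obtain n where n: "b n \<in> comb I (map b (rev [0..<n]))"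
    using sequence_dependent[OF I'] b(1) by blast
  define P where "P k = (\<Prod>i<k. x + y ^ e i)" for k
  have PR: "P k \<in> R" for k
    by (induction k) (use x y in \<open>auto simp: P_def R_closed\<close>)
  have fac: "(x + y ^ e i) * prod (\<lambda>i. x + y ^ e i) ({..<n} - {i}) = P n" if "i < n" for i
    unfolding P_def using that by (simp add: prod.remove[of "{..<n}" i])
  have prodR: "prod (\<lambda>i. x + y ^ e i) A \<in> R" if "finite A" for A
    using that by induction (use x y in \<open>auto simp: R_closed\<close>)
  have "b n \<in> quotient I (P n)"
  proof (rule subsetD[OF comb_least n])
    show "is_ideal (quotient I (P n))" by (rule quotient_ideal[OF I' PR])
    show "I \<subseteq> quotient I (P n)"
      using idealD(1)[OF I'] idealD(5)[OF I' PR] by (auto simp: quotient_def)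
    show "set (map b (rev [0..<n])) \<subseteq> quotient I (P n)"
    proof
      fix u assume "u \<in> set (map b (rev [0..<n]))"
      then obtain i where i: "i < n" "u = b i" by auto
      have "u * P n = prod (\<lambda>i. x + y ^ e i) ({..<n} - {i}) * ((x + y ^ e i) * b i)"
        unfolding i(2) fac[OF i(1), symmetric] by (simp add: algebra_simps)
      also have "\<dots> \<in> I" by (rule idealD(4)[OF I' prodR b(2)]) simp
      finally show "u \<in> quotient I (P n)" using i b by (simp add: quotient_def)
    qed
  qed
  then have Pb: "b n * P n \<in> I" by (simp add: quotient_def)
  have "\<exists>m. \<exists>t\<in>units. b n * P k - t * (y ^ m * b n) \<in> I" if "k \<le> n" for k
    using that
  proof (induction k)
    case 0
    show ?case
      by (rule exI[of _ 0], rule bexI[of _ 1]) (simp_all add: P_def units_one idealD(2)[OF I'])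
  next
    case (Suc k)
    then obtain m t where t: "t \<in> units" "b n * P k - t * (y ^ m * b n) \<in> I" by auto
    have lt: "e k < e n"
      unfolding e_def using Suc.prems inf by (intro enumerate_mono) auto
    \<comment> \<open>By the relation for \<open>b n\<close>, the factor \<open>x + y ^ e k\<close>
      acts as \<open>y ^ e k - y ^ e n\<close>. What remains after extracting \<open>y ^ e k\<close>
      is a unit because \<open>e k < e n\<close>; this is why the exponents are enumerated
      increasingly.\<close>
    define t' where "t' = t * (1 - y ^ (e n - e k))"
    have t': "t' \<in> units"
      unfolding t'_def using t(1) lt y by (auto intro!: units_mult units_diff units_one M_power)
    have pow: "y ^ e n = y ^ e k * y ^ (e n - e k)"
      using lt by (simp flip: power_add)
    have eq: "b n * P (Suc k) - t' * (y ^ (m + e k) * b n) =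
        (x + y ^ e k) * (b n * P k - t * (y ^ m * b n)) + (t * y ^ m) * ((x + y ^ e n) * b n)"
      unfolding P_def t'_def pow by (simp add: algebra_simps power_add)
    have "\<dots> \<in> I"
      by (rule ideal_lincomb[OF I' _ _ t(2) b(2)]) (use x y t in \<open>auto simp: R_closed units_R\<close>)
    then show ?case using t' unfolding eq[symmetric] by blast
  qed
  then obtain m t where t: "t \<in> units" "b n * P n - t * (y ^ m * b n) \<in> I" by blast
  then have "t * (y ^ m * b n) \<in> I"
    using ideal_diff_cong[OF I' t(2)] Pb by simp
  then have "y ^ m * b n \<in> I"
    by (rule closed_idealD2[OF I t(1), rotated]) (use y b in \<open>auto simp: R_closed\<close>)
  then show False using b(3) by auto
qed

text \<open>A substitute for prime avoidance. In terms of associated primes: each one of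
  \<open>R/I\<close> that contains \<open>y\<close> contains all of \<open>X\<close>. So
  \<open>y\<close> avoids as many of them as an element of the ideal generated by \<open>X\<close>
  can.\<close>

definition detects :: "'a set \<Rightarrow> 'a set \<Rightarrow> 'a \<Rightarrow> bool" where
  "detects I X y \<longleftrightarrow>
     (\<forall>w\<in>R. w \<notin> I \<longrightarrow> y * w \<in> I \<longrightarrow> (\<exists>r\<in>R. r * w \<notin> I \<and> (\<forall>x\<in>X. x * (r * w) \<in> I)))"

text \<open>For all but finitely many exponents, whatever \<open>g + y ^ N\<close> kills modulo
  \<open>I\<close> is killed by a power of \<open>y\<close>. The last multiple
  \<open>y ^ i * w\<close> outside \<open>I\<close> is killed by \<open>y\<close>, hence has a
  multiple outside \<open>I\<close> killed by \<open>X\<close>; and \<open>g\<close> acts on it as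
  \<open>- y ^ N\<close>, that is, as zero.\<close>

lemma detects_step:
  assumes fin: "finite \<I>" and I: "\<And>I. I \<in> \<I> \<Longrightarrow> closed_ideal I"
    and det: "\<And>I. I \<in> \<I> \<Longrightarrow> detects I X y" and y: "y \<in> M" and g: "g \<in> R"
  obtains N where "N > 0" "\<And>I. I \<in> \<I> \<Longrightarrow> detects I (insert g X) (g + y ^ N)"
proof -
  \<comment> \<open>Each ideal of the family forbids finitely many exponents, so one
    \<open>N\<close> suits them all. Excluding \<open>N = 0\<close> makes \<open>y\<close> divide
    \<open>y ^ N\<close>.\<close>
  have "finite ({0} \<union> (\<Union>I\<in>\<I>. {N. \<exists>b\<in>R. (g + y ^ N) * b \<in> I \<and> (\<forall>j. y ^ j * b \<notin> I)}))"
    by (intro finite_UnI finite_UN_I fin finite_bad_exponents I g y) simp_all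
  then obtain N where
    *: "N \<notin> {0} \<union> (\<Union>I\<in>\<I>. {N. \<exists>b\<in>R. (g + y ^ N) * b \<in> I \<and> (\<forall>j. y ^ j * b \<notin> I)})"
    using ex_new_if_finite[OF infinite_UNIV_nat] by meson
  have N: "\<exists>j. y ^ j * b \<in> I" if "I \<in> \<I>" "b \<in> R" "(g + y ^ N) * b \<in> I" for I b
    using * that by auto
  have N0: "N > 0" using * by auto
  have "detects I (insert g X) (g + y ^ N)" if II: "I \<in> \<I>" for I
    unfolding detects_def
  proof (intro ballI impI)
    fix w assume w: "w \<in> R" "w \<notin> I" "(g + y ^ N) * w \<in> I"
    note I' = closed_idealD[OF I[OF II]]
    define j where "j = (LEAST j. y ^ j * w \<in> I)"
    have j: "y ^ j * w \<in> I"
      unfolding j_def using N[OF II w(1,3)] by (rule LeastI_ex)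
    then have "j \<noteq> 0" using w by (intro notI) auto
    then obtain i where i: "j = Suc i" by (cases j) auto
    define v where "v = y ^ i * w"
    have v: "v \<in> R" using w y by (auto simp: v_def R_closed)
    have vI: "v \<notin> I"
      unfolding v_def using not_less_Least[of i "\<lambda>j. y ^ j * w \<in> I"] i by (simp add: j_def)
    have yv: "y * v \<in> I" using j by (simp add: v_def i mult.assoc)
    obtain r where r: "r \<in> R" "r * v \<notin> I" "\<And>x. x \<in> X \<Longrightarrow> x * (r * v) \<in> I"
      using det[OF II] v vI yv by (auto simp: detects_def)
    have "g * v = y ^ i * ((g + y ^ N) * w) - y ^ (N - 1) * (y * v)"
      using N0 by (cases N) (auto simp: v_def algebra_simps)
    also have "\<dots> \<in> I"
      by (rule ideal_lincomb[OF I' _ _ w(3) yv]) (use y in \<open>auto simp: R_closed\<close>)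
    finally have "r * (g * v) \<in> I" using r idealD(4)[OF I'] by auto
    then have "g * (r * v) \<in> I" by (simp add: algebra_simps)
    then show "\<exists>r\<in>R. r * w \<notin> I \<and> (\<forall>x\<in>insert g X. x * (r * w) \<in> I)"
      using r y by (intro bexI[of _ "r * y ^ i"]) (auto simp: v_def mult.assoc R_closed)
  qed
  then show ?thesis using that N0 by blast
qed

text \<open>Starting from \<open>0\<close>, which detects the empty set, each new generator
  \<open>g\<close> replaces \<open>y\<close> by \<open>g + y ^ N\<close>; the result stays in the
  ideal generated by the list.\<close>

lemma detects_exists:
  assumes fin: "finite \<I>" and I: "\<And>I. I \<in> \<I> \<Longrightarrow> closed_ideal I" and "set xs \<subseteq> M"
  shows "\<exists>y\<in>comb {0} xs. \<forall>I\<in>\<I>. detects I (set xs) y"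
  using assms(3)
proof (induction xs)
  case Nil
  have "detects I {} 0" for I
    unfolding detects_def by (auto intro!: bexI[of _ 1] R_one)
  then show ?case by simp
next
  case (Cons g xs)
  then obtain y where y: "y \<in> comb {0} xs" "\<forall>I\<in>\<I>. detects I (set xs) y" by auto
  have yM: "y \<in> M"
    using y(1) comb_least[OF M_ideal, of "{0}" xs] Cons.prems M_zero by auto
  have g: "g \<in> R" using Cons.prems M_R by auto
  obtain N where N: "N > 0" "\<And>I. I \<in> \<I> \<Longrightarrow> detects I (insert g (set xs)) (g + y ^ N)"
    using detects_step[OF fin I _ yM g, of "set xs"] y by blast
  have "y ^ N = y ^ (N - 1) * y" using N by (cases N) auto
  then have "y ^ N \<in> comb {0} xs"
    using idealD(4)[OF comb_ideal[OF zero_ideal] _ y(1)] yM by (simp add: R_closed)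
  then have "g + y ^ N \<in> comb {0} (g # xs)"
    using g yM by (auto simp: R_closed intro!: bexI[of _ 1])
  then show ?case using N by (intro bexI[of _ "g + y ^ N"]) auto
qed

text \<open>Take \<open>z\<close> detecting generators of \<open>M\<close>. If \<open>z\<close> were
  a zero divisor modulo some \<open>I\<close> of the family, there would be an element outside
  \<open>I\<close> killed by all of \<open>M\<close>.\<close>

lemma exists_nonzerodivisor:
  assumes fin: "finite \<I>" and I: "\<And>I. I \<in> \<I> \<Longrightarrow> closed_ideal I"
    and soc: "\<And>I w. I \<in> \<I> \<Longrightarrow> w \<in> R \<Longrightarrow> w \<notin> I \<Longrightarrow> \<exists>m\<in>M. m * w \<notin> I"
  obtains z where "z \<in> M" "\<And>I. I \<in> \<I> \<Longrightarrow> nonzerodivisor I z"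
proof -
  obtain xs where xs: "set xs \<subseteq> M" "M = comb {0} xs"
    using finitely_generated[OF M_ideal] .
  obtain z where z: "z \<in> M" "\<forall>I\<in>\<I>. detects I (set xs) z"
    using detects_exists[OF fin I xs(1)] xs(2) by auto
  have "nonzerodivisor I z" if II: "I \<in> \<I>" for I
    unfolding nonzerodivisor_def
  proof (intro ballI impI, rule ccontr)
    note I' = closed_idealD[OF I[OF II]]
    fix w assume "w \<in> R" "z * w \<in> I" "w \<notin> I"
    then obtain r where r: "r \<in> R" "r * w \<notin> I" "\<forall>x\<in>set xs. x * (r * w) \<in> I"
      using z(2) II unfolding detects_def by blast
    have rw: "r * w \<in> R" using r \<open>w \<in> R\<close> by (auto simp: R_closed)
    have "M \<subseteq> quotient I (r * w)"
      unfolding xs(2)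
    proof (rule comb_least[OF quotient_ideal[OF I' rw]])
      show "{0} \<subseteq> quotient I (r * w)"
        using idealD(2)[OF I'] by (auto simp: quotient_def R_zero)
      show "set xs \<subseteq> quotient I (r * w)"
        using r xs M_R by (auto simp: quotient_def)
    qed
    then show False using soc[OF II rw r(2)] by (auto simp: quotient_def)
  qed
  then show ?thesis using that z by blast
qed

text \<open>Let \<open>y\<close> start a given sequence, and let \<open>z\<close> be a
  nonzerodivisor modulo \<open>x\<close> and modulo \<open>y\<close>; it exists because
  \<open>socle_transfer\<close> carries the absence of a socle from \<open>y\<close> to
  \<open>x\<close>. The start of the sequence is changed from \<open>y, z\<close> to
  \<open>z, y\<close>, then to \<open>z, x\<close>, and finally to \<open>x, z\<close>. The
  induction hypothesis gives the sequence starting with \<open>y, z\<close> and the middle change;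
  the other two are swaps.\<close>

lemma depth_adjoin:
  assumes "closed_ideal I" "depth_ge I (Suc n)" "x \<in> M" "nonzerodivisor I x"
  shows "depth_ge (adjoin I x) n"
  using assms
proof (induction n arbitrary: I x)
  case (Suc n)
  note I = closed_idealD[OF Suc.prems(1)]
  have xR: "x \<in> R" using Suc.prems M_R by auto
  obtain y where y: "y \<in> M" "nonzerodivisor I y" "depth_ge (adjoin I y) (Suc n)"
    using Suc.prems(2) by auto
  have yR: "y \<in> R" using y M_R by auto
  have soc_y: "\<exists>m\<in>M. m * w \<notin> adjoin I y" if "w \<in> R" "w \<notin> adjoin I y" for w
    using y(3) that by (auto simp: nonzerodivisor_def)
  have soc_x: "\<exists>m\<in>M. m * w \<notin> adjoin I x" if w: "w \<in> R" "w \<notin> adjoin I x" for w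
  proof (rule ccontr)
    assume "\<not> (\<exists>m\<in>M. m * w \<notin> adjoin I x)"
    then have *: "m * w \<in> adjoin I x" if "m \<in> M" for m using that by blast
    show False
      using socle_transfer[OF I xR y(1) Suc.prems(4) y(2) w *] soc_y by meson
  qed
  have soc_I: "\<exists>m\<in>M. m * w \<notin> I" if "w \<in> R" "w \<notin> I" for w
    using y(1,2) that by (auto simp: nonzerodivisor_def)
  have "closed_ideal K" if "K \<in> {I, adjoin I x, adjoin I y}" for K
    using that Suc.prems(1) adjoin_closed_ideal[OF I] xR yR by auto
  moreover have "\<exists>m\<in>M. m * w \<notin> K"
    if "K \<in> {I, adjoin I x, adjoin I y}" "w \<in> R" "w \<notin> K" for K w
    using that soc_x soc_y soc_I by auto
  ultimately obtain z where z: "z \<in> M"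
    and nz': "\<And>K. K \<in> {I, adjoin I x, adjoin I y} \<Longrightarrow> nonzerodivisor K z"
    using exists_nonzerodivisor[of "{I, adjoin I x, adjoin I y}"] by (metis finite.emptyI finite.insertI)
  then have nz: "nonzerodivisor I z" "nonzerodivisor (adjoin I x) z" "nonzerodivisor (adjoin I y) z"
    by auto
  have zR: "z \<in> R" using z M_R by auto
  have "depth_ge (adjoin (adjoin I y) z) n"
    by (rule Suc.IH[OF adjoin_closed_ideal[OF I yR] y(3) z nz(3)])
  then have "depth_ge (adjoin I z) (Suc n)"
    using y(1) nonzerodivisor_swap[OF I yR zR y(2) nz(3)] adjoin_commute[OF I yR zR] by auto
  then have "depth_ge (adjoin (adjoin I z) x) n"
    using nonzerodivisor_swap[OF I xR zR Suc.prems(4) nz(2)] Suc.prems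
    by (intro Suc.IH adjoin_closed_ideal[OF I zR]) auto
  then show ?case
    using z nz(2) adjoin_commute[OF I xR zR] by auto
qed simp

text \<open>A form of Nakayama's lemma: dividing \<open>b\<close> by \<open>g\<close> as often as possible leads outside
  \<open>adjoin I g\<close>, and the annihilator modulo \<open>I\<close> does not shrink on the way.\<close>

lemma nakayama_lift:
  assumes I: "closed_ideal I" and g: "g \<in> M" and nz: "nonzerodivisor I g"
    and b: "b \<in> R" "b \<notin> I"
  obtains c where "c \<in> R" "c \<notin> adjoin I g" "quotient I b \<subseteq> quotient I c"
proof -
  note I' = closed_idealD[OF I]
  have gR: "g \<in> R" using g M_R by auto
  \<comment> \<open>\<open>P c\<close> expresses that \<open>c\<close> is \<open>b\<close> divided
    by a power of \<open>g\<close>, up to a unit and modulo \<open>I\<close>.\<close>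
  define P where "P c \<longleftrightarrow> c \<in> R \<and> (\<exists>k. \<exists>t\<in>units. g ^ k * c - t * b \<in> I)" for c
  have "\<exists>c. P c \<and> c \<notin> adjoin I g"
  proof (rule ccontr)
    assume contra: "\<nexists>c. P c \<and> c \<notin> adjoin I g"
    have step: "\<exists>d. P d \<and> (\<exists>t\<in>units. t * c - d * g \<in> I)" if "P c" for c
    proof -
      obtain k s where c: "c \<in> R" "s \<in> units" "g ^ k * c - s * b \<in> I"
        using \<open>P c\<close> by (auto simp: P_def)
      obtain t d where td: "t \<in> units" "d \<in> R" "t * c - d * g \<in> I"
        using contra \<open>P c\<close> by (auto elim!: adjoinE)
      have "g ^ Suc k * d - (t * s) * b = t * (g ^ k * c - s * b) - g ^ k * (t * c - d * g)"
        by (simp add: algebra_simps)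
      also have "\<dots> \<in> I"
        by (rule ideal_lincomb[OF I' _ _ c(3) td(3)]) (use td gR in \<open>auto simp: R_closed units_R\<close>)
      finally have "P d" using td c units_mult unfolding P_def by blast
      then show ?thesis using td by blast
    qed
    have "P b"
      unfolding P_def using b
      by (auto intro!: exI[of _ 0] bexI[of _ 1] simp: units_one idealD(2)[OF I'])
    then obtain c where c: "c 0 = b" "\<And>n. P (c n)" "\<And>n. \<exists>t\<in>units. t * c n - c (Suc n) * g \<in> I"
      using dependent_nat_choice[of "\<lambda>n x. P x \<and> (n = 0 \<longrightarrow> x = b)"
          "\<lambda>n x y. \<exists>t\<in>units. t * x - y * g \<in> I"] step by auto
    have cR: "c n \<in> R" for n using c(2) by (simp add: P_def)
    have iter: "\<exists>t\<in>units. t * c j - g ^ d * c (j + d) \<in> I" for j d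
    proof (induction d)
      case 0
      show ?case by (auto intro!: bexI[of _ 1] simp: units_one idealD(2)[OF I'])
    next
      case (Suc d)
      then obtain t where t: "t \<in> units" "t * c j - g ^ d * c (j + d) \<in> I" by auto
      obtain s where s: "s \<in> units" "s * c (j + d) - c (Suc (j + d)) * g \<in> I" using c(3) by auto
      have "(s * t) * c j - g ^ Suc d * c (j + Suc d) =
          s * (t * c j - g ^ d * c (j + d)) + g ^ d * (s * c (j + d) - c (Suc (j + d)) * g)"
        by (simp add: algebra_simps)
      also have "\<dots> \<in> I"
        by (rule ideal_lincomb[OF I' _ _ t(2) s(2)]) (use s gR in \<open>auto simp: R_closed units_R\<close>)
      finally show ?case using units_mult[OF s(1) t(1)] by blast
    qed
    obtain n where n: "c n \<in> comb I (map c (rev [0..<n]))"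
      using sequence_dependent[OF I'] cR by blast
    have gc: "g * c n \<in> R" using gR cR by (auto simp: R_closed)
    \<comment> \<open>Each earlier \<open>c j\<close> is, up to a unit, a multiple of
      \<open>g * c n\<close>, so the dependence gives \<open>(t - h * g) * c n\<close> in
      \<open>I\<close>. Since \<open>t - h * g\<close> is again a unit, \<open>c n\<close> and then
      \<open>b\<close> lie in \<open>I\<close>.\<close>
    have "c n \<in> adjoin I (g * c n)"
    proof (rule subsetD[OF comb_least n])
      show "is_ideal (adjoin I (g * c n))"
        by (rule closed_idealD[OF adjoin_closed_ideal[OF I' gc]])
      show "I \<subseteq> adjoin I (g * c n)" by (rule adjoin_mono[OF I'])
      show "set (map c (rev [0..<n])) \<subseteq> adjoin I (g * c n)"
      proof
        fix u assume "u \<in> set (map c (rev [0..<n]))"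
        then obtain j where j: "j < n" "u = c j" by auto
        obtain t where t: "t \<in> units" "t * c j - g ^ (n - j) * c n \<in> I"
          using iter[of j "n - j"] j by auto
        have "g ^ (n - j) * c n = g ^ (n - j - 1) * (g * c n)"
          using j by (cases "n - j") (auto simp: algebra_simps)
        then show "u \<in> adjoin I (g * c n)"
          using t j gR cR by (intro adjoinI[of _ t "g ^ (n - j - 1)"]) (auto simp: R_closed)
      qed
    qed
    then obtain t h where th: "t \<in> units" "h \<in> R" "t * c n - h * (g * c n) \<in> I"
      by (auto elim!: adjoinE)
    have "(t - h * g) * c n \<in> I" using th(3) by (simp add: algebra_simps)
    then have "c n \<in> I"
      by (rule closed_idealD2[OF I _ cR, rotated]) (use th g in \<open>auto intro: units_diff M_mult\<close>)
    moreover obtain s where s: "s \<in> units" "s * c 0 - g ^ n * c (0 + n) \<in> I" using iter by blast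
    ultimately have "s * b \<in> I"
      using ideal_diff_cong[OF I' s(2)] idealD(4)[OF I', of "g ^ n"] gR c(1) by (simp add: R_power)
    then show False using closed_idealD2[OF I s(1) b(1)] b(2) by auto
  qed
  then obtain c k t where c: "c \<in> R" "c \<notin> adjoin I g" "t \<in> units" "g ^ k * c - t * b \<in> I"
    by (auto simp: P_def)
  have cancel: "r \<in> I" if "r \<in> R" "g ^ k * r \<in> I" for r k
    using that
  proof (induction k)
    case (Suc k)
    have "g * (g ^ k * r) \<in> I" using Suc.prems by (simp add: mult.assoc)
    then show ?case
      using Suc nonzerodivisorD[OF nz, of "g ^ k * r"] gR by (auto simp: R_closed)
  qed simp
  have "quotient I b \<subseteq> quotient I c"
  proof
    fix r assume "r \<in> quotient I b"
    then have r: "r \<in> R" "r * b \<in> I" by (auto simp: quotient_def)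
    have "g ^ k * (r * c) = r * (g ^ k * c - t * b) + t * (r * b)"
      by (simp add: algebra_simps)
    also have "\<dots> \<in> I" by (rule ideal_lincomb[OF I' _ _ c(4) r(2)]) (use r c in \<open>auto simp: R_closed units_R\<close>)
    finally show "r \<in> quotient I c"
      using cancel[of "r * c" k] r c by (auto simp: quotient_def R_closed)
  qed
  then show ?thesis using that c by blast
qed

lemma comb_absorb:
  assumes K: "is_ideal K" and "J \<subseteq> K" "g \<in> K"
  shows "comb J (g # gs) \<subseteq> comb K gs"
proof
  have mono: "comb J gs \<subseteq> comb K gs"
    using assms(2) by (induction gs) auto
  fix r assume "r \<in> comb J (g # gs)"
  then obtain c where c: "c \<in> R" "r - c * g \<in> comb K gs" using mono by auto
  have "c * g \<in> comb K gs"
    using c assms comb_base[OF K] idealD(4)[OF K] by blast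
  then show "r \<in> comb K gs"
    using idealD(3)[OF comb_ideal[OF K] c(2)] by fastforce
qed

text \<open>Depth is at most the dimension of the support of any nonzero element. Dimension is measured by
  the number of elements that generate \<open>M\<close> up to radical modulo the annihilator.\<close>

lemma depth_le_length:
  assumes "closed_ideal I" "depth_ge I n" "b \<in> R" "b \<notin> I" "set gs \<subseteq> M"
    and "\<And>r. r \<in> M \<Longrightarrow> \<exists>k. r ^ k \<in> comb (quotient I b \<inter> M) gs"
  shows "n \<le> length gs"
  using assms
proof (induction gs arbitrary: I n b)
  case Nil
  show ?case
  proof (cases n)
    case (Suc n')
    \<comment> \<open>With no generators left, every element of \<open>M\<close> has a power
      annihilating \<open>b\<close> modulo \<open>I\<close>, so a nonzerodivisor in \<open>M\<close>
      forces \<open>b\<close> into \<open>I\<close>.\<close>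
    then obtain z where z: "z \<in> M" "nonzerodivisor I z" using Nil.prems(2) by auto
    then obtain k where k: "z ^ k * b \<in> I" using Nil.prems(6) by (auto simp: quotient_def)
    have "b \<in> I" using k
    proof (induction k)
      case (Suc k)
      have "z ^ k * b \<in> I"
        by (rule nonzerodivisorD[OF z(2)]) (use z Nil.prems Suc in \<open>auto simp: mult.assoc R_closed\<close>)
      then show ?case by (rule Suc.IH)
    qed simp
    then show ?thesis using Nil.prems by simp
  qed simp
next
  case (Cons g gs)
  note I = Cons.prems(1) and I' = closed_idealD[OF Cons.prems(1)]
  have g: "g \<in> M" "set gs \<subseteq> M" using Cons.prems by auto
  define J where "J = quotient I b \<inter> M"
  have J: "is_ideal J"
    using quotient_ideal[OF I' Cons.prems(3)] M_ideal unfolding J_def is_ideal_def by blast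
  have transfer: "\<exists>k. r ^ k \<in> comb (quotient I' b' \<inter> M) gs"
    if "is_ideal I'" "b' \<in> R" "J \<subseteq> quotient I' b'" "g \<in> quotient I' b'" "r \<in> M" for I' b' r
  proof -
    have "is_ideal (quotient I' b' \<inter> M)"
      using quotient_ideal[OF that(1,2)] M_ideal unfolding is_ideal_def by blast
    then have "comb J (g # gs) \<subseteq> comb (quotient I' b' \<inter> M) gs"
      by (rule comb_absorb) (use that g in \<open>auto simp: J_def\<close>)
    then show ?thesis using Cons.prems(6)[OF that(5)] unfolding J_def by blast
  qed
  show ?case
  proof (cases n)
    case (Suc n')
    \<comment> \<open>Some \<open>y\<close> in \<open>J\<close> detects generators of
      \<open>J\<close>, and \<open>z = g + y ^ N\<close> detects these together with
      \<open>g\<close>. Either \<open>z\<close> is a nonzerodivisor and can be divided out, or its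
      being a zero divisor yields an element annihilated by both \<open>J\<close> and
      \<open>g\<close>. In both cases \<open>g\<close> disappears from the list.\<close>
    obtain js where js: "set js \<subseteq> J" "J = comb {0} js" using finitely_generated[OF J] .
    have jsM: "set js \<subseteq> M" using js by (auto simp: J_def)
    obtain y where y: "y \<in> J" "detects I (set js) y"
      using detects_exists[of "{I}" js] I jsM js(2) by auto
    obtain N where N: "N > 0" "detects I (insert g (set js)) (g + y ^ N)"
      using detects_step[of "{I}" "set js" y g] I y g by (auto simp: J_def M_R)
    have yN: "y ^ N \<in> J"
      using N(1) idealD(4)[OF J _ y(1), of "y ^ (N - 1)"] y(1)
      by (cases N) (auto simp: J_def R_closed mult.commute)
    define z where "z = g + y ^ N"
    have z: "z \<in> M" using g yN by (auto simp: z_def J_def intro: M_add)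
    show ?thesis
    proof (cases "nonzerodivisor I z")
      \<comment> \<open>Modulo \<open>z\<close>, both \<open>z\<close> and \<open>y ^ N\<close>
        annihilate \<open>c\<close>, hence so does their difference \<open>g\<close>. Depth and list
        each lose one.\<close>
      case True
      obtain c where c: "c \<in> R" "c \<notin> adjoin I z" "quotient I b \<subseteq> quotient I c"
        using nakayama_lift[OF I z True Cons.prems(3,4)] .
      have zR: "z \<in> R" using z M_R by auto
      note A = closed_idealD[OF adjoin_closed_ideal[OF I' zR]]
      have sub: "J \<subseteq> quotient (adjoin I z) c"
        using c(3) adjoin_mono[OF I', of z] by (auto simp: J_def quotient_def)
      moreover have "z \<in> quotient (adjoin I z) c"
        using idealD(5)[OF A c(1) adjoin_self[OF I' zR]] zR by (auto simp: quotient_def)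
      moreover have "g = z - y ^ N" by (simp add: z_def)
      ultimately have "g \<in> quotient (adjoin I z) c"
        using idealD(7)[OF quotient_ideal[OF A c(1)]] yN by blast
      then have "n' \<le> length gs"
        using depth_adjoin[OF I _ z True, of n'] Suc Cons.prems(2)
        by (intro Cons.IH[OF adjoin_closed_ideal[OF I' zR] _ c(1,2) g(2)] transfer[OF A c(1) sub]) auto
      then show ?thesis using Suc by simp
    next
      case False
      then obtain w where w: "w \<in> R" "z * w \<in> I" "w \<notin> I" by (auto simp: nonzerodivisor_def)
      then obtain r where r: "r \<in> R" "r * w \<notin> I" "\<forall>x\<in>insert g (set js). x * (r * w) \<in> I"
        using N(2) unfolding detects_def z_def by blast
      have rw: "r * w \<in> R" using r w by (auto simp: R_closed)
      have "J \<subseteq> quotient I (r * w)"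
        unfolding js(2)
      proof (rule comb_least[OF quotient_ideal[OF I' rw]])
        show "{0} \<subseteq> quotient I (r * w)"
          using idealD(2)[OF I'] by (auto simp: quotient_def R_zero)
        show "set js \<subseteq> quotient I (r * w)"
          using r jsM M_R by (auto simp: quotient_def)
      qed
      moreover have "g \<in> quotient I (r * w)" using r g M_R by (auto simp: quotient_def)
      ultimately have "n \<le> length gs"
        by (intro Cons.IH[OF I Cons.prems(2) rw r(2) g(2)] transfer[OF I' rw])
      then show ?thesis by simp
    qed
  qed simp
qed

text \<open>Saturation preserves regularity, as localization does. The base \<open>J\<close> is
  general because the induction moves the first element of the sequence into it; \<open>comb\<close>
  adjoins the end of its list first, hence the \<open>rev\<close>.\<close>

lemma depth_ge_of_regular:
  assumes "is_ideal J" "set xs \<subseteq> M"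
    and "\<And>i r. i < length xs \<Longrightarrow> r \<in> R \<Longrightarrow> r * xs ! i \<in> comb J (rev (take i xs)) \<Longrightarrow>
      r \<in> comb J (rev (take i xs))"
  shows "depth_ge (adjoin J 0) (length xs)"
  using assms
proof (induction xs arbitrary: J)
  case (Cons x xs)
  note J = Cons.prems(1)
  have x: "x \<in> M" "x \<in> R" using Cons.prems M_R by auto
  have J': "is_ideal (comb J [x])" by (rule comb_ideal[OF J])
  have "nonzerodivisor (adjoin J 0) x"
    unfolding nonzerodivisor_def
  proof (intro ballI impI)
    fix r assume r: "r \<in> R" "x * r \<in> adjoin J 0"
    then obtain t where t: "t \<in> units" "t * (x * r) \<in> J" by (auto elim!: adjoinE)
    then have "(t * r) * (x # xs) ! 0 \<in> comb J (rev (take 0 (x # xs)))" by (simp add: ac_simps)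
    from Cons.prems(3)[OF _ _ this] have "t * r \<in> J" using r t by (simp add: R_mult units_R)
    then show "r \<in> adjoin J 0" using r t by (intro adjoinI[of _ t 0]) (auto simp: R_zero)
  qed
  moreover have "adjoin (adjoin J 0) x = adjoin (comb J [x]) 0"
  proof (intro equalityI subsetI)
    fix r assume "r \<in> adjoin (adjoin J 0) x"
    then obtain t c where *: "r \<in> R" "t \<in> units" "c \<in> R" "t * r - 0 * 0 - c * x \<in> J"
      unfolding adjoin_adjoin[OF J R_zero x(2)] by auto
    then have "t * r - 0 * 0 \<in> comb J [x]" by (auto simp: R_mult units_R)
    then show "r \<in> adjoin (comb J [x]) 0" using * by (intro adjoinI[of _ t 0]) (auto simp: R_zero)
  next
    fix r assume "r \<in> adjoin (comb J [x]) 0"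
    then obtain t d c where *: "r \<in> R" "t \<in> units" "c \<in> R" "t * r - d * 0 - c * x \<in> J"
      by (auto elim!: adjoinE)
    then show "r \<in> adjoin (adjoin J 0) x"
      unfolding adjoin_adjoin[OF J R_zero x(2)] using R_zero by auto
  qed
  moreover have "depth_ge (adjoin (comb J [x]) 0) (length xs)"
  proof (rule Cons.IH[OF J'])
    show "set xs \<subseteq> M" using Cons.prems by simp
    show "r \<in> comb (comb J [x]) (rev (take i xs))"
      if "i < length xs" "r \<in> R" "r * xs ! i \<in> comb (comb J [x]) (rev (take i xs))" for i r
      using Cons.prems(3)[of "Suc i" r] that by (simp del: comb.simps add: comb_append)
  qed
  ultimately show ?case using x by auto
qed simp

lemma radical_add:
  assumes H: "is_ideal H" and ab: "a \<in> R" "b \<in> R" "a ^ k \<in> H" "b ^ l \<in> H"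
  shows "(a + b) ^ (k + l) \<in> H"
proof -
  have of_nat_R: "of_nat n \<in> R" for n
    by (induction n) (simp_all add: R_closed)
  have pow: "x ^ m \<in> H" if "x \<in> R" "x ^ n \<in> H" "n \<le> m" for x n m
    using idealD(4)[OF H, of "x ^ (m - n)" "x ^ n"] that by (simp add: R_power flip: power_add)
  have binom: "of_nat ((k + l) choose i) * a ^ i * b ^ (k + l - i) \<in> H" for i
  proof (cases "k \<le> i")
    case True
    then show ?thesis
      using idealD(5)[OF H _ idealD(4)[OF H of_nat_R pow[OF ab(1,3)]], of "b ^ (k + l - i)" i] ab
      by (simp add: R_power)
  next
    case False
    then show ?thesis
      using idealD(4)[OF H R_mult[OF of_nat_R R_power[OF ab(1)]] pow[OF ab(2,4)], of "k + l - i"]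
      by simp
  qed
  have "sum f A \<in> H" if "finite A" "\<And>i. i \<in> A \<Longrightarrow> f i \<in> H" for f and A :: "nat set"
    using that by induction (auto intro: idealD[OF H])
  then show ?thesis unfolding binomial_ring using binom by simp
qed

end


section \<open>The cone of an affine semigroup\<close>

lemma add_submonoid_hull_induct [consumes 1, case_names zero gen add]:
  assumes "x \<in> add_submonoid hull B" and "P 0" "\<And>b. b \<in> B \<Longrightarrow> P b" "\<And>x y. P x \<Longrightarrow> P y \<Longrightarrow> P (x + y)"
  shows "P x"
  using hull_minimal[of B "Collect P" add_submonoid] assms by (auto simp: add_submonoid_def)

lemma affine_semigroup_submonoid: "affine_semigroup S \<Longrightarrow> add_submonoid S"
  by (auto simp: affine_semigroup_def add_submonoid_hull)

lemma submonoidD: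
  assumes "add_submonoid S"
  shows "0 \<in> S" and "x \<in> S \<Longrightarrow> y \<in> S \<Longrightarrow> x + y \<in> S"
  using assms by (auto simp: add_submonoid_def)

lemma submonoid_scale:
  assumes "add_submonoid S" "x \<in> S"
  shows "(n::nat) *s x \<in> S"
proof (induction n)
  case 0
  have "(0::nat) *s x = 0" by (simp add: vec_eq_iff)
  then show ?case using submonoidD(1)[OF assms(1)] by simp
next
  case (Suc n)
  have "Suc n *s x = x + n *s x" by (simp add: vec_eq_iff)
  then show ?case using submonoidD(2)[OF assms Suc] by simp
qed

lemma submonoid_sum:
  assumes "add_submonoid S" "\<And>i. i \<in> I \<Longrightarrow> f i \<in> S"
  shows "sum f I \<in> S"
  using assms(2) by (induction I rule: infinite_finite_induct) (auto intro: submonoidD[OF assms(1)])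

lemma msg_iff:
  fixes S :: "(nat ^ 'p) set"
  assumes "add_submonoid S"
  shows "s \<in> msg S \<longleftrightarrow> s \<in> S \<and> s \<noteq> 0 \<and> (\<forall>a\<in>S. \<forall>b\<in>S. s = a + b \<longrightarrow> a = 0 \<or> b = 0)"
  unfolding msg_eq[OF assms] by auto

lemma hull_msg:
  fixes S :: "(nat ^ 'p) set"
  assumes "add_submonoid S"
  shows "add_submonoid hull (msg S) = S"
proof -
  have "minimal_generating_set S (msg S)"
    unfolding minimal_generating_set_iff[OF assms] msg_eq[OF assms] by simp
  then show ?thesis by (simp add: minimal_generating_set_def)
qed

text \<open>An irreducible \<open>s\<close> lies in every generating set, since
  \<open>S - {s}\<close> is still a submonoid.\<close>

lemma finite_msg:
  fixes S :: "(nat ^ 'p) set"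
  assumes "affine_semigroup S"
  shows "finite (msg S)"
proof -
  note S = affine_semigroup_submonoid[OF assms]
  obtain B where B: "finite B" "add_submonoid hull B = S"
    using assms by (auto simp: affine_semigroup_def)
  have "s \<in> B" if s: "s \<in> msg S" for s
  proof (rule ccontr)
    assume "s \<notin> B"
    have irr: "x + y \<noteq> s" if "x \<in> S - {s}" "y \<in> S - {s}" for x y
      using s that unfolding msg_iff[OF S] by (metis DiffE add.left_neutral add.right_neutral singletonI)
    have "add_submonoid (S - {s})"
      using irr s submonoidD[OF S] unfolding add_submonoid_def msg_iff[OF S] by blast
    moreover have "B \<subseteq> S - {s}"
      using B(2) hull_subset[of B add_submonoid] \<open>s \<notin> B\<close> by auto
    ultimately have "S \<subseteq> S - {s}"
      using hull_minimal[of B "S - {s}" add_submonoid] B(2) by simp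
    then show False using s by (auto simp: msg_iff[OF S])
  qed
  then show ?thesis using finite_subset[OF _ B(1)] by auto
qed

section \<open>Lattice points and functionals of the cone\<close>

definition total :: "nat ^ 'p \<Rightarrow> nat" where
  "total x = (\<Sum>i\<in>UNIV. x $ i)"

lemma total_add: "total (x + y) = total x + total y"
  by (simp add: total_def sum.distrib)

lemma total_eq_0_iff: "total x = 0 \<longleftrightarrow> x = 0"
  by (simp add: total_def vec_eq_iff)

lemma real_vec_simps:
  "real_vec 0 = 0" "real_vec (x + y) = real_vec x + real_vec y"
  "real_vec (n *s x) = real n *\<^sub>R real_vec x"
  by (simp_all add: real_vec_def vec_eq_iff)

lemma real_vec_inject: "real_vec x = real_vec y \<longleftrightarrow> x = y"
  by (simp add: real_vec_def vec_eq_iff)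

lemma real_cone_finite:
  assumes "finite X"
  shows "y \<in> real_cone X \<longleftrightarrow> (\<exists>c. (\<forall>v\<in>X. 0 \<le> c v) \<and> y = (\<Sum>v\<in>X. c v *\<^sub>R real_vec v))"
proof
  assume "y \<in> real_cone X"
  then obtain F c where *: "F \<subseteq> X" "\<forall>v\<in>F. 0 \<le> c v" "y = (\<Sum>v\<in>F. c v *\<^sub>R real_vec v)"
    by (auto simp: real_cone_def)
  have "y = (\<Sum>v\<in>X. (if v \<in> F then c v else 0) *\<^sub>R real_vec v)"
    unfolding *(3) by (rule sum.mono_neutral_cong_left) (use * assms in auto)
  then show "\<exists>c. (\<forall>v\<in>X. 0 \<le> c v) \<and> y = (\<Sum>v\<in>X. c v *\<^sub>R real_vec v)"
    using *(2) by (intro exI[of _ "\<lambda>v. if v \<in> F then c v else 0"]) auto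
qed (use assms in \<open>auto simp: real_cone_def\<close>)

lemma real_cone_nonneg:
  assumes "linear l" "\<And>v. v \<in> X \<Longrightarrow> 0 \<le> l (real_vec v)" "y \<in> real_cone X"
  shows "0 \<le> (l y :: real)"
proof -
  obtain F c where *: "F \<subseteq> X" "\<forall>v\<in>F. 0 \<le> c v" "y = (\<Sum>v\<in>F. c v *\<^sub>R real_vec v)"
    using assms(3) by (auto simp: real_cone_def)
  have "l y = (\<Sum>v\<in>F. c v * l (real_vec v))"
    by (simp add: *(3) linear_sum[OF assms(1)] linear_scale[OF assms(1)])
  also have "\<dots> \<ge> 0"
    using * assms(2) by (intro sum_nonneg mult_nonneg_nonneg) auto
  finally show ?thesis .
qed

context
  fixes S :: "(nat ^ 'p) set"
  assumes affine: "affine_semigroup S"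
begin

private lemmas S = affine_semigroup_submonoid[OF affine]
private lemmas fin = finite_msg[OF affine]

lemma lattice_cone_add:
  assumes "x \<in> lattice_cone S" "y \<in> lattice_cone S"
  shows "x + y \<in> lattice_cone S"
proof -
  obtain c d where "\<forall>v\<in>msg S. 0 \<le> c v" "real_vec x = (\<Sum>v\<in>msg S. c v *\<^sub>R real_vec v)"
    "\<forall>v\<in>msg S. 0 \<le> d v" "real_vec y = (\<Sum>v\<in>msg S. d v *\<^sub>R real_vec v)"
    using assms by (auto simp: lattice_cone_def real_cone_finite[OF fin])
  then have "(\<forall>v\<in>msg S. 0 \<le> c v + d v) \<and> real_vec (x + y) = (\<Sum>v\<in>msg S. (c v + d v) *\<^sub>R real_vec v)"
    by (simp add: real_vec_simps sum.distrib scaleR_add_left)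
  then show ?thesis
    unfolding lattice_cone_def real_cone_finite[OF fin] mem_Collect_eq
    by (intro exI[of _ "\<lambda>v. c v + d v"])
qed

lemma subset_lattice_cone: "S \<subseteq> lattice_cone S"
proof
  have zero: "0 \<in> lattice_cone S"
    unfolding lattice_cone_def real_cone_finite[OF fin]
    by (auto simp: real_vec_simps intro!: exI[of _ "\<lambda>_. 0"])
  fix s assume "s \<in> S"
  then have "s \<in> add_submonoid hull (msg S)" by (simp add: hull_msg[OF S])
  then show "s \<in> lattice_cone S"
  proof (induction rule: add_submonoid_hull_induct)
    case (gen b)
    have "real_vec b = (\<Sum>v\<in>msg S. (if v = b then 1 else 0) *\<^sub>R real_vec v)"
      using gen fin by (simp add: if_distrib[of "\<lambda>x. x *\<^sub>R _"] sum.delta cong: if_cong)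
    then show ?case
      unfolding lattice_cone_def real_cone_finite[OF fin]
      by (auto intro!: exI[of _ "\<lambda>v. if v = b then 1 else 0"])
  qed (use zero lattice_cone_add in auto)
qed

lemma multiplicities_subset_msg: "multiplicities S \<subseteq> msg S"
proof
  fix m assume m: "m \<in> multiplicities S"
  have "a = 0 \<or> b = 0" if ab: "a \<in> S" "b \<in> S" "m = a + b" for a b
  proof (rule ccontr)
    assume *: "\<not> (a = 0 \<or> b = 0)"
    have "cone_le S a m" using ab subset_lattice_cone by (auto simp: cone_le_def)
    then have "a = m" using m ab * by (auto simp: multiplicities_def)
    then show False using ab * by simp
  qed
  then show "m \<in> msg S" using m by (auto simp: msg_iff[OF S] multiplicities_def)
qed

lemma multiplicity_below:
  assumes "s \<in> S" "s \<noteq> 0"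
  obtains e z where "e \<in> multiplicities S" "z \<in> lattice_cone S" "s = e + z"
proof -
  have "0 \<in> lattice_cone S" using subset_lattice_cone submonoidD(1)[OF S] by auto
  then have "\<exists>x. x \<in> S - {0} \<and> cone_le S x s"
    using assms by (intro exI[of _ s]) (auto simp: cone_le_def)
  then obtain e where e: "e \<in> S - {0}" "cone_le S e s"
    "\<And>y. y \<in> S - {0} \<Longrightarrow> cone_le S y s \<Longrightarrow> total e \<le> total y"
    using ex_has_least_nat[of "\<lambda>x. x \<in> S - {0} \<and> cone_le S x s" _ total] by metis
  have "y = e" if y: "y \<in> S - {0}" "cone_le S y e" for y
  proof -
    have "cone_le S y s"
      using y(2) e(2) lattice_cone_add by (fastforce simp: cone_le_def add.assoc)
    then have "total e \<le> total y" using e(3) y by blast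
    moreover obtain z where "e = y + z" using y(2) by (auto simp: cone_le_def)
    ultimately have "z = 0" by (simp add: total_add flip: total_eq_0_iff)
    then show ?thesis using \<open>e = y + z\<close> by simp
  qed
  then have "e \<in> multiplicities S" using e(1) by (auto simp: multiplicities_def)
  then show ?thesis using that e(2) by (auto simp: cone_le_def)
qed

text \<open>The coefficients are real, so denominators cannot be cleared. Instead those of
  \<open>k *s c\<close> are rounded down. The remainders \<open>r k\<close> are lattice points in a
  bounded box, so two coincide for some \<open>j < k\<close>, and subtracting writes
  \<open>(k - j) *s c\<close> with nonnegative integer coefficients.\<close>

lemma lattice_cone_multiple:
  assumes "c \<in> lattice_cone S"
  obtains n where "n > 0" "n *s c \<in> S"
proof -
  obtain a where a: "\<forall>v\<in>msg S. 0 \<le> a v" "real_vec c = (\<Sum>v\<in>msg S. a v *\<^sub>R real_vec v)"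
    using assms by (auto simp: lattice_cone_def real_cone_finite[OF fin])
  have ai: "real (c $ i) = (\<Sum>v\<in>msg S. a v * real (v $ i))" for i
    using arg_cong[OF a(2), of "\<lambda>x. x $ i"] by (simp add: real_vec_def)
  define q where "q k v = nat \<lfloor>real k * a v\<rfloor>" for k :: nat and v
  define w where "w k = (\<Sum>v\<in>msg S. q k v *s v)" for k
  define r where "r k = (\<chi> i. k * c $ i - w k $ i)" for k
  have q: "real (q k v) \<le> real k * a v" "real k * a v \<le> real (q k v) + 1" if "v \<in> msg S" for k v
    using a(1) that unfolding q_def by (auto simp: of_nat_nat floor_le_iff)
  have wi: "w k $ i = (\<Sum>v\<in>msg S. q k v * v $ i)" for k i
    by (simp add: w_def)
  have le: "w k $ i \<le> k * c $ i" for k i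
  proof -
    have "real (w k $ i) \<le> (\<Sum>v\<in>msg S. (real k * a v) * real (v $ i))"
      unfolding wi of_nat_sum of_nat_mult by (intro sum_mono mult_right_mono q) auto
    also have "\<dots> = real (k * c $ i)"
      by (simp add: ai sum_distrib_left mult.assoc)
    finally show ?thesis by linarith
  qed
  have split: "k *s c = w k + r k" for k
    using le by (simp add: vec_eq_iff r_def)
  have ge: "r k $ i \<le> (\<Sum>v\<in>msg S. v $ i)" for k i
  proof -
    have "real (k * c $ i) = (\<Sum>v\<in>msg S. (real k * a v) * real (v $ i))"
      by (simp add: ai sum_distrib_left mult.assoc)
    also have "\<dots> \<le> (\<Sum>v\<in>msg S. (real (q k v) + 1) * real (v $ i))"
      by (intro sum_mono mult_right_mono q) auto
    also have "\<dots> = real (w k $ i) + real (\<Sum>v\<in>msg S. v $ i)"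
      by (simp add: wi sum.distrib distrib_right)
    finally have "k * c $ i \<le> w k $ i + (\<Sum>v\<in>msg S. v $ i)" by linarith
    then show ?thesis by (simp add: r_def)
  qed
  have "range r \<subseteq> vec_lambda ` (\<Pi>\<^sub>E i\<in>UNIV. {..\<Sum>v\<in>msg S. v $ i})"
  proof
    fix x assume "x \<in> range r"
    then show "x \<in> vec_lambda ` (\<Pi>\<^sub>E i\<in>UNIV. {..\<Sum>v\<in>msg S. v $ i})"
      using ge by (intro image_eqI[of _ _ "vec_nth x"]) auto
  qed
  then have "finite (range r)"
    by (rule finite_subset) (intro finite_imageI finite_PiE, auto)
  then have "\<not> inj r" using finite_imageD[of r UNIV] by auto
  then obtain j k where jk: "j < k" "r j = r k"
    unfolding inj_def by (metis linorder_neqE_nat)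
  have mono: "q j v \<le> q k v" if "v \<in> msg S" for v
    unfolding q_def using jk a(1) that by (intro nat_mono floor_mono mult_right_mono) auto
  have "(k - j) *s c = (\<Sum>v\<in>msg S. (q k v - q j v) *s v)"
  proof -
    have "(k - j) *s c + (w j + r j) = (\<Sum>v\<in>msg S. (q k v - q j v) *s v) + (w j + r k)"
    proof -
      have "(k - j) *s c + (w j + r j) = k *s c"
        unfolding split[symmetric] using jk by (simp add: vec_eq_iff flip: distrib_right)
      also have "\<dots> = w k + r k" by (rule split)
      also have "w k = (\<Sum>v\<in>msg S. (q k v - q j v) *s v) + w j"
        unfolding w_def sum.distrib[symmetric]
        using mono by (intro sum.cong) (simp_all add: vec_eq_iff flip: distrib_right)
      finally show ?thesis by (simp add: add.assoc)
    qed
    then show ?thesis using jk(2) by simp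
  qed
  also have "\<dots> \<in> S"
    by (intro submonoid_sum[OF S] submonoid_scale[OF S]) (simp add: msg_iff[OF S])
  finally show ?thesis using that[of "k - j"] jk by simp
qed

text \<open>If \<open>s = e + z\<close> and \<open>n *s z\<close> is in \<open>S\<close>, then
  \<open>n *s s\<close> splits off one \<open>e\<close> and leaves
  \<open>(n - 1) *s e + n *s z\<close>. This will show that the multiplicities generate the
  irrelevant ideal up to radical.\<close>

lemma multiple_above_multiplicity:
  assumes "s \<in> S" "s \<noteq> 0"
  obtains n e t where "e \<in> multiplicities S" "t \<in> S" "n *s s = e + t"
proof -
  obtain e z where ez: "e \<in> multiplicities S" "z \<in> lattice_cone S" "s = e + z"
    using multiplicity_below[OF assms] .
  obtain n where n: "n > 0" "n *s z \<in> S" using lattice_cone_multiple[OF ez(2)] .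
  have eS: "e \<in> S" using ez by (auto simp: multiplicities_def)
  have "n *s s = e + ((n - 1) *s e + n *s z)"
    unfolding ez(3) using n by (cases n) (simp_all add: vec_eq_iff algebra_simps)
  moreover have "(n - 1) *s e + n *s z \<in> S"
    by (rule submonoidD(2)[OF S submonoid_scale[OF S eS] n(2)])
  ultimately show ?thesis using that ez by blast
qed

text \<open>Among the generators, one minimizing \<open>l v / total v\<close> cannot be negative under \<open>l\<close>, because it
  is the sum of a multiplicity and a strictly smaller element of the cone.\<close>

lemma linear_nonneg_on_cone:
  assumes l: "linear l" and pos: "\<And>e. e \<in> multiplicities S \<Longrightarrow> 0 \<le> l (real_vec e)"
    and z: "z \<in> lattice_cone S"
  shows "0 \<le> (l (real_vec z) :: real)"
proof (cases "\<forall>v\<in>msg S. 0 \<le> l (real_vec v)")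
  case True
  then show ?thesis using real_cone_nonneg[OF l] z by (auto simp: lattice_cone_def)
next
  case False
  define ratio where "ratio v = l (real_vec v) / real (total v)" for v
  obtain u where u: "u \<in> msg S" "l (real_vec u) < 0" using False by auto
  obtain v where v: "v \<in> msg S" "\<And>w. w \<in> msg S \<Longrightarrow> ratio v \<le> ratio w"
    using arg_min_if_finite[OF fin, of ratio] u by (metis empty_iff linorder_not_less)
  have tpos: "0 < real (total w)" if "w \<in> msg S" for w
    using that total_eq_0_iff[of w] by (auto simp: msg_iff[OF S])
  have neg: "ratio v < 0"
    using v(2)[OF u(1)] divide_neg_pos[OF u(2) tpos[OF u(1)]] by (simp add: ratio_def)
  \<comment> \<open>By minimality of the ratio, \<open>m\<close> is nonnegative on all generators.
    On the remainder \<open>x\<close> of \<open>v = e + x\<close> this bounds \<open>l\<close> from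
    below by \<open>ratio v * total x\<close>.\<close>
  define m where "m x = l x - ratio v * (\<Sum>i\<in>UNIV. x $ i)" for x
  have lm: "linear m"
    unfolding m_def using l by (intro linear_compose_sub)
      (auto intro!: linearI simp: sum.distrib sum_distrib_left algebra_simps)
  have rt: "(\<Sum>i\<in>UNIV. real_vec x $ i) = real (total x)" for x
    by (simp add: real_vec_def total_def)
  have "0 \<le> m (real_vec w)" if "w \<in> msg S" for w
    using v(2)[OF that] tpos[OF that] by (simp add: m_def rt ratio_def field_simps)
  then have m: "0 \<le> m (real_vec x)" if "x \<in> lattice_cone S" for x
    using real_cone_nonneg[OF lm] that by (auto simp: lattice_cone_def)
  have "v \<in> S" "v \<noteq> 0" using v(1) by (auto simp: msg_iff[OF S])
  then obtain e x where ex: "e \<in> multiplicities S" "x \<in> lattice_cone S" "v = e + x"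
    using multiplicity_below by blast
  have "ratio v * real (total v) = l (real_vec v)"
    using tpos[OF v(1)] by (simp add: ratio_def)
  also have "\<dots> = l (real_vec e) + l (real_vec x)"
    by (simp add: ex(3) real_vec_simps linear_add[OF l])
  also have "\<dots> \<ge> ratio v * real (total x)"
    using pos[OF ex(1)] m[OF ex(2)] by (simp add: m_def rt)
  finally have "total v \<le> total x" using neg by (simp add: mult_le_cancel_left)
  then have "e = 0" by (simp add: ex(3) total_add flip: total_eq_0_iff)
  then show ?thesis using ex(1) by (simp add: multiplicities_def)
qed

text \<open>The \<open>l e\<close> form the basis dual to the multiplicities. These span, since a
  functional vanishing on them vanishes on \<open>S\<close> (apply
  \<open>linear_nonneg_on_cone\<close> to it and to its negative), against full dimension; being as
  many as the dimension, they are a basis.\<close>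

lemma multiplicity_functionals:
  assumes card: "card (multiplicities S) = CARD('p)" and dim: "dim (real_cone S) = CARD('p)"
  shows "\<exists>l :: nat ^ 'p \<Rightarrow> nat ^ 'p \<Rightarrow> real.
    (\<forall>e x y. l e (x + y) = l e x + l e y) \<and> (\<forall>e. l e 0 = 0) \<and>
    (\<forall>e x. x \<in> S \<longrightarrow> 0 \<le> l e x) \<and>
    (\<forall>e. \<forall>e'\<in>multiplicities S. l e e' = (if e' = e then 1 else 0)) \<and>
    (\<forall>x\<in>S. (\<forall>e\<in>multiplicities S. l e x = 0) \<longrightarrow> x = 0)"
proof -
  define V where "V = real_vec ` multiplicities S"
  have inj: "inj_on real_vec (multiplicities S)"
    by (simp add: inj_on_def real_vec_inject)
  have cV: "card V = CARD('p)" by (simp add: V_def card_image[OF inj] card)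
  have fV: "finite V" using cV by (intro card_ge_0_finite) simp
  have "span V = UNIV"
  proof (rule ccontr)
    assume "span V \<noteq> UNIV"
    then obtain a where a: "a \<noteq> 0" "\<And>x. x \<in> span V \<Longrightarrow> a \<bullet> x = 0"
      using span_not_univ_subset_hyperplane[of V] by auto
    have l: "linear (\<lambda>x. a \<bullet> x)" "linear (\<lambda>x. (- a) \<bullet> x)"
      by (auto intro!: linearI simp: inner_add_right inner_diff_right)
    have z: "a \<bullet> real_vec e = 0" if "e \<in> multiplicities S" for e
      using a(2)[OF span_base] that by (simp add: V_def)
    have "a \<bullet> real_vec x = 0" if "x \<in> S" for x
      using linear_nonneg_on_cone[OF l(1), of x] linear_nonneg_on_cone[OF l(2), of x] z that
        subset_lattice_cone by fastforce
    then have "real_cone S \<subseteq> {x. a \<bullet> x = 0}"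
      by (auto simp: real_cone_def inner_sum_right subset_iff intro!: sum.neutral)
    then have "dim (real_cone S) \<le> dim {x. a \<bullet> x = 0}" by (rule dim_subset)
    also have "\<dots> = CARD('p) - 1" using dim_hyperplane[OF a(1)] by simp
    also have "\<dots> < CARD('p)" by simp
    finally show False using dim by simp
  qed
  then have ind: "independent V"
    using fV cV by (intro card_le_dim_spanning[of V UNIV]) auto
  have "\<forall>e. \<exists>g :: real ^ 'p \<Rightarrow> real. linear g \<and> (\<forall>x\<in>V. g x = (if x = real_vec e then 1 else 0))"
    by (intro allI linear_independent_extend[OF ind])
  then obtain g where g: "\<And>e. linear (g e)"
    "\<And>e x. x \<in> V \<Longrightarrow> g e x = ((if x = real_vec e then 1 else 0) :: real)"
    by metis
  define l where "l e x = g e (real_vec x)" for e x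
  have l: "l e e' = (if e' = e then 1 else 0)" if "e' \<in> multiplicities S" for e e'
    using g(2)[of "real_vec e'" e] that by (simp add: l_def V_def real_vec_inject)
  have nonneg: "0 \<le> l e x" if "x \<in> lattice_cone S" for e x
    unfolding l_def by (rule linear_nonneg_on_cone[OF g(1) _ that]) (simp add: l flip: l_def)
  have add: "l e (x + y) = l e x + l e y" for e x y
    by (simp add: l_def real_vec_simps linear_add[OF g(1)])
  have "x = 0" if x: "x \<in> S" "\<And>e. e \<in> multiplicities S \<Longrightarrow> l e x = 0" for x
  proof (rule ccontr)
    assume "x \<noteq> 0"
    then obtain e z where "e \<in> multiplicities S" "z \<in> lattice_cone S" "x = e + z"
      using multiplicity_below x(1) by metis
    then show False using x(2)[of e] nonneg[of z e] by (simp add: add l)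
  qed
  moreover have "l e 0 = 0" for e by (simp add: l_def real_vec_simps linear_0[OF g(1)])
  ultimately show ?thesis
    using add l nonneg subset_lattice_cone by (intro exI[of _ l]) (simp add: subset_iff)
qed

end


section \<open>The Cohen-Macaulay property of the semigroup ring\<close>

lemma lookup_mult_sum:
  "Poly_Mapping.lookup (f * g) k = (\<Sum>a\<in>Poly_Mapping.keys f. \<Sum>b\<in>Poly_Mapping.keys g.
     if a + b = k then Poly_Mapping.lookup f a * Poly_Mapping.lookup g b else 0)"
proof -
  have "Poly_Mapping.lookup (f * g) k = Sum_any (\<lambda>a. Poly_Mapping.lookup f a *
      Sum_any (\<lambda>b. Poly_Mapping.lookup g b when k = a + b))"
    by (rule lookup_mult)
  also have "\<dots> = (\<Sum>a\<in>Poly_Mapping.keys f. Poly_Mapping.lookup f a *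
      Sum_any (\<lambda>b. Poly_Mapping.lookup g b when k = a + b))"
    by (rule Sum_any.expand_superset) (auto simp: in_keys_iff)
  also have "\<dots> = (\<Sum>a\<in>Poly_Mapping.keys f. Poly_Mapping.lookup f a *
      (\<Sum>b\<in>Poly_Mapping.keys g. Poly_Mapping.lookup g b when k = a + b))"
    by (intro sum.cong refl arg_cong2[of _ _ _ _ "(*)"] Sum_any.expand_superset)
      (auto simp: in_keys_iff)
  finally show ?thesis
    by (auto simp: sum_distrib_left when_def intro!: sum.cong)
qed

lemma poly_mapping_decompose:
  "f = (\<Sum>k\<in>Poly_Mapping.keys f. Poly_Mapping.single k (Poly_Mapping.lookup f k))"
  by (rule poly_mapping_eqI)
    (simp add: lookup_sum lookup_single when_def sum.delta in_keys_iff)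

text \<open>Integer polynomials are linearly ordered by the sign of the leading coefficient of a
  difference. Using coordinates as coefficients gives the exponents a linear order compatible with
  addition.\<close>

lemma ordered_embedding:
  "\<exists>\<phi> :: nat ^ 'p \<Rightarrow> int Polynomial.poly. inj \<phi> \<and> (\<forall>x y. \<phi> (x + y) = \<phi> x + \<phi> y)"
proof -
  obtain h :: "'p \<Rightarrow> nat" where h: "inj h"
    using finite_imp_inj_to_nat_seg[of "UNIV :: 'p set"] by auto
  define \<phi> :: "nat ^ 'p \<Rightarrow> int Polynomial.poly" where "\<phi> x = (\<Sum>i\<in>UNIV. Polynomial.monom (int (x $ i)) (h i))" for x
  have "Polynomial.coeff (\<phi> x) (h i) = int (x $ i)" for x i
    by (simp add: \<phi>_def coeff_sum inj_eq[OF h])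
  then have "inj \<phi>" unfolding inj_def vec_eq_iff by (metis of_nat_eq_iff)
  moreover have "\<phi> (x + y) = \<phi> x + \<phi> y" for x y
    by (simp add: \<phi>_def sum.distrib flip: add_monom)
  ultimately show ?thesis by blast
qed

text \<open>Take the two maxima for the order above. The corresponding coefficient of a product
  cannot cancel.\<close>

lemma unique_sum:
  fixes A B :: "(nat ^ 'p) set"
  assumes "finite A" "A \<noteq> {}" "finite B" "B \<noteq> {}"
  obtains a b where "a \<in> A" "b \<in> B" "\<And>a' b'. a' \<in> A \<Longrightarrow> b' \<in> B \<Longrightarrow> a' + b' = a + b \<Longrightarrow> a' = a \<and> b' = b"
proof -
  obtain \<phi> :: "nat ^ 'p \<Rightarrow> int Polynomial.poly"
    where \<phi>: "inj \<phi>" "\<And>x y. \<phi> (x + y) = \<phi> x + \<phi> y"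
    using ordered_embedding by metis
  have max: "\<exists>a\<in>A. \<forall>a'\<in>A. \<phi> a' \<le> \<phi> a" if "finite A" "A \<noteq> {}" for A
  proof -
    have "Max (\<phi> ` A) \<in> \<phi> ` A" using that by (intro Max_in) auto
    then obtain a where "a \<in> A" "\<phi> a = Max (\<phi> ` A)" by auto
    then show ?thesis using that by (metis Max_ge finite_imageI imageI)
  qed
  from max[OF assms(1,2)] max[OF assms(3,4)] obtain a b
    where ab: "a \<in> A" "\<forall>a'\<in>A. \<phi> a' \<le> \<phi> a" "b \<in> B" "\<forall>b'\<in>B. \<phi> b' \<le> \<phi> b"
    by (elim bexE)
  show ?thesis
  proof (rule that[OF ab(1,3)])
    fix a' b' assume *: "a' \<in> A" "b' \<in> B" "a' + b' = a + b"
    then have "\<phi> a' + \<phi> b' = \<phi> a + \<phi> b" by (metis \<phi>(2))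
    moreover have "\<phi> a' \<le> \<phi> a" "\<phi> b' \<le> \<phi> b" using * ab by auto
    ultimately have "\<phi> a' = \<phi> a" "\<phi> b' = \<phi> b" by linarith+
    then show "a' = a \<and> b' = b" using \<phi>(1) by (simp add: inj_eq)
  qed
qed

lemma carrier_semigroup_ring: "f \<in> carrier (semigroup_ring S) \<longleftrightarrow> Poly_Mapping.keys f \<subseteq> S"
  by (simp add: semigroup_ring_def)

lemma semigroup_ring_ops:
  "x \<otimes>\<^bsub>semigroup_ring S\<^esub> y = x * y" "x \<oplus>\<^bsub>semigroup_ring S\<^esub> y = x + y"
  "\<one>\<^bsub>semigroup_ring S\<^esub> = 1" "\<zero>\<^bsub>semigroup_ring S\<^esub> = 0"
  by (simp_all add: semigroup_ring_def)

lemma semigroup_ring_a_inv: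
  fixes x :: "'a::comm_monoid_add \<Rightarrow>\<^sub>0 'k::field"
  assumes "add_submonoid S" "x \<in> carrier (semigroup_ring S)"
  shows "\<ominus>\<^bsub>semigroup_ring S\<^esub> x = - x"
proof -
  interpret cring "semigroup_ring S :: ('a \<Rightarrow>\<^sub>0 'k) ring"
    by (rule semigroup_ring_cring[OF assms(1)])
  show ?thesis
    by (rule minus_equality) (use assms in \<open>auto simp: semigroup_ring_ops carrier_semigroup_ring\<close>)
qed

lemma semigroup_ring_ideal_iff:
  fixes I :: "('a::comm_monoid_add \<Rightarrow>\<^sub>0 'k::field) set"
  assumes S: "add_submonoid S"
  shows "ideal I (semigroup_ring S) \<longleftrightarrow> I \<subseteq> carrier (semigroup_ring S) \<and> 0 \<in> I \<and>
    (\<forall>x\<in>I. \<forall>y\<in>I. x + y \<in> I) \<and> (\<forall>r\<in>carrier (semigroup_ring S). \<forall>x\<in>I. r * x \<in> I)"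
    (is "_ \<longleftrightarrow> ?R")
proof -
  let ?K = "semigroup_ring S :: ('a \<Rightarrow>\<^sub>0 'k) ring"
  interpret K: cring ?K by (rule semigroup_ring_cring[OF S])
  have ?R if "ideal I ?K"
  proof -
    interpret ideal I ?K by fact
    show ?thesis
      using a_subset additive_subgroup.zero_closed[OF is_additive_subgroup] a_closed I_l_closed
      by (auto simp: semigroup_ring_ops)
  qed
  moreover have "ideal I ?K" if R: ?R
  proof (rule idealI)
    show "Ring.ring ?K" by (rule K.ring_axioms)
    have inv: "inv\<^bsub>add_monoid ?K\<^esub> x \<in> I" if "x \<in> I" for x
    proof -
      have x: "x \<in> carrier ?K" using that R by auto
      have "- 1 \<in> carrier ?K"
        using S by (simp add: carrier_semigroup_ring add_submonoid_def)
      then have "(- 1) * x \<in> I" using R that by blast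
      then show ?thesis
        using semigroup_ring_a_inv[OF S x] by (simp add: a_inv_def)
    qed
    show "subgroup I (add_monoid ?K)"
      by (rule subgroup.intro) (use R inv in \<open>auto simp: semigroup_ring_ops\<close>)
    show lm: "x \<otimes>\<^bsub>?K\<^esub> a \<in> I" if "a \<in> I" "x \<in> carrier ?K" for a x
      using R that by (simp add: semigroup_ring_ops)
    show "a \<otimes>\<^bsub>?K\<^esub> x \<in> I" if "a \<in> I" "x \<in> carrier ?K" for a x
      using lm[OF that] by (simp add: semigroup_ring_ops mult.commute)
  qed
  ultimately show ?thesis by blast
qed

section \<open>Monomial primes from faces\<close>

lemma keys_times_subset:
  assumes "Poly_Mapping.keys f \<subseteq> A" "Poly_Mapping.keys g \<subseteq> B"
    "\<And>a b. a \<in> A \<Longrightarrow> b \<in> B \<Longrightarrow> a + b \<in> C"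
  shows "Poly_Mapping.keys (f * g) \<subseteq> C"
  using keys_mult[of f g] assms by blast

lemma keys_plus_subset:
  assumes "Poly_Mapping.keys f \<subseteq> A" "Poly_Mapping.keys g \<subseteq> A"
  shows "Poly_Mapping.keys (f + g) \<subseteq> A"
  using Poly_Mapping.keys_add[of f g] assms by blast

definition face :: "(nat ^ 'p) set \<Rightarrow> (nat ^ 'p) set \<Rightarrow> bool" where
  "face S F \<longleftrightarrow> F \<subseteq> S \<and> 0 \<in> F \<and> (\<forall>x\<in>S. \<forall>y\<in>S. x + y \<in> F \<longleftrightarrow> x \<in> F \<and> y \<in> F)"

text \<open>For a face \<open>F\<close> this is the kernel of the projection of the semigroup ring
  onto that of \<open>F\<close>; \<open>F = {0}\<close> gives the irrelevant maximal ideal.\<close>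

definition face_ideal :: "(nat ^ 'p) set \<Rightarrow> (nat ^ 'p) set \<Rightarrow> (nat ^ 'p \<Rightarrow>\<^sub>0 'k::field) set" where
  "face_ideal S F = {f. Poly_Mapping.keys f \<subseteq> S - F}"

lemma face_ideal_ideal:
  fixes S :: "(nat ^ 'p) set"
  assumes S: "add_submonoid S" and F: "face S F"
  shows "ideal (face_ideal S F :: (nat ^ 'p \<Rightarrow>\<^sub>0 'k::field) set) (semigroup_ring S)"
  unfolding semigroup_ring_ideal_iff[OF S]
proof (intro conjI ballI)
  show "r * x \<in> face_ideal S F"
    if "r \<in> carrier (semigroup_ring S)" "x \<in> face_ideal S F" for r x :: "nat ^ 'p \<Rightarrow>\<^sub>0 'k"
    using that unfolding face_ideal_def carrier_semigroup_ring mem_Collect_eq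
    by (rule keys_times_subset) (use S F in \<open>auto simp: face_def add_submonoid_def\<close>)
qed (auto simp: face_ideal_def carrier_semigroup_ring dest: keys_plus_subset)

text \<open>Apply \<open>unique_sum\<close> to the exponents of \<open>f\<close> and
  \<open>g\<close> in \<open>F\<close>. A sum lies in \<open>F\<close> only if both summands do, so
  the coefficient of \<open>f * g\<close> at the unique sum is a single nonzero product.\<close>

lemma face_ideal_prime:
  fixes S :: "(nat ^ 'p) set"
  assumes S: "add_submonoid S" and F: "face S F"
  shows "primeideal (face_ideal S F :: (nat ^ 'p \<Rightarrow>\<^sub>0 'k::field) set) (semigroup_ring S)"
proof (rule primeidealI[OF face_ideal_ideal[OF assms] semigroup_ring_cring[OF S]])
  let ?P = "face_ideal S F :: (nat ^ 'p \<Rightarrow>\<^sub>0 'k) set"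
  have "1 \<in> carrier (semigroup_ring S :: (nat ^ 'p \<Rightarrow>\<^sub>0 'k) ring)" "(1 :: nat ^ 'p \<Rightarrow>\<^sub>0 'k) \<notin> ?P"
    using F by (auto simp: carrier_semigroup_ring face_ideal_def face_def)
  then show "carrier (semigroup_ring S) \<noteq> ?P" by auto
  fix f g :: "nat ^ 'p \<Rightarrow>\<^sub>0 'k"
  assume "f \<in> carrier (semigroup_ring S)" "g \<in> carrier (semigroup_ring S)"
    "f \<otimes>\<^bsub>semigroup_ring S\<^esub> g \<in> ?P"
  then have fg: "Poly_Mapping.keys f \<subseteq> S" "Poly_Mapping.keys g \<subseteq> S"
    "Poly_Mapping.keys (f * g) \<subseteq> S - F"
    by (auto simp: carrier_semigroup_ring semigroup_ring_ops face_ideal_def)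
  show "f \<in> ?P \<or> g \<in> ?P"
  proof (rule ccontr)
    assume "\<not> (f \<in> ?P \<or> g \<in> ?P)"
    then have "Poly_Mapping.keys f \<inter> F \<noteq> {}" "Poly_Mapping.keys g \<inter> F \<noteq> {}"
      using fg by (auto simp: face_ideal_def)
    then obtain a b where ab: "a \<in> Poly_Mapping.keys f \<inter> F" "b \<in> Poly_Mapping.keys g \<inter> F"
      "\<And>a' b'. a' \<in> Poly_Mapping.keys f \<inter> F \<Longrightarrow> b' \<in> Poly_Mapping.keys g \<inter> F \<Longrightarrow>
        a' + b' = a + b \<Longrightarrow> a' = a \<and> b' = b"
      using unique_sum[of "Poly_Mapping.keys f \<inter> F" "Poly_Mapping.keys g \<inter> F"] by auto
    have "a \<in> S" "b \<in> S" using ab fg by auto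
    then have abF: "a + b \<in> F" using ab F by (simp add: face_def)
    have uniq: "a' = a \<and> b' = b"
      if "a' \<in> Poly_Mapping.keys f" "b' \<in> Poly_Mapping.keys g" "a' + b' = a + b" for a' b'
    proof -
      have "a' \<in> S" "b' \<in> S" "a' + b' \<in> F" using that fg abF by auto
      then have "a' \<in> F \<and> b' \<in> F" using F by (simp add: face_def)
      then show ?thesis using ab(3) that by auto
    qed
    have "Poly_Mapping.lookup (f * g) (a + b) = (\<Sum>a'\<in>Poly_Mapping.keys f. \<Sum>b'\<in>Poly_Mapping.keys g.
        if a' = a \<and> b' = b then Poly_Mapping.lookup f a * Poly_Mapping.lookup g b else 0)"
      unfolding lookup_mult_sum by (intro sum.cong refl) (use uniq in auto)
    also have "\<dots> = (\<Sum>a'\<in>Poly_Mapping.keys f. if a' = a then \<Sum>b'\<in>Poly_Mapping.keys g.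
        if b' = b then Poly_Mapping.lookup f a * Poly_Mapping.lookup g b else 0 else 0)"
      by (intro sum.cong refl) auto
    also have "\<dots> = Poly_Mapping.lookup f a * Poly_Mapping.lookup g b"
      using ab by (simp add: sum.delta)
    also have "\<dots> \<noteq> 0" using ab by (simp add: in_keys_iff)
    finally have "a + b \<in> Poly_Mapping.keys (f * g)" by (simp add: in_keys_iff)
    then show False using fg(3) abF by auto
  qed
qed

lemma face_ideal_zero_maximal:
  fixes S :: "(nat ^ 'p) set"
  assumes S: "add_submonoid S"
  shows "maximalideal (face_ideal S {0} :: (nat ^ 'p \<Rightarrow>\<^sub>0 'k::field) set) (semigroup_ring S)"
proof -
  let ?K = "semigroup_ring S :: (nat ^ 'p \<Rightarrow>\<^sub>0 'k) ring"
  let ?M = "face_ideal S {0} :: (nat ^ 'p \<Rightarrow>\<^sub>0 'k) set"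
  have face: "face S {0}"
    using S by (auto simp: face_def add_submonoid_def vec_nat_add_eq_0)
  interpret P: primeideal ?M ?K by (rule face_ideal_prime[OF S face])
  show ?thesis
  proof (rule maximalidealI)
    show "ideal ?M ?K" by (rule P.is_ideal)
    show "carrier ?K \<noteq> ?M" by (rule P.I_notcarr)
    fix J assume J: "ideal J ?K" "?M \<subseteq> J" "J \<subseteq> carrier ?K"
    note J' = J(1)[unfolded semigroup_ring_ideal_iff[OF S]]
    show "J = ?M \<or> J = carrier ?K"
    proof (cases "J \<subseteq> ?M")
      case False
      then obtain f where f: "f \<in> J" "f \<notin> ?M" by auto
      define c where "c = Poly_Mapping.lookup f 0"
      have fS: "Poly_Mapping.keys f \<subseteq> S" using subsetD[OF J(3) f(1)] by (simp add: carrier_semigroup_ring)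
      then have c: "c \<noteq> 0" using f(2) by (auto simp: face_ideal_def c_def in_keys_iff)
      \<comment> \<open>Removing the constant term \<open>c\<close> from \<open>f\<close> leaves an
        element of the face ideal, so \<open>J\<close> contains the nonzero constant
        \<open>c\<close>.\<close>
      define g where "g = Poly_Mapping.single 0 c - f"
      have "Poly_Mapping.lookup g k = (if k = 0 then 0 else - Poly_Mapping.lookup f k)" for k
        by (simp add: g_def lookup_minus lookup_single when_def c_def)
      then have "Poly_Mapping.keys g \<subseteq> Poly_Mapping.keys f - {0}"
        by (auto simp: in_keys_iff split: if_splits)
      then have "g \<in> ?M" using fS by (auto simp: face_ideal_def)
      then have "g \<in> J" using J(2) by blast
      then have "g + f \<in> J" using f J' by blast
      moreover have "Poly_Mapping.single 0 (1 / c) \<in> carrier ?K"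
        using submonoidD(1)[OF S] by (simp add: carrier_semigroup_ring)
      ultimately have "Poly_Mapping.single 0 (1 / c) * Poly_Mapping.single 0 c \<in> J"
        using J' by (simp add: g_def)
      then have "\<one>\<^bsub>?K\<^esub> \<in> J"
        using c by (simp add: mult_single semigroup_ring_ops)
      then show ?thesis using ideal.one_imp_carrier[OF J(1)] by simp
    qed (use J in auto)
  qed
qed

lemma prime_height_ge:
  fixes S :: "(nat ^ 'p) set"
  assumes affine: "affine_semigroup S"
    and card: "card (multiplicities S) = CARD('p)" and dim: "dim (real_cone S) = CARD('p)"
  shows "enat (CARD('p)) \<le>
    prime_height (semigroup_ring S :: (nat ^ 'p \<Rightarrow>\<^sub>0 'k::field) ring) (face_ideal S {0})"
proof -
  let ?K = "semigroup_ring S :: (nat ^ 'p \<Rightarrow>\<^sub>0 'k) ring"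
  let ?p = "CARD('p)"
  note S = affine_semigroup_submonoid[OF affine]
  obtain l :: "nat ^ 'p \<Rightarrow> nat ^ 'p \<Rightarrow> real"
    where add: "\<forall>e x y. l e (x + y) = l e x + l e y" and zero: "\<forall>e. l e 0 = 0"
      and nonneg: "\<forall>e x. x \<in> S \<longrightarrow> 0 \<le> l e x"
      and delta: "\<forall>e. \<forall>e'\<in>multiplicities S. l e e' = (if e' = e then 1 else 0)"
      and sep: "\<forall>x\<in>S. (\<forall>e\<in>multiplicities S. l e x = 0) \<longrightarrow> x = 0"
    using multiplicity_functionals[OF affine card dim] by (elim exE conjE)
  have "finite (multiplicities S)" using card by (intro card_ge_0_finite) simp
  then obtain e where e: "bij_betw e {..<?p} (multiplicities S)"
    using ex_bij_betw_nat_finite[of "multiplicities S"] card by (auto simp: atLeast0LessThan)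
  have eE: "e i \<in> multiplicities S" if "i < ?p" for i
    using e that by (auto simp: bij_betw_def)
  have eS: "e i \<in> S" if "i < ?p" for i
    using eE[OF that] by (simp add: multiplicities_def)
  \<comment> \<open>The face of the first \<open>j\<close> multiplicities: all later dual
    coordinates vanish.\<close>
  define F where "F j = {s \<in> S. \<forall>i<?p. j \<le> i \<longrightarrow> l (e i) s = 0}" for j
  have face: "face S (F j)" for j
  proof -
    have "l (e i) (x + y) = 0 \<longleftrightarrow> l (e i) x = 0 \<and> l (e i) y = 0" if "x \<in> S" "y \<in> S" "i < ?p" for i x y
      using nonneg that(1,2) by (simp add: add add_nonneg_eq_0_iff)
    then show ?thesis
      using submonoidD[OF S] by (auto simp: face_def F_def zero)
  qed
  have F0: "F 0 = {0}"
  proof -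
    have "x = 0" if "x \<in> F 0" for x
    proof -
      have "l u x = 0" if u: "u \<in> multiplicities S" for u
      proof -
        obtain i where "i < ?p" "u = e i" using e u unfolding bij_betw_def by blast
        then show ?thesis using \<open>x \<in> F 0\<close> by (simp add: F_def)
      qed
      then show ?thesis using that sep by (simp add: F_def)
    qed
    then show ?thesis using face[of 0] by (auto simp: face_def)
  qed
  \<comment> \<open>Larger faces have smaller ideals, so the index is reversed. The monomial of
    \<open>e i\<close> separates consecutive primes.\<close>
  define Q :: "nat \<Rightarrow> (nat ^ 'p \<Rightarrow>\<^sub>0 'k) set" where "Q n = face_ideal S (F (?p - n))" for n
  have "Q n \<subset> Q (Suc n)" if n: "n < ?p" for n
  proof -
    define i where "i = ?p - Suc n"
    have i: "i < ?p" "?p - n = Suc i" using n by (auto simp: i_def)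
    have "F i \<subseteq> F (Suc i)" by (auto simp: F_def)
    then have "Q n \<subseteq> Q (Suc n)" using i(2) by (auto simp: Q_def face_ideal_def i_def)
    moreover have "e i \<in> F (Suc i)"
    proof -
      have "l (e k) (e i) = 0" if "k < ?p" "Suc i \<le> k" for k
      proof -
        have "e k = e i \<longleftrightarrow> k = i"
          using e that(1) i(1) unfolding bij_betw_def by (intro inj_on_eq_iff[of e "{..<?p}"]) auto
        then have "e k \<noteq> e i" using that(2) by simp
        then show ?thesis using delta eE[OF i(1)] by simp
      qed
      then show ?thesis using eS[OF i(1)] by (simp add: F_def)
    qed
    moreover have "e i \<notin> F i" using i delta eE[OF i(1)] by (auto simp: F_def)
    ultimately have "Poly_Mapping.single (e i) 1 \<in> Q (Suc n) - Q n"
      using i eS[OF i(1)] by (auto simp: Q_def face_ideal_def i_def)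
    then show ?thesis using \<open>Q n \<subseteq> Q (Suc n)\<close> by blast
  qed
  moreover have "primeideal (Q n) ?K" for n
    unfolding Q_def by (rule face_ideal_prime[OF S face])
  moreover have "Q ?p = face_ideal S {0}" by (simp add: Q_def F0)
  ultimately show ?thesis
    unfolding prime_height_def by (intro Sup_upper) blast
qed

lemma semigroup_ring_noetherian_subring:
  fixes S :: "(nat ^ 'p) set"
  assumes S: "add_submonoid S"
    and noeth: "noetherian_ring (semigroup_ring S :: (nat ^ 'p \<Rightarrow>\<^sub>0 'k::field) ring)"
  shows "noetherian_subring (carrier (semigroup_ring S :: (nat ^ 'p \<Rightarrow>\<^sub>0 'k) ring)) (face_ideal S {0})"
proof -
  let ?K = "semigroup_ring S :: (nat ^ 'p \<Rightarrow>\<^sub>0 'k) ring"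
  interpret K: cring ?K by (rule semigroup_ring_cring[OF S])
  have "ideal (face_ideal S {0} :: (nat ^ 'p \<Rightarrow>\<^sub>0 'k) set) ?K"
    using face_ideal_zero_maximal[OF S] by (rule maximalideal.axioms)
  note M = this[unfolded semigroup_ring_ideal_iff[OF S]]
  show ?thesis
  proof
    fix C :: "nat \<Rightarrow> (nat ^ 'p \<Rightarrow>\<^sub>0 'k) set"
    assume C: "\<And>n. C n \<subseteq> carrier ?K \<and> 0 \<in> C n \<and> (\<forall>x\<in>C n. \<forall>y\<in>C n. x + y \<in> C n) \<and>
      (\<forall>r\<in>carrier ?K. \<forall>x\<in>C n. r * x \<in> C n)" and inc: "\<And>n. C n \<subseteq> C (Suc n)"
    have mono: "C m \<subseteq> C n" if "m \<le> n" for m n using lift_Suc_mono_le[of C] inc that by blast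
    have "\<Union>(range C) \<in> range C"
    proof (rule noetherian_ring.ideal_chain_is_trivial[OF noeth])
      show "subset.chain {I. ideal I ?K} (range C)"
        unfolding subset.chain_def semigroup_ring_ideal_iff[OF S]
        using C mono by (auto; metis nle_le subsetD)
    qed simp
    then obtain n where "\<Union>(range C) = C n" by auto
    then show "\<exists>n. C (Suc n) \<subseteq> C n" by blast
  next
    fix x y :: "nat ^ 'p \<Rightarrow>\<^sub>0 'k"
    assume "x \<in> carrier ?K" "y \<in> carrier ?K"
    then show "x + y \<in> carrier ?K" "x * y \<in> carrier ?K"
      using K.add.m_closed K.m_closed by (simp_all add: semigroup_ring_ops)
  qed (use M in \<open>auto simp: carrier_semigroup_ring submonoidD(1)[OF S]\<close>)
qed

section \<open>From depth to the exchange property\<close>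

lemma lookup_single_mult:
  fixes r :: "'a::cancel_comm_monoid_add \<Rightarrow>\<^sub>0 'k::field"
  shows "Poly_Mapping.lookup (Poly_Mapping.single a c * r) (a + k) = c * Poly_Mapping.lookup r k"
proof (cases "c = 0")
  case False
  then have "Poly_Mapping.keys (Poly_Mapping.single a c) = {a}" by simp
  then show ?thesis
    unfolding lookup_mult_sum by (subst \<open>Poly_Mapping.keys _ = _\<close>) (simp add: sum.delta in_keys_iff)
qed simp

lemma single_power: "Poly_Mapping.single s c ^ n = Poly_Mapping.single (n *s s) (c ^ n :: 'k::field)"
proof (induction n)
  case 0
  have "0 *s s = 0" by (simp add: vec_eq_iff)
  then show ?case by simp
next
  case (Suc n)
  have "Suc n *s s = s + n *s s" by (simp add: vec_eq_iff)
  then show ?case by (simp add: Suc mult_single)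
qed

lemma cohen_macaulay_depth:
  fixes S :: "(nat ^ 'p) set"
  assumes affine: "affine_semigroup S"
    and cm: "cohen_macaulay_ring (semigroup_ring S :: (nat ^ 'p \<Rightarrow>\<^sub>0 'k::field) ring)"
    and card: "card (multiplicities S) = CARD('p)" and dim: "dim (real_cone S) = CARD('p)"
  obtains n where "CARD('p) \<le> n"
    "noetherian_subring.depth_ge (carrier (semigroup_ring S)) (face_ideal S {0})
      (noetherian_subring.adjoin (carrier (semigroup_ring S :: (nat ^ 'p \<Rightarrow>\<^sub>0 'k) ring))
        (face_ideal S {0}) {0} 0) n"
proof -
  let ?K = "semigroup_ring S :: (nat ^ 'p \<Rightarrow>\<^sub>0 'k) ring"
  let ?M = "face_ideal S {0} :: (nat ^ 'p \<Rightarrow>\<^sub>0 'k) set"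
  note S = affine_semigroup_submonoid[OF affine]
  have noeth: "noetherian_ring ?K" using cm by (simp add: cohen_macaulay_ring_def)
  interpret noetherian_subring "carrier ?K" ?M
    by (rule semigroup_ring_noetherian_subring[OF S noeth])
  interpret K: cring ?K by (rule semigroup_ring_cring[OF S])
  have "enat (CARD('p)) \<le> ideal_depth ?K ?M"
    using prime_height_ge[OF affine card dim, where 'k = 'k]
      face_ideal_zero_maximal[OF S, where 'k = 'k] cm
    unfolding cohen_macaulay_ring_def by simp
  \<comment> \<open>Depth is a supremum, which yields a member only above a strictly smaller bound;
    lengths being integers, exceeding \<open>p - 1\<close> means at least \<open>p\<close>.\<close>
  then have "enat (CARD('p) - 1) < ideal_depth ?K ?M"
    by (rule less_le_trans[rotated]) simp
  then obtain xs where xs: "regular_sequence ?K xs" "set xs \<subseteq> ?M" "CARD('p) - 1 < length xs"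
    unfolding ideal_depth_def less_Sup_iff by auto
  have ideal_iff: "is_ideal I \<longleftrightarrow> ideal I ?K" for I
    by (simp add: semigroup_ring_ideal_iff[OF S] is_ideal_def)
  have gen: "genideal ?K (set gs) = comb {0} gs" if gs: "set gs \<subseteq> carrier ?K" for gs
  proof
    show "genideal ?K (set gs) \<subseteq> comb {0} gs"
      by (rule K.genideal_minimal)
        (use gs comb_gens[OF zero_ideal] comb_ideal[OF zero_ideal] in \<open>auto simp: ideal_iff\<close>)
    have "is_ideal (genideal ?K (set gs))"
      unfolding ideal_iff by (rule K.genideal_ideal[OF gs])
    then show "comb {0} gs \<subseteq> genideal ?K (set gs)"
      by (rule comb_least) (use K.genideal_self[OF gs] idealD(2) \<open>is_ideal (genideal ?K (set gs))\<close> in auto)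
  qed
  have "depth_ge (adjoin {0} 0) (length xs)"
  proof (rule depth_ge_of_regular[OF zero_ideal xs(2)])
    fix i r assume i: "i < length xs" and r: "r \<in> carrier ?K" "r * xs ! i \<in> comb {0} (rev (take i xs))"
    have "set (rev (take i xs)) \<subseteq> carrier ?K"
      using xs(2) M_sub set_take_subset[of i xs] by auto
    note g = gen[OF this]
    have "genideal ?K (set (take i xs)) = comb {0} (rev (take i xs))" using g by simp
    then show "r \<in> comb {0} (rev (take i xs))"
      using xs(1) i r by (auto simp: regular_sequence_def semigroup_ring_ops)
  qed
  moreover have "CARD('p) \<le> length xs" using xs(3) by simp
  ultimately show ?thesis using that by blast
qed

text \<open>The condition of Goto, Suzuki and Watanabe: \<open>X\<^sup>e\<close>, \<open>X\<^sup>f\<close> is a regular sequence. If it failed,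
  \<open>X\<^sup>s\<close> would be a nonzero element modulo \<open>X\<^sup>f\<close> that \<open>X\<^sup>e\<close> and \<open>X\<^sup>f\<close> annihilate, so its support
  would have dimension at most \<open>p - 2\<close>, less than the depth \<open>p - 1\<close> modulo \<open>X\<^sup>f\<close>.\<close>

lemma cohen_macaulay_exchange:
  fixes S :: "(nat ^ 'p) set"
  assumes affine: "affine_semigroup S"
    and cm: "cohen_macaulay_ring (semigroup_ring S :: (nat ^ 'p \<Rightarrow>\<^sub>0 'k::field) ring)"
    and card: "card (multiplicities S) = CARD('p)" and dim: "dim (real_cone S) = CARD('p)"
    and ef: "e \<in> multiplicities S" "f \<in> multiplicities S" "e \<noteq> f"
    and st: "s \<in> S" "t \<in> S" "e + s = f + t"
  shows "\<exists>u\<in>S. s = f + u"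
proof (rule ccontr)
  assume contra: "\<not> (\<exists>u\<in>S. s = f + u)"
  let ?K = "semigroup_ring S :: (nat ^ 'p \<Rightarrow>\<^sub>0 'k) ring"
  let ?M = "face_ideal S {0} :: (nat ^ 'p \<Rightarrow>\<^sub>0 'k) set"
  let ?X = "\<lambda>x :: nat ^ 'p. Poly_Mapping.single x (1 :: 'k)"
  note S = affine_semigroup_submonoid[OF affine]
  have noeth: "noetherian_ring ?K" using cm by (simp add: cohen_macaulay_ring_def)
  interpret noetherian_subring "carrier ?K" ?M
    by (rule semigroup_ring_noetherian_subring[OF S noeth])
  have E: "x \<in> S" "x \<noteq> 0" if "x \<in> multiplicities S" for x
    using that by (auto simp: multiplicities_def)
  have XR: "?X x \<in> carrier ?K" if "x \<in> S" for x
    using that by (simp add: carrier_semigroup_ring)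
  have XM: "?X x \<in> ?M" if "x \<in> multiplicities S" for x
    using E[OF that] by (simp add: face_ideal_def)
  have fin: "finite (multiplicities S)" using card by (intro card_ge_0_finite) simp
  have card2: "2 \<le> CARD('p)"
    using card_mono[OF fin, of "{e, f}"] ef card by simp
  define I\<^sub>0 where "I\<^sub>0 = adjoin {0} (0 :: nat ^ 'p \<Rightarrow>\<^sub>0 'k)"
  have I\<^sub>0: "closed_ideal I\<^sub>0"
    unfolding I\<^sub>0_def by (rule adjoin_closed_ideal[OF zero_ideal R_zero])
  obtain n where n: "CARD('p) \<le> n" "depth_ge I\<^sub>0 n"
    unfolding I\<^sub>0_def by (rule cohen_macaulay_depth[OF affine cm card dim])
  then obtain n' where n': "n = Suc n'" using card2 by (cases n) auto
  have fR: "?X f \<in> carrier ?K" using XR E ef by auto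
  have nz: "nonzerodivisor I\<^sub>0 (?X f)"
    unfolding nonzerodivisor_def
  proof (intro ballI impI)
    fix r assume r: "r \<in> carrier ?K" "?X f * r \<in> I\<^sub>0"
    then obtain v where v: "v \<in> units" "v * (?X f * r) = 0" by (auto simp: I\<^sub>0_def elim!: adjoinE)
    then have "?X f * (v * r) = 0" by (simp add: ac_simps)
    then have "v * r = 0"
      using lookup_single_mult[of f "1 :: 'k" "v * r"] by (intro poly_mapping_eqI) (metis lookup_zero mult_1)
    then show "r \<in> I\<^sub>0"
      unfolding I\<^sub>0_def using r v by (intro adjoinI[of _ v 0]) (auto simp: R_zero)
  qed
  define I where "I = adjoin I\<^sub>0 (?X f)"
  have I: "closed_ideal I" unfolding I_def by (rule adjoin_closed_ideal[OF closed_idealD[OF I\<^sub>0] fR])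
  have depth: "depth_ge I n'"
    unfolding I_def by (rule depth_adjoin[OF I\<^sub>0 _ XM[OF ef(2)] nz]) (use n n' in simp)
  have sI: "?X s \<notin> I"
  proof
    assume "?X s \<in> I"
    then obtain v c d where *: "v \<in> units" "c \<in> carrier ?K" "v * ?X s - d * 0 - c * ?X f \<in> {0}"
      unfolding I_def I\<^sub>0_def adjoin_adjoin[OF zero_ideal R_zero fR]
      by (auto simp: algebra_simps)
    then have "?X s * v = c * ?X f" by (simp add: mult.commute)
    \<comment> \<open>As \<open>v\<close> is congruent to 1 modulo the irrelevant ideal,
      \<open>s\<close> has coefficient 1 in \<open>X^s * v\<close>. So it occurs in
      \<open>c * X^f\<close>, which puts it into \<open>f + S\<close>.\<close>
    moreover have "Poly_Mapping.lookup v 0 = 1"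
    proof -
      have "1 - v \<in> ?M" using *(1) by (simp add: units_def)
      then have "0 \<notin> Poly_Mapping.keys (1 - v)" by (auto simp: face_ideal_def)
      then show ?thesis by (simp add: in_keys_iff lookup_minus)
    qed
    ultimately have "Poly_Mapping.lookup (c * ?X f) s = 1"
      using lookup_single_mult[of s "1 :: 'k" v 0] by simp
    then have "s \<in> Poly_Mapping.keys (c * ?X f)" by (simp add: in_keys_iff)
    then obtain a where "a \<in> Poly_Mapping.keys c" "s = a + f"
      using keys_mult[of c "?X f"] by auto
    then show False using contra *(2) by (auto simp: carrier_semigroup_ring add.commute)
  qed
  note I' = closed_idealD[OF I]
  define H\<^sub>0 where "H\<^sub>0 = quotient I (?X s) \<inter> ?M"
  have H\<^sub>0: "is_ideal H\<^sub>0"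
    using quotient_ideal[OF I' XR[OF st(1)]] M_ideal unfolding H\<^sub>0_def is_ideal_def by blast
  have fI: "?X f \<in> I" unfolding I_def by (rule adjoin_self[OF closed_idealD[OF I\<^sub>0] fR])
  have eH: "?X e \<in> H\<^sub>0"
  proof -
    have "?X e * ?X s = ?X t * ?X f" by (simp add: mult_single st(3) add.commute)
    then have "?X e * ?X s \<in> I" using idealD(4)[OF I' XR[OF st(2)] fI] by simp
    then show ?thesis using XM[OF ef(1)] M_R by (auto simp: H\<^sub>0_def quotient_def)
  qed
  have fH: "?X f \<in> H\<^sub>0"
    using idealD(5)[OF I' XR[OF st(1)] fI] XM[OF ef(2)] M_R by (auto simp: H\<^sub>0_def quotient_def)
  \<comment> \<open>Modulo \<open>I\<close>, the element \<open>X^s\<close> is annihilated by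
    \<open>X^e\<close> and \<open>X^f\<close>, so only the other \<open>p - 2\<close> multiplicities
    have to be adjoined to the annihilator.\<close>
  obtain gs where gs: "set gs = multiplicities S - {e, f}" "distinct gs"
    using finite_distinct_list[of "multiplicities S - {e, f}"] fin by auto
  have len: "length gs = CARD('p) - 2"
    using distinct_card[OF gs(2)] gs(1) card_Diff_subset[of "{e, f}" "multiplicities S"] ef card by simp
  define H where "H = comb H\<^sub>0 (map ?X gs)"
  have H: "is_ideal H" unfolding H_def by (rule comb_ideal[OF H\<^sub>0])
  have gM: "set (map ?X gs) \<subseteq> ?M" using gs XM by auto
  have XH: "?X x \<in> H" if "x \<in> multiplicities S" for x
  proof (cases "x \<in> {e, f}")
    case True
    then show ?thesis using eH fH comb_base[OF H\<^sub>0] by (auto simp: H_def)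
  next
    case False
    then have "?X x \<in> set (map ?X gs)" using gs that by auto
    then show ?thesis using comb_gens[OF H\<^sub>0, of "map ?X gs"] gM M_R unfolding H_def by blast
  qed
  have mono: "\<exists>k. Poly_Mapping.single x c ^ k \<in> H" if x: "x \<in> S" "x \<noteq> 0" for x c
  proof -
    obtain k g u where kgu: "g \<in> multiplicities S" "u \<in> S" "k *s x = g + u"
      using multiple_above_multiplicity[OF affine x] .
    have "Poly_Mapping.single x c ^ k = Poly_Mapping.single u (c ^ k) * ?X g"
      by (simp add: single_power kgu(3) mult_single add.commute)
    also have "\<dots> \<in> H"
      by (rule idealD(4)[OF H _ XH[OF kgu(1)]]) (use kgu in \<open>simp add: carrier_semigroup_ring\<close>)
    finally show ?thesis by blast
  qed
  have rad: "(\<Sum>x\<in>A. Poly_Mapping.single x (c x)) \<in> carrier ?K \<and>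
      (\<exists>k. (\<Sum>x\<in>A. Poly_Mapping.single x (c x)) ^ k \<in> H)"
    if "finite A" "A \<subseteq> S - {0}" for A c
    using that
  proof (induction A)
    case empty
    then show ?case using idealD(2)[OF H] by (auto simp: R_zero intro!: exI[of _ 1])
  next
    case (insert x A)
    obtain k where k: "(\<Sum>x\<in>A. Poly_Mapping.single x (c x)) ^ k \<in> H" using insert by auto
    obtain k' where k': "Poly_Mapping.single x (c x) ^ k' \<in> H" using mono insert.prems by blast
    have xR: "Poly_Mapping.single x (c x) \<in> carrier ?K"
      using insert.prems by (simp add: carrier_semigroup_ring)
    have "(Poly_Mapping.single x (c x) + (\<Sum>x\<in>A. Poly_Mapping.single x (c x))) ^ (k' + k) \<in> H"
      by (rule radical_add[OF H xR _ k' k]) (use insert in auto)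
    then show ?case using insert xR by (auto intro: R_add)
  qed
  have "\<exists>k. r ^ k \<in> comb (quotient I (?X s) \<inter> ?M) (map ?X gs)" if "r \<in> ?M" for r
  proof -
    have "Poly_Mapping.keys r \<subseteq> S - {0}" using that by (simp add: face_ideal_def)
    then show ?thesis
      using rad[of "Poly_Mapping.keys r" "Poly_Mapping.lookup r"]
      unfolding poly_mapping_decompose[of r, symmetric] H_def H\<^sub>0_def by simp
  qed
  then have "n' \<le> length (map ?X gs)"
    by (rule depth_le_length[OF I depth XR[OF st(1)] sI gM])
  \<comment> \<open>Here \<open>n = n' + 1\<close> is at least \<open>p\<close>, while
    \<open>n'\<close> is at most \<open>p - 2\<close>.\<close>
  then show False using n n' len card2 by simp
qed


section \<open>Binomial ideals and moves\<close>

lemma s_degree_superset: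
  assumes "finite X" "Poly_Mapping.keys \<alpha> \<subseteq> X"
  shows "s_degree \<alpha> = (\<Sum>v\<in>X. Poly_Mapping.lookup \<alpha> v *s v)"
  unfolding s_degree_def using assms
  by (intro sum.mono_neutral_left) (auto simp: in_keys_iff vec_eq_iff)

lemma s_degree_add: "s_degree (\<alpha> + \<beta>) = s_degree \<alpha> + s_degree \<beta>"
proof -
  let ?X = "Poly_Mapping.keys \<alpha> \<union> Poly_Mapping.keys \<beta>"
  have "s_degree (\<alpha> + \<beta>) = (\<Sum>v\<in>?X. Poly_Mapping.lookup (\<alpha> + \<beta>) v *s v)"
    by (rule s_degree_superset) (auto dest: subsetD[OF Poly_Mapping.keys_add])
  also have "\<dots> = (\<Sum>v\<in>?X. Poly_Mapping.lookup \<alpha> v *s v) + (\<Sum>v\<in>?X. Poly_Mapping.lookup \<beta> v *s v)"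
    by (simp add: lookup_add sum.distrib vec_eq_iff distrib_right)
  also have "\<dots> = s_degree \<alpha> + s_degree \<beta>"
    by (simp add: s_degree_superset[of ?X])
  finally show ?thesis .
qed

lemma s_degree_single: "s_degree (Poly_Mapping.single v n) = n *s v"
  by (subst s_degree_superset[of "{v}"]) auto

lemma s_degree_zero: "s_degree 0 = 0"
  by (simp add: s_degree_def)

lemma keys_add_nat:
  "Poly_Mapping.keys (\<alpha> + \<beta> :: 'a \<Rightarrow>\<^sub>0 nat) = Poly_Mapping.keys \<alpha> \<union> Poly_Mapping.keys \<beta>"
  by (auto simp: in_keys_iff lookup_add)

lemma exponents_add_iff: "\<alpha> + \<beta> \<in> exponents S \<longleftrightarrow> \<alpha> \<in> exponents S \<and> \<beta> \<in> exponents S"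
  by (auto simp: exponents_def keys_add_nat)

lemma exponents_zero: "0 \<in> exponents S"
  by (simp add: exponents_def)

lemma exponents_submonoid: "add_submonoid (exponents S)"
  by (simp add: add_submonoid_def exponents_add_iff exponents_zero)

lemma remove_variable:
  assumes "v \<in> Poly_Mapping.keys \<alpha>"
  obtains \<alpha>' where "\<alpha> = Poly_Mapping.single v (1 :: nat) + \<alpha>'"
proof
  show "\<alpha> = Poly_Mapping.single v 1 + (\<alpha> - Poly_Mapping.single v 1)"
    using assms
    by (intro poly_mapping_eqI) (auto simp: lookup_add lookup_minus lookup_single when_def in_keys_iff)
qed

lemma monomial_diff_eq_0_iff: "monomial \<gamma> - monomial \<delta> = (0 :: _ \<Rightarrow>\<^sub>0 'k::field) \<longleftrightarrow> \<gamma> = \<delta>"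
proof
  assume "monomial \<gamma> - monomial \<delta> = (0 :: _ \<Rightarrow>\<^sub>0 'k)"
  then have "Poly_Mapping.lookup (monomial \<gamma>) \<gamma> = Poly_Mapping.lookup (monomial \<delta> :: _ \<Rightarrow>\<^sub>0 'k) \<gamma>"
    by simp
  then show "\<gamma> = \<delta>" by (simp add: monomial_def lookup_single when_def split: if_splits)
qed simp

lemma keys_monomial_diff:
  assumes "\<gamma> \<noteq> \<delta>"
  shows "Poly_Mapping.keys (monomial \<gamma> - monomial \<delta> :: _ \<Rightarrow>\<^sub>0 'k::field) = {\<gamma>, \<delta>}"
  using assms
  by (auto simp: in_keys_iff monomial_def lookup_minus lookup_single when_def split: if_splits)

definition move :: "(nat ^ 'p) set \<Rightarrow> ((nat ^ 'p \<Rightarrow>\<^sub>0 nat) \<Rightarrow>\<^sub>0 'k::field) set \<Rightarrow>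
    (nat ^ 'p \<Rightarrow>\<^sub>0 nat) \<Rightarrow> (nat ^ 'p \<Rightarrow>\<^sub>0 nat) \<Rightarrow> bool" where
  "move S G \<alpha> \<beta> \<longleftrightarrow> (\<exists>\<mu>\<in>exponents S. \<exists>\<gamma>\<in>exponents S. \<exists>\<delta>\<in>exponents S.
     (monomial \<gamma> - monomial \<delta> \<in> G \<or> monomial \<delta> - monomial \<gamma> \<in> G) \<and> \<alpha> = \<mu> + \<gamma> \<and> \<beta> = \<mu> + \<delta>)"

lemma moveE:
  assumes "move S G \<alpha> \<beta>"
  obtains \<mu> \<gamma> \<delta> where "\<mu> \<in> exponents S" "\<gamma> \<in> exponents S" "\<delta> \<in> exponents S"
    "monomial \<gamma> - monomial \<delta> \<in> G \<or> monomial \<delta> - monomial \<gamma> \<in> G" "\<alpha> = \<mu> + \<gamma>" "\<beta> = \<mu> + \<delta>"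
  using assms by (auto simp: move_def)

lemma moveI:
  assumes "\<mu> \<in> exponents S" "\<gamma> \<in> exponents S" "\<delta> \<in> exponents S"
    "monomial \<gamma> - monomial \<delta> \<in> G \<or> monomial \<delta> - monomial \<gamma> \<in> G"
  shows "move S G (\<mu> + \<gamma>) (\<mu> + \<delta>)"
  using assms unfolding move_def by blast

abbreviation connected_by :: "(nat ^ 'p) set \<Rightarrow> ((nat ^ 'p \<Rightarrow>\<^sub>0 nat) \<Rightarrow>\<^sub>0 'k::field) set \<Rightarrow>
    (nat ^ 'p \<Rightarrow>\<^sub>0 nat) \<Rightarrow> (nat ^ 'p \<Rightarrow>\<^sub>0 nat) \<Rightarrow> bool" where
  "connected_by S G \<equiv> (move S G)\<^sup>*\<^sup>*"

lemma connected_by_sym: "connected_by S G \<alpha> \<beta> \<Longrightarrow> connected_by S G \<beta> \<alpha>"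
proof -
  have "symp (move S G)" unfolding symp_def move_def by blast
  then show "connected_by S G \<alpha> \<beta> \<Longrightarrow> connected_by S G \<beta> \<alpha>"
    by (metis symp_rtranclp sympD)
qed

lemma move_translate: "move S G \<alpha> \<beta> \<Longrightarrow> \<mu> \<in> exponents S \<Longrightarrow> move S G (\<mu> + \<alpha>) (\<mu> + \<beta>)"
  by (elim moveE) (simp add: moveI exponents_add_iff flip: add.assoc)

lemma connected_by_translate:
  assumes "connected_by S G \<alpha> \<beta>" "\<mu> \<in> exponents S"
  shows "connected_by S G (\<mu> + \<alpha>) (\<mu> + \<beta>)"
  using assms(1)
  by induction (use move_translate[OF _ assms(2)] in \<open>auto intro: rtranclp.rtrancl_into_rtrancl\<close>)

lemma move_exponents: "move S G \<alpha> \<beta> \<Longrightarrow> \<beta> \<in> exponents S"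
  by (elim moveE) (simp add: exponents_add_iff)

text \<open>Membership in \<open>binomials\<close> supplies some pair of exponents of equal degree;
  the keys of the difference identify it with the given pair up to order.\<close>

lemma binomial_degree:
  assumes "monomial \<gamma> - monomial \<delta> \<in> (binomials S :: ((nat ^ 'p \<Rightarrow>\<^sub>0 nat) \<Rightarrow>\<^sub>0 'k::field) set)"
  shows "s_degree \<gamma> = s_degree \<delta>"
proof (cases "\<gamma> = \<delta>")
  case False
  obtain \<alpha> \<beta> where *: "monomial \<gamma> - monomial \<delta> = (monomial \<alpha> - monomial \<beta> :: _ \<Rightarrow>\<^sub>0 'k)"
    "s_degree \<alpha> = s_degree \<beta>"
    using assms by (auto simp: binomials_def)
  then have "\<alpha> \<noteq> \<beta>" using False by (metis monomial_diff_eq_0_iff)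
  then have "{\<gamma>, \<delta>} = {\<alpha>, \<beta>}"
    using keys_monomial_diff[OF False, where 'k = 'k] keys_monomial_diff[of \<alpha> \<beta>, where 'k = 'k] *(1)
    by simp
  then show ?thesis using *(2) by (metis doubleton_eq_iff)
qed simp

lemma move_degree:
  assumes "G \<subseteq> binomials S" "move S G \<alpha> \<beta>"
  shows "s_degree \<alpha> = s_degree \<beta>"
proof -
  obtain \<mu> \<gamma> \<delta> where *: "monomial \<gamma> - monomial \<delta> \<in> G \<or> monomial \<delta> - monomial \<gamma> \<in> G"
    "\<alpha> = \<mu> + \<gamma>" "\<beta> = \<mu> + \<delta>"
    using assms(2) by (elim moveE)
  then have "s_degree \<gamma> = s_degree \<delta>"
    using subsetD[OF assms(1)] binomial_degree[of \<gamma> \<delta> S] binomial_degree[of \<delta> \<gamma> S] by metis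
  then show ?thesis by (simp add: * s_degree_add)
qed

lemma connected_by_degree:
  assumes "G \<subseteq> binomials S" "connected_by S G \<alpha> \<beta>"
  shows "s_degree \<alpha> = s_degree \<beta>"
  using assms(2) by induction (auto simp: move_degree[OF assms(1)])

text \<open>The linear functional with prescribed values \<open>\<phi>\<close> on the
  monomials.\<close>

definition weighted_sum :: "('a \<Rightarrow> 'k) \<Rightarrow> ('a \<Rightarrow>\<^sub>0 'k::field) \<Rightarrow> 'k" where
  "weighted_sum \<phi> f = (\<Sum>a\<in>Poly_Mapping.keys f. Poly_Mapping.lookup f a * \<phi> a)"

lemma weighted_sum_superset:
  assumes "finite X" "Poly_Mapping.keys f \<subseteq> X"
  shows "weighted_sum \<phi> f = (\<Sum>a\<in>X. Poly_Mapping.lookup f a * \<phi> a)"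
  unfolding weighted_sum_def using assms by (intro sum.mono_neutral_left) (auto simp: in_keys_iff)

lemma weighted_sum_add: "weighted_sum \<phi> (f + g) = weighted_sum \<phi> f + weighted_sum \<phi> g"
proof -
  let ?X = "Poly_Mapping.keys f \<union> Poly_Mapping.keys g"
  have "weighted_sum \<phi> (f + g) = (\<Sum>a\<in>?X. Poly_Mapping.lookup (f + g) a * \<phi> a)"
    by (rule weighted_sum_superset) (auto dest: subsetD[OF Poly_Mapping.keys_add])
  then show ?thesis
    by (simp add: weighted_sum_superset[of ?X] lookup_add sum.distrib distrib_right)
qed

lemma weighted_sum_monomial_diff:
  "weighted_sum \<phi> (monomial \<alpha> - monomial \<beta>) = \<phi> \<alpha> - \<phi> \<beta>"
proof (cases "\<alpha> = \<beta>")
  case False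
  then show ?thesis
    unfolding weighted_sum_def keys_monomial_diff[OF False]
    by (simp add: monomial_def lookup_minus lookup_single when_def)
qed (simp add: weighted_sum_def)

text \<open>Multiplication by \<open>r\<close> replaces the weight by its translates. Constancy
  along moves survives translation, which makes the common zeros of such functionals an
  ideal.\<close>

lemma weighted_sum_mult:
  fixes f r :: "'a::comm_monoid_add \<Rightarrow>\<^sub>0 'k::field"
  shows "weighted_sum \<phi> (r * f) =
    (\<Sum>a\<in>Poly_Mapping.keys r. Poly_Mapping.lookup r a * weighted_sum (\<lambda>b. \<phi> (a + b)) f)"
proof -
  let ?A = "Poly_Mapping.keys r" and ?B = "Poly_Mapping.keys f"
  define X where "X = (\<lambda>(a, b). a + b) ` (?A \<times> ?B)"
  have X: "finite X" "\<And>a b. a \<in> ?A \<Longrightarrow> b \<in> ?B \<Longrightarrow> a + b \<in> X" by (auto simp: X_def)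
  have "Poly_Mapping.keys (r * f) \<subseteq> X" using keys_mult[of r f] by (auto simp: X_def)
  then have "weighted_sum \<phi> (r * f) = (\<Sum>k\<in>X. (\<Sum>a\<in>?A. \<Sum>b\<in>?B.
      if a + b = k then Poly_Mapping.lookup r a * Poly_Mapping.lookup f b else 0) * \<phi> k)"
    by (simp only: weighted_sum_superset[OF X(1)] lookup_mult_sum)
  also have "\<dots> = (\<Sum>k\<in>X. \<Sum>a\<in>?A. \<Sum>b\<in>?B.
      if k = a + b then Poly_Mapping.lookup r a * Poly_Mapping.lookup f b * \<phi> (a + b) else 0)"
    unfolding sum_distrib_right by (intro sum.cong refl) auto
  also have "\<dots> = (\<Sum>a\<in>?A. \<Sum>k\<in>X. \<Sum>b\<in>?B.
      if k = a + b then Poly_Mapping.lookup r a * Poly_Mapping.lookup f b * \<phi> (a + b) else 0)"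
    by (rule sum.swap)
  also have "\<dots> = (\<Sum>a\<in>?A. \<Sum>b\<in>?B. \<Sum>k\<in>X.
      if k = a + b then Poly_Mapping.lookup r a * Poly_Mapping.lookup f b * \<phi> (a + b) else 0)"
    by (rule sum.cong[OF refl], rule sum.swap)
  also have "\<dots> = (\<Sum>a\<in>?A. \<Sum>b\<in>?B. Poly_Mapping.lookup r a * Poly_Mapping.lookup f b * \<phi> (a + b))"
    by (intro sum.cong refl) (simp add: sum.delta X)
  finally show ?thesis by (simp add: weighted_sum_def sum_distrib_left mult.assoc)
qed

lemma monomial_add: "monomial (\<mu> + \<gamma>) = monomial \<mu> * monomial \<gamma>"
  by (simp add: monomial_def mult_single)

lemma monomial_carrier: "monomial \<alpha> \<in> carrier (semigroup_ring (exponents S)) \<longleftrightarrow> \<alpha> \<in> exponents S"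
  by (simp add: monomial_def carrier_semigroup_ring)

lemma binomials_carrier:
  "(binomials S :: ((nat ^ 'p \<Rightarrow>\<^sub>0 nat) \<Rightarrow>\<^sub>0 'k::field) set) \<subseteq> carrier (semigroup_ring (exponents S))"
proof
  fix f :: "(nat ^ 'p \<Rightarrow>\<^sub>0 nat) \<Rightarrow>\<^sub>0 'k"
  assume "f \<in> binomials S"
  then obtain \<alpha> \<beta> where "\<alpha> \<in> exponents S" "\<beta> \<in> exponents S" "f = monomial \<alpha> - monomial \<beta>"
    by (auto simp: binomials_def)
  then show "f \<in> carrier (semigroup_ring (exponents S))"
    by (cases "\<alpha> = \<beta>") (auto simp: carrier_semigroup_ring keys_monomial_diff)
qed

text \<open>A weight that is constant along moves gives a linear functional that vanishes on the generated
  ideal; the indicator functions of the classes of connected monomials separate these classes.\<close>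

lemma connected_by_iff_genideal:
  fixes G :: "((nat ^ 'p \<Rightarrow>\<^sub>0 nat) \<Rightarrow>\<^sub>0 'k::field) set"
  assumes G: "G \<subseteq> binomials S" and \<alpha>: "\<alpha> \<in> exponents S" and \<beta>: "\<beta> \<in> exponents S"
  shows "connected_by S G \<alpha> \<beta> \<longleftrightarrow>
    monomial \<alpha> - monomial \<beta> \<in> genideal (semigroup_ring (exponents S)) G"
proof
  let ?P = "semigroup_ring (exponents S) :: ((nat ^ 'p \<Rightarrow>\<^sub>0 nat) \<Rightarrow>\<^sub>0 'k) ring"
  let ?I = "genideal ?P G"
  interpret P: cring ?P by (rule semigroup_ring_cring[OF exponents_submonoid])
  have GP: "G \<subseteq> carrier ?P" using G binomials_carrier by blast
  note I = P.genideal_ideal[OF GP, unfolded semigroup_ring_ideal_iff[OF exponents_submonoid]]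
  have GI: "G \<subseteq> ?I" by (rule P.genideal_self[OF GP])
  have neg: "- x \<in> ?I" if "x \<in> ?I" for x
  proof -
    have "- 1 \<in> carrier ?P" by (simp add: carrier_semigroup_ring exponents_zero)
    then have "(- 1) * x \<in> ?I" using I that by blast
    then show ?thesis by simp
  qed
  show "monomial \<alpha> - monomial \<beta> \<in> ?I" if "connected_by S G \<alpha> \<beta>"
    using that
  proof induction
    case base
    then show ?case using I by simp
  next
    case (step \<gamma> \<delta>)
    obtain \<mu> \<gamma>' \<delta>' where m: "\<mu> \<in> exponents S" "\<gamma> = \<mu> + \<gamma>'" "\<delta> = \<mu> + \<delta>'"
      "monomial \<gamma>' - monomial \<delta>' \<in> G \<or> monomial \<delta>' - monomial \<gamma>' \<in> G"
      using step(2) by (auto simp: move_def)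
    have "monomial \<gamma>' - monomial \<delta>' \<in> ?I"
      using m(4) GI neg[of "monomial \<delta>' - monomial \<gamma>'"] by auto
    then have "monomial \<mu> * (monomial \<gamma>' - monomial \<delta>') \<in> ?I"
      using I m(1) monomial_carrier by blast
    then have "monomial \<gamma> - monomial \<delta> \<in> ?I" by (simp add: m monomial_add algebra_simps)
    then have "(monomial \<alpha> - monomial \<gamma>) + (monomial \<gamma> - monomial \<delta>) \<in> ?I" using I step.IH by blast
    then show ?case by simp
  qed
  define J where "J = {f \<in> carrier ?P. \<forall>\<phi>. (\<forall>\<alpha> \<beta>. move S G \<alpha> \<beta> \<longrightarrow> \<phi> \<alpha> = \<phi> \<beta>) \<longrightarrow> weighted_sum \<phi> f = 0}"
  have "ideal J ?P"
    unfolding semigroup_ring_ideal_iff[OF exponents_submonoid]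
  proof (intro conjI ballI)
    show "x + y \<in> J" if "x \<in> J" "y \<in> J" for x y
      using that P.add.m_closed[of x y] by (simp add: J_def semigroup_ring_ops weighted_sum_add)
    show "r * x \<in> J" if r: "r \<in> carrier ?P" and x: "x \<in> J" for r x
    proof -
      have "weighted_sum \<phi> (r * x) = 0" if \<phi>: "\<forall>\<alpha> \<beta>. move S G \<alpha> \<beta> \<longrightarrow> \<phi> \<alpha> = \<phi> \<beta>" for \<phi>
      proof -
        have "weighted_sum (\<lambda>b. \<phi> (a + b)) x = 0" if "a \<in> Poly_Mapping.keys r" for a
        proof -
          have "a \<in> exponents S" using r that by (auto simp: carrier_semigroup_ring)
          then have "\<forall>\<alpha> \<beta>. move S G \<alpha> \<beta> \<longrightarrow> \<phi> (a + \<alpha>) = \<phi> (a + \<beta>)"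
            using \<phi> move_translate by blast
          then show ?thesis using x by (simp add: J_def)
        qed
        then show ?thesis by (simp add: weighted_sum_mult)
      qed
      then show ?thesis
        using P.m_closed[OF r, of x] x by (simp add: J_def semigroup_ring_ops)
    qed
  qed (auto simp: J_def carrier_semigroup_ring weighted_sum_def)
  moreover have "G \<subseteq> J"
  proof
    fix g assume g: "g \<in> G"
    then obtain \<gamma> \<delta> where gd: "\<gamma> \<in> exponents S" "\<delta> \<in> exponents S" "g = monomial \<gamma> - monomial \<delta>"
      using G by (auto simp: binomials_def)
    then have "move S G \<gamma> \<delta>"
      using g moveI[OF exponents_zero gd(1,2), of G] by simp
    then show "g \<in> J" using g GP gd by (auto simp: J_def weighted_sum_monomial_diff)
  qed
  ultimately have IJ: "?I \<subseteq> J" by (rule P.genideal_minimal)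
  assume "monomial \<alpha> - monomial \<beta> \<in> ?I"
  then have J: "monomial \<alpha> - monomial \<beta> \<in> J" using IJ by auto
  define \<phi> :: "_ \<Rightarrow> 'k" where "\<phi> \<gamma> = (if connected_by S G \<alpha> \<gamma> then 1 else 0)" for \<gamma>
  have "\<phi> \<gamma> = \<phi> \<delta>" if m: "move S G \<gamma> \<delta>" for \<gamma> \<delta>
  proof -
    have c: "connected_by S G \<gamma> \<delta>" using m by (rule r_into_rtranclp)
    have "connected_by S G \<alpha> \<gamma> \<longleftrightarrow> connected_by S G \<alpha> \<delta>"
      using rtranclp_trans[OF _ c] rtranclp_trans[OF _ connected_by_sym[OF c]] by blast
    then show ?thesis by (simp add: \<phi>_def)
  qed
  then have "weighted_sum \<phi> (monomial \<alpha> - monomial \<beta>) = 0" using J by (simp add: J_def)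
  then have "\<phi> \<alpha> = \<phi> \<beta>" by (simp add: weighted_sum_monomial_diff)
  then show "connected_by S G \<alpha> \<beta>" by (simp add: \<phi>_def split: if_splits)
qed

text \<open>Turns generation of the ideal into connectedness of the monomials of each degree, so
  that Betti elements can be found combinatorially.\<close>

lemma generates_iff_connected:
  fixes G :: "((nat ^ 'p \<Rightarrow>\<^sub>0 nat) \<Rightarrow>\<^sub>0 'k::field) set"
  assumes G: "G \<subseteq> binomials S"
  shows "genideal (semigroup_ring (exponents S)) G = semigroup_ideal S \<longleftrightarrow>
    (\<forall>\<alpha>\<in>exponents S. \<forall>\<beta>\<in>exponents S. s_degree \<alpha> = s_degree \<beta> \<longrightarrow> connected_by S G \<alpha> \<beta>)"
proof -
  let ?P = "semigroup_ring (exponents S) :: ((nat ^ 'p \<Rightarrow>\<^sub>0 nat) \<Rightarrow>\<^sub>0 'k) ring"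
  interpret P: cring ?P by (rule semigroup_ring_cring[OF exponents_submonoid])
  have GP: "G \<subseteq> carrier ?P" using G binomials_carrier by blast
  have "genideal ?P G \<subseteq> semigroup_ideal S"
    unfolding semigroup_ideal_def
    by (intro P.genideal_minimal P.genideal_ideal binomials_carrier order_trans[OF G] P.genideal_self)
  moreover have "semigroup_ideal S \<subseteq> genideal ?P G \<longleftrightarrow> binomials S \<subseteq> genideal ?P G"
    unfolding semigroup_ideal_def
    using P.genideal_minimal[OF P.genideal_ideal[OF GP]] P.genideal_self[OF binomials_carrier] by blast
  moreover have "binomials S \<subseteq> genideal ?P G \<longleftrightarrow>
    (\<forall>\<alpha>\<in>exponents S. \<forall>\<beta>\<in>exponents S. s_degree \<alpha> = s_degree \<beta> \<longrightarrow> connected_by S G \<alpha> \<beta>)"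
    unfolding binomials_def using connected_by_iff_genideal[OF G] by blast
  ultimately show ?thesis by blast
qed


section \<open>Betti elements\<close>

text \<open>The interface between ring theory and combinatorics: the Cohen-Macaulay property
  survives only as \<open>exchange\<close>.\<close>

locale strong_exchange_semigroup =
  fixes S E A :: "(nat ^ 'p) set"
  assumes S: "add_submonoid S"
    and fin: "finite (msg S)"
    and E: "E \<subseteq> msg S"
    and A: "A = msg S - E"
    and strong: "x \<in> S \<Longrightarrow> y \<in> S \<Longrightarrow> x \<noteq> 0 \<Longrightarrow> y \<noteq> 0 \<Longrightarrow> x \<noteq> y \<Longrightarrow> \<exists>e\<in>E. \<exists>s\<in>S. x + y = e + s"
    and exchange: "e \<in> E \<Longrightarrow> f \<in> E \<Longrightarrow> e \<noteq> f \<Longrightarrow> s \<in> S \<Longrightarrow> t \<in> S \<Longrightarrow> e + s = f + t \<Longrightarrow>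
      \<exists>u\<in>S. s = f + u"
begin

section \<open>Monomials and factorizations\<close>

definition var :: "nat ^ 'p \<Rightarrow> (nat ^ 'p \<Rightarrow>\<^sub>0 nat)" where
  "var v = Poly_Mapping.single v 1"

lemma keys_var: "Poly_Mapping.keys (var v) = {v}"
  by (simp add: var_def)

lemma msgD: "v \<in> msg S \<Longrightarrow> v \<in> S" "v \<in> msg S \<Longrightarrow> v \<noteq> 0"
  "v \<in> msg S \<Longrightarrow> a \<in> S \<Longrightarrow> b \<in> S \<Longrightarrow> v = a + b \<Longrightarrow> a = 0 \<or> b = 0"
  by (simp_all add: msg_iff[OF S])

lemma A_D: "a \<in> A \<Longrightarrow> a \<in> msg S" "a \<in> A \<Longrightarrow> a \<in> S" "a \<in> A \<Longrightarrow> a \<noteq> 0" "a \<in> A \<Longrightarrow> a \<notin> E"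
  using msgD by (auto simp: A)

lemma E_D: "e \<in> E \<Longrightarrow> e \<in> msg S" "e \<in> E \<Longrightarrow> e \<in> S"
  using msgD E by auto

lemma var_exponents: "v \<in> msg S \<Longrightarrow> var v \<in> exponents S"
  by (simp add: exponents_def keys_var)

lemma s_degree_var: "s_degree (var v) = v"
  by (simp add: var_def s_degree_single vec_eq_iff)

lemma s_degree_in: "\<alpha> \<in> exponents S \<Longrightarrow> s_degree \<alpha> \<in> S"
  unfolding s_degree_def exponents_def
  by (intro submonoid_sum[OF S] submonoid_scale[OF S]) (auto intro: msgD)

lemma factorization:
  assumes "s \<in> S"
  obtains \<sigma> where "\<sigma> \<in> exponents S" "s_degree \<sigma> = s"
proof -
  have "s \<in> add_submonoid hull (msg S)" using assms by (simp add: hull_msg[OF S])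
  then have "\<exists>\<sigma>\<in>exponents S. s_degree \<sigma> = s"
  proof (induction rule: add_submonoid_hull_induct)
    case zero
    show ?case using exponents_zero s_degree_zero by blast
  next
    case (gen b)
    show ?case using var_exponents[OF gen] s_degree_var by blast
  next
    case (add x y)
    then show ?case by (metis exponents_add_iff s_degree_add)
  qed
  then show ?thesis using that by blast
qed

lemma exponents_cases:
  assumes "v \<in> Poly_Mapping.keys \<alpha>" "\<alpha> \<in> exponents S"
  obtains \<alpha>' where "\<alpha>' \<in> exponents S" "\<alpha> = var v + \<alpha>'" "v \<in> msg S"
proof -
  obtain \<alpha>' where "\<alpha> = var v + \<alpha>'"
    using remove_variable[OF assms(1)] unfolding var_def by blast
  then show ?thesis using that assms exponents_add_iff[of "var v" \<alpha>' S] by (auto simp: exponents_def)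
qed

lemma s_degree_eq_0:
  assumes "\<alpha> \<in> exponents S" "s_degree \<alpha> = 0"
  shows "\<alpha> = 0"
proof (rule ccontr)
  assume "\<alpha> \<noteq> 0"
  then obtain v where "v \<in> Poly_Mapping.keys \<alpha>" by (metis ex_in_conv keys_eq_empty)
  then obtain \<alpha>' where "\<alpha> = var v + \<alpha>'" "v \<in> msg S" using exponents_cases assms(1) by metis
  then show False using assms(2) msgD(2)[of v] by (simp add: s_degree_add s_degree_var vec_nat_add_eq_0)
qed

text \<open>The critical monomials generate the ideal of the relations modulo the variables in \<open>E\<close>, which
  is a monomial ideal; the standard ones are the monomials outside it, and their degrees are the
  elements of the Apery set.\<close>

definition critical :: "(nat ^ 'p \<Rightarrow>\<^sub>0 nat) set" where
  "critical = {var a + var b | a b. a \<in> A \<and> b \<in> A \<and> a \<noteq> b} \<union>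
     {Poly_Mapping.single a 2 | a. a \<in> A \<and> 2 *s a \<notin> Apery S E} \<union>
     {Poly_Mapping.single a 3 | a. a \<in> A \<and> 2 *s a \<in> Apery S E}"

definition standard :: "(nat ^ 'p \<Rightarrow>\<^sub>0 nat) set" where
  "standard = {0} \<union> var ` A \<union> {Poly_Mapping.single a 2 | a. a \<in> A \<and> 2 *s a \<in> Apery S E}"

lemma single_2: "Poly_Mapping.single v 2 = var v + var v"
  by (simp add: var_def numeral_2_eq_2 flip: single_add)

lemma single_3: "Poly_Mapping.single v 3 = var v + Poly_Mapping.single v 2"
  by (simp add: var_def numeral_2_eq_2 numeral_3_eq_3 flip: single_add)

lemma criticalE:
  assumes "\<kappa> \<in> critical"
  obtains (mixed) a b where "a \<in> A" "b \<in> A" "a \<noteq> b" "\<kappa> = var a + var b"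
  | (square) a where "a \<in> A" "2 *s a \<notin> Apery S E" "\<kappa> = Poly_Mapping.single a 2"
  | (cube) a where "a \<in> A" "2 *s a \<in> Apery S E" "\<kappa> = Poly_Mapping.single a 3"
  using assms by (auto simp: critical_def)

lemma critical_keys: "\<kappa> \<in> critical \<Longrightarrow> Poly_Mapping.keys \<kappa> \<subseteq> A"
  by (auto simp: critical_def keys_add_nat keys_var split: if_splits)

lemma critical_exponents: "critical \<subseteq> exponents S"
  using critical_keys A_D(1) by (auto simp: exponents_def)

lemma finite_critical: "finite critical"
proof -
  have "finite A" using fin A by auto
  then have "finite ((\<lambda>(a, b). var a + var b) ` (A \<times> A) \<union> (\<lambda>a. Poly_Mapping.single a 2) ` A \<union>
      (\<lambda>a. Poly_Mapping.single a (3 :: nat)) ` A)" by simp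
  then show ?thesis by (rule finite_subset[rotated]) (auto simp: critical_def)
qed

lemma not_AperyD:
  assumes "s \<in> S" "s \<notin> Apery S E"
  shows "\<exists>e\<in>E. \<exists>t\<in>S. s = e + t"
  using assms by (auto simp: Apery_def)

text \<open>Strongness applies to distinct elements only. It covers \<open>a + b\<close> for
  \<open>a \<noteq> b\<close> and \<open>3 *s a\<close> as the sum of \<open>a\<close> and
  \<open>2 *s a\<close>, but says nothing about \<open>a + a\<close>; this is the origin of the case
  distinction on \<open>2 *s a\<close> and of the exponents 2 and 3.\<close>

lemma critical_degree:
  assumes "\<kappa> \<in> critical"
  shows "\<exists>e\<in>E. \<exists>s\<in>S. s_degree \<kappa> = e + s"
  using assms
proof (cases rule: criticalE)
  case (mixed a b)
  then show ?thesis using strong[of a b] A_D by (simp add: s_degree_add s_degree_var)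
next
  case (square a)
  then show ?thesis
    using not_AperyD[of "2 *s a"] A_D submonoid_scale[OF S] by (simp add: s_degree_single)
next
  case (cube a)
  have "2 *s a \<noteq> 0" "a \<noteq> 2 *s a" using A_D(3)[OF cube(1)] by (auto simp: vec_eq_iff)
  then show ?thesis
    using strong[of a "2 *s a"] A_D cube submonoid_scale[OF S]
    by (simp add: single_3 s_degree_add s_degree_var s_degree_single)
qed

text \<open>Peel off variables of \<open>A\<close>. Two distinct ones form a critical divisor, two
  equal ones a critical or a standard square; beyond a standard square, a third variable completes a
  cube or a mixed product.\<close>

lemma exponents_trichotomy:
  assumes "\<alpha> \<in> exponents S"
  shows "(\<exists>e\<in>E. e \<in> Poly_Mapping.keys \<alpha>) \<or>
    (\<exists>\<kappa>\<in>critical. \<exists>\<mu>\<in>exponents S. \<alpha> = \<mu> + \<kappa>) \<or> \<alpha> \<in> standard"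
proof (cases "Poly_Mapping.keys \<alpha> \<inter> E = {}")
  case True
  have split: "\<exists>a \<beta>. a \<in> A \<and> \<beta> \<in> exponents S \<and> \<gamma> = var a + \<beta> \<and> Poly_Mapping.keys \<beta> \<inter> E = {}"
    if \<gamma>: "\<gamma> \<in> exponents S" "\<gamma> \<noteq> 0" "Poly_Mapping.keys \<gamma> \<inter> E = {}" for \<gamma>
  proof -
    obtain v where v: "v \<in> Poly_Mapping.keys \<gamma>" using \<gamma>(2) by (metis ex_in_conv keys_eq_empty)
    obtain \<beta> where "\<beta> \<in> exponents S" "\<gamma> = var v + \<beta>" "v \<in> msg S" using exponents_cases[OF v \<gamma>(1)] .
    moreover have "v \<notin> E" using v \<gamma> by auto
    ultimately show ?thesis using \<gamma>(3) by (auto simp: A keys_add_nat keys_var)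
  qed
  have crit: ?thesis if "\<kappa> \<in> critical" "\<mu> \<in> exponents S" "\<alpha> = \<mu> + \<kappa>" for \<kappa> \<mu>
    using that by blast
  show ?thesis
  proof (cases "\<alpha> = 0")
    case False
    obtain a \<beta> where a: "a \<in> A" "\<beta> \<in> exponents S" "\<alpha> = var a + \<beta>" "Poly_Mapping.keys \<beta> \<inter> E = {}"
      using split[OF assms False True] by auto
    show ?thesis
    proof (cases "\<beta> = 0")
      case False
      obtain b \<gamma> where b: "b \<in> A" "\<gamma> \<in> exponents S" "\<beta> = var b + \<gamma>" "Poly_Mapping.keys \<gamma> \<inter> E = {}"
        using split[OF a(2) False a(4)] by auto
      have \<alpha>: "\<alpha> = \<gamma> + (var a + var b)" by (simp only: a b ac_simps)
      show ?thesis
      proof (cases "a = b")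
        case True
        then have \<alpha>2: "\<alpha> = \<gamma> + Poly_Mapping.single a 2" unfolding \<alpha> single_2 by simp
        show ?thesis
        proof (cases "2 *s a \<in> Apery S E")
          case sq: True
          show ?thesis
          proof (cases "\<gamma> = 0")
            case False
            obtain c \<delta> where c: "c \<in> A" "\<delta> \<in> exponents S" "\<gamma> = var c + \<delta>"
              using split[OF b(2) False b(4)] by auto
            show ?thesis
            proof (cases "c = a")
              case True
              have "\<alpha> = \<delta> + Poly_Mapping.single a 3"
                unfolding \<alpha>2 c(3) True single_3 by (simp only: ac_simps)
              then show ?thesis using a(1) sq c by (intro crit[of "Poly_Mapping.single a 3" \<delta>]) (auto simp: critical_def)
            next
              case False
              have "\<alpha> = (\<delta> + var a) + (var a + var c)"
                unfolding \<alpha>2 c(3) single_2 by (simp only: ac_simps)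
              then show ?thesis
                using a(1) c False var_exponents[OF A_D(1)[OF a(1)]]
                by (intro crit[of "var a + var c" "\<delta> + var a"]) (auto simp: critical_def exponents_add_iff)
            qed
          qed (use a(1) sq \<alpha>2 in \<open>auto simp: standard_def\<close>)
        next
          case False
          then show ?thesis
            using a(1) b(2) \<alpha>2 by (intro crit[of "Poly_Mapping.single a 2" \<gamma>]) (auto simp: critical_def)
        qed
      next
        case False
        then show ?thesis
          using a(1) b(1,2) \<alpha> by (intro crit[of "var a + var b" \<gamma>]) (auto simp: critical_def)
      qed
    qed (use a in \<open>auto simp: standard_def\<close>)
  qed (simp add: standard_def)
qed auto

lemma standard_degree: "\<alpha> \<in> standard \<Longrightarrow> s_degree \<alpha> \<in> Apery S E"
proof -
  have "0 \<in> Apery S E"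
    using submonoidD(1)[OF S] E msgD(2) by (auto simp: Apery_def vec_nat_add_eq_0 dest!: sym[of 0])
  moreover have "a \<in> Apery S E" if a: "a \<in> A" for a
  proof -
    have "a \<noteq> e + t" if "e \<in> E" "t \<in> S" for e t
    proof
      assume "a = e + t"
      then have "t = 0" using msgD(3)[OF A_D(1)[OF a] E_D(2)[OF that(1)] that(2)] E_D(1)[OF that(1)] msgD(2) by auto
      then show False using \<open>a = e + t\<close> A_D(4)[OF a] that by simp
    qed
    then show ?thesis using A_D(2)[OF a] by (auto simp: Apery_def)
  qed
  ultimately show "\<alpha> \<in> standard \<Longrightarrow> s_degree \<alpha> \<in> Apery S E"
    by (auto simp: standard_def s_degree_zero s_degree_var s_degree_single)
qed

text \<open>The other two alternatives of the trichotomy put the degree into \<open>e + S\<close>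
  for some \<open>e\<close> in \<open>E\<close>.\<close>

lemma Apery_standard:
  assumes \<alpha>: "\<alpha> \<in> exponents S" and Ap: "s_degree \<alpha> \<in> Apery S E"
  shows "\<alpha> \<in> standard"
proof -
  have no: "s_degree \<alpha> \<noteq> e + t" if "e \<in> E" "t \<in> S" for e t
    using Ap that by (auto simp: Apery_def)
  have "\<not> (\<exists>e\<in>E. e \<in> Poly_Mapping.keys \<alpha>)"
  proof
    assume "\<exists>e\<in>E. e \<in> Poly_Mapping.keys \<alpha>"
    then obtain e \<beta> where "e \<in> E" "\<beta> \<in> exponents S" "\<alpha> = var e + \<beta>" using exponents_cases \<alpha> by metis
    then show False using no[of e "s_degree \<beta>"] s_degree_in by (simp add: s_degree_add s_degree_var)
  qed
  moreover have "\<not> (\<exists>\<kappa>\<in>critical. \<exists>\<mu>\<in>exponents S. \<alpha> = \<mu> + \<kappa>)"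
  proof
    assume "\<exists>\<kappa>\<in>critical. \<exists>\<mu>\<in>exponents S. \<alpha> = \<mu> + \<kappa>"
    then obtain \<kappa> \<mu> where k: "\<kappa> \<in> critical" "\<mu> \<in> exponents S" "\<alpha> = \<mu> + \<kappa>" by blast
    obtain e s where es: "e \<in> E" "s \<in> S" "s_degree \<kappa> = e + s" using critical_degree[OF k(1)] by blast
    have "s_degree \<alpha> = e + (s_degree \<mu> + s)" by (simp add: k s_degree_add es ac_simps)
    then show False using no es submonoidD(2)[OF S s_degree_in[OF k(2)] es(2)] by blast
  qed
  ultimately show ?thesis using exponents_trichotomy[OF \<alpha>] by blast
qed

text \<open>The degree lies in the Apery set, so \<open>\<beta>\<close> is standard as well.
  Distinct standard monomials have distinct degrees, because no element of \<open>A\<close> is zero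
  or twice another one.\<close>

lemma standard_unique:
  assumes "\<alpha> \<in> standard" "\<beta> \<in> exponents S" "s_degree \<alpha> = s_degree \<beta>"
  shows "\<beta> = \<alpha>"
proof -
  have \<beta>: "\<beta> \<in> standard" using Apery_standard[OF assms(2)] standard_degree[OF assms(1)] assms(3) by simp
  have two: "a \<noteq> 2 *s b" if "a \<in> A" "b \<in> A" for a b
  proof
    assume "a = 2 *s b"
    then have "a = b + b" by (simp add: vec_eq_iff)
    then show False using msgD(3)[OF A_D(1)[OF that(1)] A_D(2)[OF that(2)] A_D(2)[OF that(2)]] A_D(3)[OF that(2)] by auto
  qed
  have "2 *s b \<noteq> 0" if "b \<in> A" for b using A_D(3)[OF that] by (auto simp: vec_eq_iff)
  moreover have "2 *s a = 2 *s b \<longleftrightarrow> a = b" for a b :: "nat ^ 'p" by (simp add: vec_eq_iff)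
  ultimately show ?thesis
    using assms(1,3) \<beta> two A_D(3) unfolding standard_def
    by (auto simp: s_degree_zero s_degree_var s_degree_single) metis+
qed

text \<open>Deleting any one variable from a critical monomial leaves a standard one, which is alone
  in its degree.\<close>

lemma critical_isolated:
  assumes \<kappa>: "\<kappa> \<in> critical" and \<delta>: "\<delta> \<in> exponents S" "s_degree \<delta> = s_degree \<kappa>"
    and v: "v \<in> Poly_Mapping.keys \<kappa>" "v \<in> Poly_Mapping.keys \<delta>"
  shows "\<delta> = \<kappa>"
proof -
  have "\<exists>\<kappa>'\<in>standard. \<kappa> = var v + \<kappa>'"
    using \<kappa>
  proof (cases rule: criticalE)
    case (mixed a b)
    then have "v = a \<or> v = b" using v(1) by (auto simp: keys_add_nat keys_var)
    then show ?thesis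
    proof
      assume "v = a"
      then show ?thesis using mixed by (intro bexI[of _ "var b"]) (auto simp: standard_def)
    next
      assume "v = b"
      then show ?thesis
        using mixed by (intro bexI[of _ "var a"]) (auto simp: standard_def add.commute)
    qed
  next
    case (square a)
    then show ?thesis using v(1) by (auto simp: standard_def single_2 keys_add_nat keys_var)
  next
    case (cube a)
    then show ?thesis using v(1) unfolding single_3 by (auto simp: standard_def keys_add_nat keys_var)
  qed
  then obtain \<kappa>' where k: "\<kappa>' \<in> standard" "\<kappa> = var v + \<kappa>'" by blast
  obtain \<delta>' where d: "\<delta>' \<in> exponents S" "\<delta> = var v + \<delta>'" using exponents_cases[OF v(2) \<delta>(1)] .
  have "s_degree \<kappa>' = s_degree \<delta>'" using \<delta>(2) by (simp add: k d s_degree_add)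
  then show ?thesis using standard_unique[OF k(1) d(1)] k d by simp
qed

lemma total_pos: "\<mu> \<in> exponents S \<Longrightarrow> \<mu> \<noteq> 0 \<Longrightarrow> 0 < total (s_degree \<mu>)"
  using s_degree_eq_0 total_eq_0_iff by (metis gr0I)

text \<open>Monomials of the same degree that both involve variables in \<open>E\<close> are connected through smaller
  degrees; this is where the Cohen-Macaulay property enters.\<close>

lemma connected_step:
  assumes G: "G \<subseteq> (binomials S :: ((nat ^ 'p \<Rightarrow>\<^sub>0 nat) \<Rightarrow>\<^sub>0 'k::field) set)"
    and IH: "\<And>\<alpha> \<beta>. \<alpha> \<in> exponents S \<Longrightarrow> \<beta> \<in> exponents S \<Longrightarrow> s_degree \<alpha> = s_degree \<beta> \<Longrightarrow>
      total (s_degree \<alpha>) < total d \<Longrightarrow> connected_by S G \<alpha> \<beta>"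
    and crit: "\<And>\<kappa>. \<kappa> \<in> critical \<Longrightarrow> s_degree \<kappa> = d \<Longrightarrow>
      \<exists>e\<in>E. \<exists>\<xi>\<in>exponents S. connected_by S G \<kappa> (var e + \<xi>)"
    and \<alpha>: "\<alpha> \<in> exponents S" "s_degree \<alpha> = d" and \<beta>: "\<beta> \<in> exponents S" "s_degree \<beta> = d"
  shows "connected_by S G \<alpha> \<beta>"
proof -
  have reach: "\<exists>e\<in>E. \<exists>\<xi>\<in>exponents S. connected_by S G \<gamma> (var e + \<xi>)"
    if \<gamma>: "\<gamma> \<in> exponents S" "s_degree \<gamma> = d" "\<gamma> \<notin> standard" for \<gamma>
  proof (cases "\<exists>e\<in>E. e \<in> Poly_Mapping.keys \<gamma>")
    case True
    then obtain e \<xi> where "e \<in> E" "\<xi> \<in> exponents S" "\<gamma> = var e + \<xi>" using exponents_cases \<gamma>(1) by metis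
    then show ?thesis by blast
  next
    case False
    then obtain \<kappa> \<mu> where k: "\<kappa> \<in> critical" "\<mu> \<in> exponents S" "\<gamma> = \<mu> + \<kappa>"
      using exponents_trichotomy[OF \<gamma>(1)] \<gamma>(3) by blast
    show ?thesis
    proof (cases "\<mu> = 0")
      case True
      then show ?thesis using crit[OF k(1)] \<gamma>(2) k(3) by simp
    next
      \<comment> \<open>A proper critical divisor has smaller degree, so the induction hypothesis
        links it to a monomial with a variable of \<open>E\<close>; translating by
        \<open>\<mu>\<close> keeps that variable.\<close>
      case \<mu>: False
      obtain e s where es: "e \<in> E" "s \<in> S" "s_degree \<kappa> = e + s" using critical_degree[OF k(1)] by blast
      obtain \<sigma> where \<sigma>: "\<sigma> \<in> exponents S" "s_degree \<sigma> = s" using factorization[OF es(2)] .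
      have "connected_by S G \<kappa> (var e + \<sigma>)"
      proof (rule IH)
        show "\<kappa> \<in> exponents S" using k critical_exponents by auto
        show "var e + \<sigma> \<in> exponents S"
          using \<sigma> var_exponents[OF E_D(1)[OF es(1)]] by (simp add: exponents_add_iff)
        show "s_degree \<kappa> = s_degree (var e + \<sigma>)"
          by (simp add: es \<sigma> s_degree_add s_degree_var)
        show "total (s_degree \<kappa>) < total d"
          using total_pos[OF k(2) \<mu>] by (simp add: \<gamma>(2)[symmetric] k(3) s_degree_add total_add)
      qed
      then have "connected_by S G \<gamma> (var e + (\<mu> + \<sigma>))"
        using connected_by_translate[OF _ k(2)] unfolding k(3) by (metis add.left_commute)
      then show ?thesis using es \<sigma> k exponents_add_iff by blast
    qed
  qed
  show ?thesis
  proof (cases "\<alpha> \<in> standard \<or> \<beta> \<in> standard")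
    case True
    then have "\<alpha> = \<beta>" using standard_unique[of \<alpha> \<beta>] standard_unique[of \<beta> \<alpha>] \<alpha> \<beta> by auto
    then show ?thesis by simp
  next
    case False
    obtain e \<xi> where e: "e \<in> E" "\<xi> \<in> exponents S" "connected_by S G \<alpha> (var e + \<xi>)"
      using reach \<alpha> False by blast
    obtain f \<eta> where f: "f \<in> E" "\<eta> \<in> exponents S" "connected_by S G \<beta> (var f + \<eta>)"
      using reach \<beta> False by blast
    have deg: "e + s_degree \<xi> = d" "f + s_degree \<eta> = d"
      using connected_by_degree[OF G e(3)] connected_by_degree[OF G f(3)] \<alpha> \<beta>
      by (simp_all add: s_degree_add s_degree_var)
    \<comment> \<open>A common variable of \<open>E\<close> can be cancelled, which lowers the
      degree.\<close>
    have var_step: "connected_by S G (var g + \<mu>) (var g + \<nu>)"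
      if "g \<in> E" "\<mu> \<in> exponents S" "\<nu> \<in> exponents S" "s_degree \<mu> = s_degree \<nu>" "g + s_degree \<mu> = d" for g \<mu> \<nu>
    proof (rule connected_by_translate[OF IH[OF that(2-4)] var_exponents[OF E_D(1)[OF that(1)]]])
      have "0 < total g" using msgD(2)[OF E_D(1)[OF that(1)]] total_eq_0_iff by (metis gr0I)
      then show "total (s_degree \<mu>) < total d" by (simp add: that(5)[symmetric] total_add)
    qed
    have "connected_by S G (var e + \<xi>) (var f + \<eta>)"
    proof (cases "e = f")
      case True
      then have "s_degree \<xi> = s_degree \<eta>" using deg by (metis add_left_cancel)
      then show ?thesis using var_step[OF e(1,2) f(2)] deg True by simp
    next
      case False
      obtain u where u: "u \<in> S" "s_degree \<xi> = f + u"
        using exchange[OF e(1) f(1) False s_degree_in[OF e(2)] s_degree_in[OF f(2)]] deg by auto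
      have \<eta>: "s_degree \<eta> = e + u"
      proof -
        have "f + s_degree \<eta> = f + (e + u)" using deg u(2) by (simp add: ac_simps)
        then show ?thesis by simp
      qed
      obtain \<nu> where \<nu>: "\<nu> \<in> exponents S" "s_degree \<nu> = u" using factorization[OF u(1)] .
      have ex: "var g + \<nu> \<in> exponents S" if "g \<in> E" for g
        using \<nu> var_exponents[OF E_D(1)[OF that]] by (simp add: exponents_add_iff)
      have "connected_by S G (var e + \<xi>) (var e + (var f + \<nu>))"
        by (rule var_step[OF e(1,2) ex[OF f(1)] _ deg(1)])
          (simp add: u \<nu> s_degree_add s_degree_var)
      moreover have "connected_by S G (var f + \<eta>) (var f + (var e + \<nu>))"
        by (rule var_step[OF f(1,2) ex[OF e(1)] _ deg(2)])
          (simp add: \<eta> \<nu> s_degree_add s_degree_var)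
      moreover have "var e + (var f + \<nu>) = var f + (var e + \<nu>)" by (rule add.left_commute)
      ultimately show ?thesis by (metis connected_by_sym rtranclp_trans)
    qed
    then show ?thesis using e(3) f(3) by (meson connected_by_sym rtranclp_trans)
  qed
qed

section \<open>Generating sets and their degrees\<close>

lemma critical_companion:
  assumes "\<kappa> \<in> critical"
  obtains e \<sigma> where "e \<in> E" "\<sigma> \<in> exponents S" "var e + \<sigma> \<in> exponents S"
    "s_degree (var e + \<sigma>) = s_degree \<kappa>"
proof -
  obtain e s where es: "e \<in> E" "s \<in> S" "s_degree \<kappa> = e + s" using critical_degree[OF assms] by blast
  obtain \<sigma> where \<sigma>: "\<sigma> \<in> exponents S" "s_degree \<sigma> = s" using factorization[OF es(2)] .
  show ?thesis
    using that[OF es(1) \<sigma>(1)] es \<sigma> var_exponents[OF E_D(1)[OF es(1)]]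
    by (simp add: exponents_add_iff s_degree_add s_degree_var)
qed

text \<open>One binomial per critical monomial suffices, pairing it with a monomial of the same
  degree that involves a variable of \<open>E\<close>. These binomials supply the hypothesis of
  \<open>connected_step\<close> on critical monomials, and induction on the total degree does the
  rest.\<close>

lemma finite_generating_binomials:
  obtains G :: "((nat ^ 'p \<Rightarrow>\<^sub>0 nat) \<Rightarrow>\<^sub>0 'k::field) set"
  where "finite G" "G \<subseteq> binomials S" "genideal (semigroup_ring (exponents S)) G = semigroup_ideal S"
proof -
  have "\<forall>\<kappa>\<in>critical. \<exists>e \<sigma>. e \<in> E \<and> \<sigma> \<in> exponents S \<and> var e + \<sigma> \<in> exponents S \<and>
      s_degree (var e + \<sigma>) = s_degree \<kappa>"
    using critical_companion by metis
  then obtain e \<sigma> where *: "\<And>\<kappa>. \<kappa> \<in> critical \<Longrightarrow> e \<kappa> \<in> E"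
    "\<And>\<kappa>. \<kappa> \<in> critical \<Longrightarrow> \<sigma> \<kappa> \<in> exponents S"
    "\<And>\<kappa>. \<kappa> \<in> critical \<Longrightarrow> var (e \<kappa>) + \<sigma> \<kappa> \<in> exponents S"
    "\<And>\<kappa>. \<kappa> \<in> critical \<Longrightarrow> s_degree (var (e \<kappa>) + \<sigma> \<kappa>) = s_degree \<kappa>"
    by metis
  define G :: "((nat ^ 'p \<Rightarrow>\<^sub>0 nat) \<Rightarrow>\<^sub>0 'k) set"
    where "G = (\<lambda>\<kappa>. monomial \<kappa> - monomial (var (e \<kappa>) + \<sigma> \<kappa>)) ` critical"
  have G: "G \<subseteq> binomials S"
  proof
    fix g assume "g \<in> G"
    then obtain \<kappa> where "\<kappa> \<in> critical" "g = monomial \<kappa> - monomial (var (e \<kappa>) + \<sigma> \<kappa>)"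
      by (auto simp: G_def)
    then show "g \<in> binomials S"
      using *(3,4)[of \<kappa>] critical_exponents unfolding binomials_def mem_Collect_eq
      by (intro exI[of _ \<kappa>] exI[of _ "var (e \<kappa>) + \<sigma> \<kappa>"]) auto
  qed
  have conn: "connected_by S G \<alpha> \<beta>"
    if "\<alpha> \<in> exponents S" "\<beta> \<in> exponents S" "s_degree \<alpha> = s_degree \<beta>" for \<alpha> \<beta>
    using that
  proof (induction "total (s_degree \<alpha>)" arbitrary: \<alpha> \<beta> rule: less_induct)
    case less
    show ?case
    proof (rule connected_step[OF G, where d = "s_degree \<alpha>"])
      fix \<kappa> assume k: "\<kappa> \<in> critical"
      have "move S G (0 + \<kappa>) (0 + (var (e \<kappa>) + \<sigma> \<kappa>))"
        by (rule moveI) (use k * critical_exponents exponents_zero in \<open>auto simp: G_def\<close>)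
      then have "connected_by S G \<kappa> (var (e \<kappa>) + \<sigma> \<kappa>)" by (simp add: r_into_rtranclp)
      then show "\<exists>e\<in>E. \<exists>\<xi>\<in>exponents S. connected_by S G \<kappa> (var e + \<xi>)"
        using *(1,2)[OF k] by blast
    qed (use less in auto)
  qed
  have "genideal (semigroup_ring (exponents S)) G = semigroup_ideal S"
    unfolding generates_iff_connected[OF G] using conn by blast
  moreover have "finite G" by (simp add: G_def finite_critical)
  ultimately show ?thesis using that G by blast
qed

text \<open>A minimal generating subset of the finite set just found. Without its existence the
  definite description in \<open>betti_elements\<close> would say nothing.\<close>

lemma minimal_binomial_generating_set_exists:
  "\<exists>G :: ((nat ^ 'p \<Rightarrow>\<^sub>0 nat) \<Rightarrow>\<^sub>0 'k::field) set. minimal_binomial_generating_set S G"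
proof -
  obtain G0 :: "((nat ^ 'p \<Rightarrow>\<^sub>0 nat) \<Rightarrow>\<^sub>0 'k) set"
    where G0: "finite G0" "G0 \<subseteq> binomials S"
      "genideal (semigroup_ring (exponents S)) G0 = semigroup_ideal S"
    by (rule finite_generating_binomials)
  define \<G> where "\<G> = {G. G \<subseteq> G0 \<and> genideal (semigroup_ring (exponents S)) G = semigroup_ideal S}"
  have "finite \<G>" "\<G> \<noteq> {}" using G0 by (auto simp: \<G>_def)
  then obtain G where G: "G \<in> \<G>" "\<And>G'. G' \<in> \<G> \<Longrightarrow> G' \<subseteq> G \<Longrightarrow> G' = G"
    using finite_has_minimal[of \<G>] by metis
  have "genideal (semigroup_ring (exponents S)) G' \<noteq> semigroup_ideal S" if "G' \<subset> G" for G'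
    using G(1) G(2)[of G'] that by (auto simp: \<G>_def)
  then have "minimal_binomial_generating_set S G"
    unfolding minimal_binomial_generating_set_def using G(1) G0(2) by (auto simp: \<G>_def)
  then show ?thesis by blast
qed

text \<open>The critical monomial is connected to a companion involving \<open>E\<close>, so some
  move leaves it. A nonconstant monomial factor of that move would be shared by both ends, against
  \<open>critical_isolated\<close>; hence the move is a generator itself.\<close>

lemma critical_degree_occurs:
  fixes G :: "((nat ^ 'p \<Rightarrow>\<^sub>0 nat) \<Rightarrow>\<^sub>0 'k::field) set"
  assumes G: "G \<subseteq> binomials S" "genideal (semigroup_ring (exponents S)) G = semigroup_ideal S"
    and \<kappa>: "\<kappa> \<in> critical"
  shows "s_degree \<kappa> \<in> s_degrees G"
proof -
  have \<kappa>E: "\<kappa> \<in> exponents S" using \<kappa> critical_exponents by auto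
  obtain e \<sigma> where e: "e \<in> E" "var e + \<sigma> \<in> exponents S" "s_degree (var e + \<sigma>) = s_degree \<kappa>"
    using critical_companion[OF \<kappa>] by metis
  have "e \<in> Poly_Mapping.keys (var e + \<sigma>)" by (simp add: keys_add_nat keys_var)
  then have ne: "\<kappa> \<noteq> var e + \<sigma>" using critical_keys[OF \<kappa>] A_D(4) e(1) by blast
  have "connected_by S G \<kappa> (var e + \<sigma>)"
    using G(2)[unfolded generates_iff_connected[OF G(1)]] \<kappa>E e by simp
  then have "\<exists>\<eta>. move S G \<kappa> \<eta> \<and> \<eta> \<noteq> \<kappa>"
    using ne by (induction rule: converse_rtranclp_induct) metis+
  then obtain \<eta> where \<eta>: "move S G \<kappa> \<eta>" "\<eta> \<noteq> \<kappa>" by blast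
  obtain \<mu> \<gamma> \<delta> where m: "\<mu> \<in> exponents S" "monomial \<gamma> - monomial \<delta> \<in> G \<or> monomial \<delta> - monomial \<gamma> \<in> G"
    "\<kappa> = \<mu> + \<gamma>" "\<eta> = \<mu> + \<delta>"
    using \<eta>(1) by (elim moveE)
  have "\<mu> = 0"
  proof (rule ccontr)
    assume "\<mu> \<noteq> 0"
    then obtain v where "v \<in> Poly_Mapping.keys \<mu>" by (metis ex_in_conv keys_eq_empty)
    then have "\<eta> = \<kappa>"
      using critical_isolated[OF \<kappa> move_exponents[OF \<eta>(1)] move_degree[OF G(1) \<eta>(1), symmetric], of v] m
      by (simp add: keys_add_nat)
    then show False using \<eta>(2) by simp
  qed
  then have "monomial \<kappa> - monomial \<eta> \<in> G \<or> monomial \<eta> - monomial \<kappa> \<in> G" using m by simp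
  moreover have "\<kappa> \<in> Poly_Mapping.keys (monomial \<kappa> - monomial \<eta> :: _ \<Rightarrow>\<^sub>0 'k)"
    "\<kappa> \<in> Poly_Mapping.keys (monomial \<eta> - monomial \<kappa> :: _ \<Rightarrow>\<^sub>0 'k)"
    using \<eta>(2) keys_monomial_diff[of \<kappa> \<eta>, where 'k = 'k] keys_monomial_diff[of \<eta> \<kappa>, where 'k = 'k] by auto
  ultimately show ?thesis unfolding s_degrees_def by blast
qed

text \<open>A generator of any other degree is redundant: its two monomials are already connected by moves
  of smaller degree.\<close>

lemma minimal_degree_critical:
  fixes G :: "((nat ^ 'p \<Rightarrow>\<^sub>0 nat) \<Rightarrow>\<^sub>0 'k::field) set"
  assumes min: "minimal_binomial_generating_set S G" and d: "d \<in> s_degrees G"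
  shows "d \<in> s_degree ` critical"
proof (rule ccontr)
  assume nd: "d \<notin> s_degree ` critical"
  have G: "G \<subseteq> binomials S" "genideal (semigroup_ring (exponents S)) G = semigroup_ideal S"
    using min by (auto simp: minimal_binomial_generating_set_def)
  obtain g \<alpha> where g: "g \<in> G" "\<alpha> \<in> Poly_Mapping.keys g" "d = s_degree \<alpha>"
    using d by (auto simp: s_degrees_def)
  obtain \<gamma> \<delta> where gd: "\<gamma> \<in> exponents S" "\<delta> \<in> exponents S" "s_degree \<gamma> = s_degree \<delta>"
    "g = monomial \<gamma> - monomial \<delta>"
    using g(1) G(1) by (auto simp: binomials_def)
  have "\<gamma> \<noteq> \<delta>" using g(2) gd(4) by auto
  then have keys_g: "Poly_Mapping.keys g = {\<gamma>, \<delta>}" by (simp add: gd(4) keys_monomial_diff)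
  have dd: "s_degree \<gamma> = d" "s_degree \<delta> = d" using g gd(3) keys_g by auto
  define G' where "G' = G - {g}"
  have G': "G' \<subseteq> binomials S" using G by (auto simp: G'_def)
  have same: "{\<gamma>', \<delta>'} = {\<gamma>, \<delta>}" if "monomial \<gamma>' - monomial \<delta>' = g" for \<gamma>' \<delta>'
  proof -
    have "\<gamma>' \<noteq> \<delta>'" using that keys_g by auto
    then show ?thesis using keys_monomial_diff[of \<gamma>' \<delta>', where 'k = 'k] that keys_g by simp
  qed
  \<comment> \<open>Both monomials of \<open>g\<close> have degree \<open>d\<close>, so
    \<open>g\<close> takes part in no move below that total degree.\<close>
  have move_G': "move S G' \<alpha> \<beta>"
    if mv: "move S G \<alpha> \<beta>" and lt: "total (s_degree \<alpha>) < total d" for \<alpha> \<beta>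
  proof -
    obtain \<mu> \<gamma>' \<delta>' where m: "\<mu> \<in> exponents S" "\<gamma>' \<in> exponents S" "\<delta>' \<in> exponents S"
      "monomial \<gamma>' - monomial \<delta>' \<in> G \<or> monomial \<delta>' - monomial \<gamma>' \<in> G" "\<alpha> = \<mu> + \<gamma>'" "\<beta> = \<mu> + \<delta>'"
      using mv by (elim moveE)
    have "\<gamma>' \<notin> {\<gamma>, \<delta>}" using lt dd m(5) by (auto simp: s_degree_add total_add)
    then have "monomial \<gamma>' - monomial \<delta>' \<noteq> g" "monomial \<delta>' - monomial \<gamma>' \<noteq> g"
      using same[of \<gamma>' \<delta>'] same[of \<delta>' \<gamma>'] by auto
    then show ?thesis using moveI[OF m(1-3), of G'] m(4-6) by (auto simp: G'_def)
  qed
  have small: "connected_by S G' \<alpha> \<beta>"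
    if "\<alpha> \<in> exponents S" "\<beta> \<in> exponents S" "s_degree \<alpha> = s_degree \<beta>" "total (s_degree \<alpha>) < total d" for \<alpha> \<beta>
  proof -
    have "connected_by S G \<alpha> \<beta>"
      using G(2)[unfolded generates_iff_connected[OF G(1)]] that by blast
    then show ?thesis
    proof induction
      case (step \<eta> \<zeta>)
      have "s_degree \<eta> = s_degree \<alpha>" using connected_by_degree[OF G(1) step.hyps(1)] by simp
      then show ?case
        using move_G'[OF step.hyps(2)] that(4) rtranclp.rtrancl_into_rtrancl[OF step.IH] by simp
    qed simp
  qed
  \<comment> \<open>No critical monomial has degree \<open>d\<close>, so the hypothesis of
    \<open>connected_step\<close> on critical monomials holds vacuously.\<close>
  have gd_conn: "connected_by S G' \<gamma> \<delta>"
    by (rule connected_step[OF G' small _ gd(1) dd(1) gd(2) dd(2)]) (use nd in auto)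
  have move_conn: "connected_by S G' \<alpha> \<beta>" if mv: "move S G \<alpha> \<beta>" for \<alpha> \<beta>
  proof -
    obtain \<mu> \<gamma>' \<delta>' where m: "\<mu> \<in> exponents S" "\<gamma>' \<in> exponents S" "\<delta>' \<in> exponents S"
      "monomial \<gamma>' - monomial \<delta>' \<in> G \<or> monomial \<delta>' - monomial \<gamma>' \<in> G" "\<alpha> = \<mu> + \<gamma>'" "\<beta> = \<mu> + \<delta>'"
      using mv by (elim moveE)
    have "connected_by S G' \<gamma>' \<delta>'"
    proof (cases "{\<gamma>', \<delta>'} = {\<gamma>, \<delta>}")
      case True
      then show ?thesis using gd_conn connected_by_sym[OF gd_conn] by (auto simp: doubleton_eq_iff)
    next
      case False
      then have "monomial \<gamma>' - monomial \<delta>' \<noteq> g" "monomial \<delta>' - monomial \<gamma>' \<noteq> g"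
        using same[of \<gamma>' \<delta>'] same[of \<delta>' \<gamma>'] by (auto simp: insert_commute)
      then have "move S G' (0 + \<gamma>') (0 + \<delta>')"
        using m(4) by (intro moveI[OF exponents_zero m(2,3)]) (auto simp: G'_def)
      then show ?thesis by auto
    qed
    then show ?thesis unfolding m(5,6) by (rule connected_by_translate[OF _ m(1)])
  qed
  have "connected_by S G' \<alpha> \<beta>" if "connected_by S G \<alpha> \<beta>" for \<alpha> \<beta>
    using that
  proof induction
    case (step \<eta> \<zeta>)
    then show ?case by (meson move_conn rtranclp_trans)
  qed simp
  then have "genideal (semigroup_ring (exponents S)) G' = semigroup_ideal S"
    using G(2) unfolding generates_iff_connected[OF G(1)] generates_iff_connected[OF G'] by blast
  moreover have "G' \<subset> G" using g(1) by (auto simp: G'_def)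
  ultimately show False using min by (simp add: minimal_binomial_generating_set_def)
qed

lemma betti_elements_eq: "betti_elements TYPE('k::field) S = s_degree ` critical"
proof -
  have degs: "s_degrees G = s_degree ` critical"
    if "minimal_binomial_generating_set S G" for G :: "((nat ^ 'p \<Rightarrow>\<^sub>0 nat) \<Rightarrow>\<^sub>0 'k) set"
    using minimal_degree_critical[OF that] critical_degree_occurs that
    by (auto simp: minimal_binomial_generating_set_def)
  obtain G :: "((nat ^ 'p \<Rightarrow>\<^sub>0 nat) \<Rightarrow>\<^sub>0 'k) set" where G: "minimal_binomial_generating_set S G"
    using minimal_binomial_generating_set_exists by blast
  show ?thesis
    unfolding betti_elements_def by (rule the_equality) (use G degs in auto)
qed

lemma s_degree_critical:
  "s_degree ` critical =
    {a + a' | a a'. a \<in> A \<and> a' \<in> A \<and> a \<noteq> a'} \<union>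
    {2 *s a | a. a \<in> A \<and> 2 *s a \<notin> Apery S E} \<union>
    {3 *s a | a. a \<in> A \<and> 2 *s a \<in> Apery S E}"
proof (intro equalityI subsetI)
  fix d assume "d \<in> s_degree ` critical"
  then obtain \<kappa> where "\<kappa> \<in> critical" "d = s_degree \<kappa>" by auto
  then show "d \<in> {a + a' | a a'. a \<in> A \<and> a' \<in> A \<and> a \<noteq> a'} \<union>
    {2 *s a | a. a \<in> A \<and> 2 *s a \<notin> Apery S E} \<union> {3 *s a | a. a \<in> A \<and> 2 *s a \<in> Apery S E}"
    by (cases rule: criticalE) (auto simp: s_degree_add s_degree_var s_degree_single)
next
  fix d assume "d \<in> {a + a' | a a'. a \<in> A \<and> a' \<in> A \<and> a \<noteq> a'} \<union>
    {2 *s a | a. a \<in> A \<and> 2 *s a \<notin> Apery S E} \<union> {3 *s a | a. a \<in> A \<and> 2 *s a \<in> Apery S E}"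
  then consider a b where "a \<in> A" "b \<in> A" "a \<noteq> b" "d = a + b"
    | a where "a \<in> A" "2 *s a \<notin> Apery S E" "d = 2 *s a"
    | a where "a \<in> A" "2 *s a \<in> Apery S E" "d = 3 *s a" by blast
  then show "d \<in> s_degree ` critical"
  proof cases
    case (1 a b)
    then have "var a + var b \<in> critical" by (auto simp: critical_def)
    then show ?thesis using 1 by (intro image_eqI) (auto simp: s_degree_add s_degree_var)
  next
    case (2 a)
    then have "Poly_Mapping.single a 2 \<in> critical" by (auto simp: critical_def)
    then show ?thesis using 2 by (intro image_eqI) (auto simp: s_degree_single)
  next
    case (3 a)
    then have "Poly_Mapping.single a 3 \<in> critical" by (auto simp: critical_def)
    then show ?thesis using 3 by (intro image_eqI) (auto simp: s_degree_single)
  qed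
qed

end

theorem proposition32:
  fixes S E A :: "(nat ^ 'p) set"
  assumes "affine_semigroup S"
    and "cohen_macaulay TYPE('k::field) S"
    and "simplicial S"
    and "strong S"
    and "E = multiplicities S"
    and "A = msg S - E"
    and "card E = CARD('p)"
    and "A \<noteq> {}"
  shows "betti_elements TYPE('k) S =
    {a + a' | a a'. a \<in> A \<and> a' \<in> A \<and> a \<noteq> a'} \<union>
    {2 *s a | a. a \<in> A \<and> 2 *s a \<in> (\<lambda>a. 2 *s a) ` A - Apery S E} \<union>
    {3 *s a | a. a \<in> A \<and> 2 *s a \<in> (\<lambda>a. 2 *s a) ` A \<inter> Apery S E}"
proof -
  have cm: "cohen_macaulay_ring (semigroup_ring S :: (nat ^ 'p \<Rightarrow>\<^sub>0 'k) ring)"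
    using assms(2) by (simp add: cohen_macaulay_def)
  have dim: "dim (real_cone S) = CARD('p)"
    using assms(3) by (simp add: simplicial_def)
  interpret strong_exchange_semigroup S E A
  proof
    show "add_submonoid S" by (rule affine_semigroup_submonoid[OF assms(1)])
    show "finite (msg S)" by (rule finite_msg[OF assms(1)])
    show "E \<subseteq> msg S" unfolding assms(5) by (rule multiplicities_subset_msg[OF assms(1)])
    show "A = msg S - E" by (rule assms(6))
    show "\<exists>e\<in>E. \<exists>s\<in>S. x + y = e + s"
      if "x \<in> S" "y \<in> S" "x \<noteq> 0" "y \<noteq> 0" "x \<noteq> y" for x y
      using assms(4,5) that by (simp add: strong_def)
    show "\<exists>u\<in>S. s = f + u"
      if "e \<in> E" "f \<in> E" "e \<noteq> f" "s \<in> S" "t \<in> S" "e + s = f + t" for e f s t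
      using cohen_macaulay_exchange[OF assms(1) cm _ dim] assms(5,7) that by blast
  qed
  \<comment> \<open>For \<open>a\<close> in \<open>A\<close>, membership of \<open>2 *s a\<close> in
    the doubled set is automatic, so only the Apery condition distinguishes the last two
    sets.\<close>
  show ?thesis
    unfolding betti_elements_eq s_degree_critical by blast
qed

end
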